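(* Let $\{X_i:i\in[n]\}$, $[n]=\{1,\dots,n\}$, be real-valued random variables with $\mathbb{E}X_i=0$. Assume that for every $i\in[n]$ there is a set $A_i\subset[n]$ such that $X_i$ is independent of $\{X_j:j\notin A_i\}$, and that for every $i\in[n]$ and $j\in A_i$ there is a set $A_{ij}\supset A_i$, $A_{ij}\subset[n]$, such that $\{X_i,X_j\}$ is independent of $\{X_k:k\notin A_{ij}\}$. Let $\sigma^2=\mathrm{Var}(\sum_{i\in[n]}X_i)\in(0,\infty)$. Let $A\subset[n]$ and $B\subset[n]$ be two arbitrary nonempty index sets, let $\xi_A=h(X_A)\ge0$ be a nonnegative measurable function of $X_A=\{X_i:i\in A\}$, and let $$\bar V_A=\psi\Big(\sum_{k\in N_A^c}\sum_{l\in N_A^c\cap A_k}X_kX_l\Big),\qquad S_A=\sum_{k\in N_A^c}X_k,$$ $$\eta_{A,B}=a-c\sum_{m\in B}\frac{|X_m|}\sigma-\frac{c|S_A|Q_A}{\sigma},\qquad \zeta_{A,B}=b+c\sum_{m\in B}\frac{|X_m|}\sigma+\frac{c|S_A|Q_A}{\sigma},$$ where $$\psi(x)=\big((x\vee(0.25\sigma^2))\wedge(2\sigma^2)\big)^{1/2},\quad T_A^2=\frac1{\sigma^2}\sum_{k\in N_A}\sum_{l\in A_k}|X_kX_l|+\frac1{\sigma^2}\sum_{k\in N_A}\sum_{l\in N_k}|X_kX_l|,\quad Q_A=\min\{1,T_A\}\ (T_A\ge0),$$ and $a,b,c\in\mathbb{R}$ satisfy $a\le b$ and $c\ge1$. Then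 $$\mathbb{E}\{\xi_A\mathbf 1(\eta_{A,B}\le S_A/\bar V_A\le\zeta_{A,B})\}\le8755\,\|\xi_A\|_{4/3}\Big\{\frac{b-a}{1500}+\delta_1+\delta_2+\delta_3+\delta_4\Big\},$$ where $\lambda=\kappa\sum_{k\in[n]}\|X_k\|_2^2/\sigma^2$, $\delta_4\ge0$, and $$\delta_1=\frac c\sigma\sum_{m\in B}\|X_m\|_4,\qquad \delta_2=\frac{c\lambda\kappa^2|A|^2}{\sigma^3}\sum_{i=1}^n\|X_i\|_4^3,$$ $$\delta_3=\frac{c\lambda\kappa^{1/2}(\kappa+\tau^{1/2})|A|^{1/2}}{\sigma^2}\Big(\sum_{i=1}^n\|X_i\|_4^4\Big)^{1/2},\qquad \delta_4^2=\frac{\lambda^2c^2}{\sigma^2}\sum_{k\in N_A}\sum_{l\in N_k\cup A_k}\|X_k\|_4\|X_l\|_4.$$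
   Context: $\|X\|_p=(\mathbb{E}|X|^p)^{1/p}$; $x\vee y=\max(x,y)$, $x\wedge y=\min(x,y)$; $|A|$ is the cardinality of $A$. For $A\subset[n]$: $N_A=\{k\in[n]:A_k\cap A\ne\varnothing\}$, $N_A^c=[n]\setminus N_A$. For $i\in[n]$: $N_i=\{k\in[n]:i\in A_k\}$, $D_i=\{(k,l):k\in[n],\ l\in A_k,\ i\in A_{kl}\}$. The constants are $$\kappa=\max\Big\{\sup_{i\in[n]}|N_i|,\ \sup_{i\in[n],\,j\in A_i}|A_{ij}|\Big\},\qquad\tau=\sup_{i\in[n]}|D_i|.$$ *)

theory Defs
  imports "HOL-Probability.Probability"
begin

text \<open>Real powers on the extended nonnegative reals; meant for exponents \<open>p > 0\<close> only.\<close>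

definition ennreal_rpow :: "ennreal \<Rightarrow> real \<Rightarrow> ennreal" where
  "ennreal_rpow x p = (if x = \<infinity> then \<infinity> else ennreal (enn2real x powr p))"

text \<open>The \<open>L\<^sup>p\<close> norm takes the value \<open>\<infinity>\<close> when the \<open>p\<close>-th absolute moment is infinite.\<close>

definition Lp_norm :: "'a measure \<Rightarrow> real \<Rightarrow> ('a \<Rightarrow> real) \<Rightarrow> ennreal" where
  "Lp_norm M p Y = ennreal_rpow (\<integral>\<^sup>+ \<omega>. ennreal (\<bar>Y \<omega>\<bar> powr p) \<partial>M) (1 / p)"

text \<open>
  Throughout, \<open>nb i\<close> stands for the dependency neighbourhood \<open>A\<^sub>i\<close> and \<open>nb2 i j\<close> for
  \<open>A\<^sub>i\<^sub>j\<close>, while \<open>A\<close> is a set of indices. The sets \<open>N\<^sub>i\<close> (for an index) and \<open>N\<^sub>A\<close> (for a set)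
  are separate functions \<open>N_idx\<close> and \<open>N_set\<close>; \<open>N_set_compl\<close> is the complement in \<open>[n]\<close>.
\<close>

definition N_set :: "nat \<Rightarrow> (nat \<Rightarrow> nat set) \<Rightarrow> nat set \<Rightarrow> nat set" where
  "N_set n nb A = {k \<in> {1..n}. nb k \<inter> A \<noteq> {}}"

definition N_set_compl :: "nat \<Rightarrow> (nat \<Rightarrow> nat set) \<Rightarrow> nat set \<Rightarrow> nat set" where
  "N_set_compl n nb A = {1..n} - N_set n nb A"

definition N_idx :: "nat \<Rightarrow> (nat \<Rightarrow> nat set) \<Rightarrow> nat \<Rightarrow> nat set" where
  "N_idx n nb i = {k \<in> {1..n}. i \<in> nb k}"

definition D_idx ::
  "nat \<Rightarrow> (nat \<Rightarrow> nat set) \<Rightarrow> (nat \<Rightarrow> nat \<Rightarrow> nat set) \<Rightarrow> nat \<Rightarrow> (nat \<times> nat) set" where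
  "D_idx n nb nb2 i = {(k, l). k \<in> {1..n} \<and> l \<in> nb k \<and> i \<in> nb2 k l}"

text \<open>On \<open>nat\<close>, the supremum of the empty set is \<open>0\<close>.\<close>

definition kappa :: "nat \<Rightarrow> (nat \<Rightarrow> nat set) \<Rightarrow> (nat \<Rightarrow> nat \<Rightarrow> nat set) \<Rightarrow> nat" where
  "kappa n nb nb2 =
     max (SUP i\<in>{1..n}. card (N_idx n nb i))
         (SUP (i, j)\<in>(SIGMA i:{1..n}. nb i). card (nb2 i j))"

definition tau :: "nat \<Rightarrow> (nat \<Rightarrow> nat set) \<Rightarrow> (nat \<Rightarrow> nat \<Rightarrow> nat set) \<Rightarrow> nat" where
  "tau n nb nb2 = (SUP i\<in>{1..n}. card (D_idx n nb nb2 i))"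

definition psi :: "real \<Rightarrow> real \<Rightarrow> real" where
  "psi \<sigma> x = sqrt (min (max x (0.25 * \<sigma>\<^sup>2)) (2 * \<sigma>\<^sup>2))"

text \<open>
  Independence of families indexed by \<open>I\<close> and \<open>J\<close>, as independence of the two random vectors
  in the product spaces (equivalently, of the generated \<open>\<sigma>\<close>-algebras).
\<close>

definition indep_families ::
  "'a measure \<Rightarrow> (nat \<Rightarrow> 'a \<Rightarrow> real) \<Rightarrow> nat set \<Rightarrow> nat set \<Rightarrow> bool" where
  "indep_families M X I J \<longleftrightarrow>
     prob_space.indep_var M
       (Pi\<^sub>M I (\<lambda>_. borel)) (\<lambda>\<omega>. \<lambda>i\<in>I. X i \<omega>)
       (Pi\<^sub>M J (\<lambda>_. borel)) (\<lambda>\<omega>. \<lambda>j\<in>J. X j \<omega>)"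

end

theory Submission
  imports Defs
begin

text \<open>
  The proof is Stein's method combined with an induction on the constant. After division by
  \<open>\<sigma>\<close> the total sum has variance \<open>1\<close>. Let \<open>f\<close> be the antiderivative, as a function of
  \<open>S\<^sub>A / V\<^sub>A\<close>, of the trapezoid \<open>F\<close> that equals \<open>1\<close> on the random interval
  \<open>[\<eta>, \<zeta>]\<close> and falls to \<open>0\<close> linearly over a distance \<open>d\<close> on either side. For \<open>k\<close> in the
  complement of \<open>N\<^sub>A\<close>, the weight \<open>\<xi>\<close> and the version \<open>f\<^sub>k\<close> of \<open>f\<close> that ignores the
  indices in \<open>A\<^sub>k\<close> are jointly independent of \<open>X\<^sub>k\<close>, so \<open>E (\<xi> X\<^sub>k f\<^sub>k) = 0\<close> and
  \<open>E (\<xi> S\<^sub>A f) = E (\<xi> \<Sum>\<^sub>k X\<^sub>k (f - f\<^sub>k))\<close>. The left side is at most the length of the interval,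
  up to a constant. On the right, the linear part of the increments is \<open>E (\<xi> U F / V\<^sub>A)\<close> with
  \<open>U = \<Sum>\<^sub>k \<Sum>\<^sub>l X\<^sub>k X\<^sub>l\<close>, and \<open>U\<close> concentrates near \<open>1\<close>; so it dominates the probability
  that is to be estimated (\<open>pointwise_concentration\<close>, \<open>concentration_step\<close>).

  The second order part is supported where \<open>S\<^sub>A / V\<^sub>A\<close> is close to one of the two ramps of \<open>F\<close>,
  and there it is of order \<open>\<Sum>\<^sub>k |X\<^sub>k| Y\<^sub>k\<^sup>2 / d\<close>, where \<open>Y\<^sub>k\<close> is the sum over \<open>A\<^sub>k\<close>. A plain
  moment bound would lose a factor \<open>1 / d\<close>. Instead \<open>|X\<^sub>k| Y\<^sub>k\<^sup>2\<close> is bounded by cubes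
  \<open>|X\<^sub>i|\<^sup>3\<close>, and \<open>\<xi> |X\<^sub>i|\<^sup>3\<close> is again a weight of the permitted kind for the index set
  \<open>insert i A\<close>, to be integrated over a random interval around one with end points at distance
  \<open>d\<close>. Thus the inequality itself applies to the remainder. With \<open>d\<close> a large multiple of
  \<open>\<delta>\<^sub>1 + \<delta>\<^sub>2 + \<delta>\<^sub>3 + \<delta>\<^sub>4\<close>, the constant \<open>C\<close> in front of this sum is improved to
  \<open>4000 + C / 2\<close> (\<open>concentration_improve\<close>), while the constant in front of \<open>b - a\<close> is the same
  at every stage. Some constant works because \<open>\<delta>\<^sub>2 > 0\<close>; iterating gives \<open>8000\<close>
  (\<open>concentration_8000\<close>).

  The exponent \<open>4/3\<close> is what lets the induction close. Write \<open>\<xi> = v\<^sup>3\<close>. Then the norm of \<open>\<xi>\<close>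
  is the cube of the \<open>L\<^sup>4\<close> norm of \<open>v\<close>, the new weight is \<open>(v |X\<^sub>i|)\<^sup>3\<close>, and by independence
  \<open>v X\<^sub>i\<close> has \<open>L\<^sup>4\<close> norm equal to the product of the norms. Every moment that occurs is the
  expectation of a product of four functions in \<open>L\<^sup>4\<close> (\<open>L4_bound_mult4\<close>). The inputs are a
  variance bound for \<open>U\<close> (\<open>weighted_variance\<close>) and a bound for the fourth moment of \<open>S\<^sub>A\<close>
  (\<open>L4_S\<close>), both with respect to the weight \<open>v\<^sup>4\<close>.

  If some \<open>X\<^sub>i\<close> has infinite fourth moment, then the right side is infinite, except when
  \<open>\<xi>\<close> vanishes almost everywhere: \<open>\<delta>\<^sub>2\<close> is infinite, since \<open>\<lambda>\<close> cannot be \<open>0\<close>. The same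
  holds if the norm of \<open>\<xi>\<close> is infinite, since \<open>\<delta>\<^sub>2\<close> cannot be \<open>0\<close>.
\<close>

section \<open>Products of four functions in \<open>L\<^sup>4\<close>\<close>

text \<open>
  A relation between a function and an upper bound for its norm. It includes measurability and
  integrability, so that the premises of Hoelder's inequality take one uniform form.
\<close>

definition L4_bound :: "'a measure \<Rightarrow> ('a \<Rightarrow> real) \<Rightarrow> real \<Rightarrow> bool" where
  "L4_bound M f r \<longleftrightarrow> f \<in> borel_measurable M \<and> integrable M (\<lambda>\<omega>. f \<omega> ^ 4) \<and> 0 \<le> r \<and>
     (\<integral>\<omega>. f \<omega> ^ 4 \<partial>M) \<le> r ^ 4"

lemma am_gm4: "\<bar>a * b * c * d\<bar> \<le> (a ^ 4 + b ^ 4 + c ^ 4 + d ^ 4) / (4::real)"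
proof -
  have *: "2 * (x * y) \<le> x\<^sup>2 + y\<^sup>2" for x y :: real
    using sum_squares_bound[of x y] by (simp add: mult.assoc)
  have "4 * (\<bar>a\<bar> * \<bar>b\<bar> * (\<bar>c\<bar> * \<bar>d\<bar>)) \<le> 2 * ((\<bar>a\<bar> * \<bar>b\<bar>)\<^sup>2 + (\<bar>c\<bar> * \<bar>d\<bar>)\<^sup>2)"
    using *[of "\<bar>a\<bar> * \<bar>b\<bar>" "\<bar>c\<bar> * \<bar>d\<bar>"] by simp
  also have "\<dots> \<le> ((a\<^sup>2)\<^sup>2 + (b\<^sup>2)\<^sup>2) + ((c\<^sup>2)\<^sup>2 + (d\<^sup>2)\<^sup>2)"
    using *[of "a\<^sup>2" "b\<^sup>2"] *[of "c\<^sup>2" "d\<^sup>2"] by (simp add: power_mult_distrib)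
  finally show ?thesis by (simp add: abs_mult mult.assoc)
qed

text \<open>
  Hoelder's inequality with four equal exponents, from the inequality between the arithmetic and
  the geometric mean for the functions scaled to norm at most one. The bounds are first enlarged by
  \<open>e > 0\<close>, so that they can be divided by.
\<close>

lemma L4_bound_mult4:
  assumes "L4_bound M f1 r1" "L4_bound M f2 r2" "L4_bound M f3 r3" "L4_bound M f4 r4"
  shows "integrable M (\<lambda>\<omega>. f1 \<omega> * f2 \<omega> * f3 \<omega> * f4 \<omega>)"
    and "(\<integral>\<omega>. \<bar>f1 \<omega> * f2 \<omega> * f3 \<omega> * f4 \<omega>\<bar> \<partial>M) \<le> r1 * r2 * r3 * r4"
proof -
  note [measurable] = assms[unfolded L4_bound_def, THEN conjunct1]
  note int = assms[unfolded L4_bound_def, THEN conjunct2, THEN conjunct1]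
  note pos = assms[unfolded L4_bound_def, THEN conjunct2, THEN conjunct2, THEN conjunct1]
  note bd = assms[unfolded L4_bound_def, THEN conjunct2, THEN conjunct2, THEN conjunct2]
  have i: "integrable M (\<lambda>\<omega>. (f1 \<omega> ^ 4 + f2 \<omega> ^ 4 + f3 \<omega> ^ 4 + f4 \<omega> ^ 4) / 4)"
    using int by auto
  show int4: "integrable M (\<lambda>\<omega>. f1 \<omega> * f2 \<omega> * f3 \<omega> * f4 \<omega>)"
  proof (rule Bochner_Integration.integrable_bound[OF i])
    show "AE \<omega> in M. norm (f1 \<omega> * f2 \<omega> * f3 \<omega> * f4 \<omega>)
        \<le> norm ((f1 \<omega> ^ 4 + f2 \<omega> ^ 4 + f3 \<omega> ^ 4 + f4 \<omega> ^ 4) / 4)"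
      unfolding real_norm_def by (intro AE_I2 order_trans[OF am_gm4] abs_ge_self)
  qed measurable
  have key: "(\<integral>\<omega>. \<bar>f1 \<omega> * f2 \<omega> * f3 \<omega> * f4 \<omega>\<bar> \<partial>M) \<le> (r1 + e) * (r2 + e) * (r3 + e) * (r4 + e)"
    if e: "e > 0" for e
  proof -
    define s where "s = (r1 + e) * (r2 + e) * (r3 + e) * (r4 + e)"
    have p: "r1 + e > 0" "r2 + e > 0" "r3 + e > 0" "r4 + e > 0" using pos e by auto
    then have s: "s > 0" by (simp add: s_def)
    let ?g = "\<lambda>\<omega>. s * (((f1 \<omega> / (r1 + e)) ^ 4 + (f2 \<omega> / (r2 + e)) ^ 4 + (f3 \<omega> / (r3 + e)) ^ 4 + (f4 \<omega> / (r4 + e)) ^ 4) / 4)"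
    have one: "(\<integral>\<omega>. (f \<omega> / (r + e)) ^ 4 \<partial>M) \<le> 1" if "(\<integral>\<omega>. f \<omega> ^ 4 \<partial>M) \<le> r ^ 4" "0 \<le> r" for f r
    proof -
      have "(\<integral>\<omega>. (f \<omega> / (r + e)) ^ 4 \<partial>M) = (\<integral>\<omega>. f \<omega> ^ 4 \<partial>M) / (r + e) ^ 4"
        by (simp add: power_divide)
      also have "\<dots> \<le> r ^ 4 / (r + e) ^ 4" using that e by (intro divide_right_mono) auto
      also have "\<dots> \<le> 1" using that e by (auto simp: divide_le_eq intro!: power_mono)
      finally show ?thesis .
    qed
    have I: "integrable M (\<lambda>\<omega>. (f \<omega> / (r + e)) ^ 4)" if "integrable M (\<lambda>\<omega>. f \<omega> ^ 4)" for f r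
      using that by (simp add: power_divide)
    have G: "\<bar>(p1 * q1) * (p2 * q2) * (p3 * q3) * (p4 * q4)\<bar> = (p1 * p2 * p3 * p4) * \<bar>q1 * q2 * q3 * q4\<bar>"
      if "p1 > 0" "p2 > 0" "p3 > 0" "p4 > 0" for p1 p2 p3 p4 q1 q2 q3 q4 :: real
      using that by (simp add: abs_mult)
    note I' = I[OF int(1), of r1] I[OF int(2), of r2] I[OF int(3), of r3] I[OF int(4), of r4]
    have "(\<integral>\<omega>. \<bar>f1 \<omega> * f2 \<omega> * f3 \<omega> * f4 \<omega>\<bar> \<partial>M) \<le> (\<integral>\<omega>. ?g \<omega> \<partial>M)"
    proof (rule integral_mono)
      show "integrable M (\<lambda>\<omega>. \<bar>f1 \<omega> * f2 \<omega> * f3 \<omega> * f4 \<omega>\<bar>)" using int4 by simp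
      show "integrable M ?g" using I' by simp
      fix \<omega>
      have "\<bar>f1 \<omega> * f2 \<omega> * f3 \<omega> * f4 \<omega>\<bar>
          = s * \<bar>(f1 \<omega> / (r1 + e)) * (f2 \<omega> / (r2 + e)) * (f3 \<omega> / (r3 + e)) * (f4 \<omega> / (r4 + e))\<bar>"
        unfolding s_def using G[OF p, of "f1 \<omega> / (r1 + e)" "f2 \<omega> / (r2 + e)" "f3 \<omega> / (r3 + e)" "f4 \<omega> / (r4 + e)"] p
        by simp
      also have "\<dots> \<le> ?g \<omega>" using s by (intro mult_left_mono am_gm4) auto
      finally show "\<bar>f1 \<omega> * f2 \<omega> * f3 \<omega> * f4 \<omega>\<bar> \<le> ?g \<omega>" .
    qed
    also have "\<dots> = s * (((\<integral>\<omega>. (f1 \<omega> / (r1 + e)) ^ 4 \<partial>M) + (\<integral>\<omega>. (f2 \<omega> / (r2 + e)) ^ 4 \<partial>M)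
        + (\<integral>\<omega>. (f3 \<omega> / (r3 + e)) ^ 4 \<partial>M) + (\<integral>\<omega>. (f4 \<omega> / (r4 + e)) ^ 4 \<partial>M)) / 4)"
      using I' by simp
    also have "\<dots> \<le> s * 1"
      using one[OF bd(1) pos(1)] one[OF bd(2) pos(2)] one[OF bd(3) pos(3)] one[OF bd(4) pos(4)] s
      by (intro mult_left_mono) auto
    finally show ?thesis by (simp add: s_def)
  qed
  show "(\<integral>\<omega>. \<bar>f1 \<omega> * f2 \<omega> * f3 \<omega> * f4 \<omega>\<bar> \<partial>M) \<le> r1 * r2 * r3 * r4"
  proof (rule tendsto_lowerbound)
    show "((\<lambda>e. (r1 + e) * (r2 + e) * (r3 + e) * (r4 + e)) \<longlongrightarrow> r1 * r2 * r3 * r4) (at_right 0)"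
      by (auto intro!: tendsto_eq_intros)
    show "\<forall>\<^sub>F e in at_right 0. (\<integral>\<omega>. \<bar>f1 \<omega> * f2 \<omega> * f3 \<omega> * f4 \<omega>\<bar> \<partial>M) \<le> (r1 + e) * (r2 + e) * (r3 + e) * (r4 + e)"
      using key by (auto simp: eventually_at_filter)
  qed simp
qed

text \<open>
  A square integrable function enters a product as two factors in \<open>L\<^sup>4\<close>.
\<close>

lemma L4_bound_sqrt_abs:
  assumes "f \<in> borel_measurable M" "integrable M (\<lambda>\<omega>. (f \<omega>)\<^sup>2)" "(\<integral>\<omega>. (f \<omega>)\<^sup>2 \<partial>M) \<le> r\<^sup>2" "0 \<le> r"
  shows "L4_bound M (\<lambda>\<omega>. sqrt \<bar>f \<omega>\<bar>) (sqrt r)"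
proof -
  have "sqrt \<bar>y\<bar> ^ 4 = y\<^sup>2" for y :: real
    using power_mult[of "sqrt \<bar>y\<bar>" 2 2] by simp
  moreover have "sqrt r ^ 4 = r\<^sup>2" using power_mult[of "sqrt r" 2 2] assms(4) by simp
  ultimately show ?thesis using assms unfolding L4_bound_def by auto
qed

lemma am_gm3: 
  assumes "0 \<le> a" "0 \<le> b" "0 \<le> (c::real)"
  shows "a * b * c \<le> (a ^ 3 + b ^ 3 + c ^ 3) / 3"
proof -
  have "a ^ 3 + b ^ 3 + c ^ 3 - 3 * (a * b * c) = (a + b + c) * ((a - b)\<^sup>2 + (b - c)\<^sup>2 + (c - a)\<^sup>2) / 2"
    by algebra
  also have "\<dots> \<ge> 0" using assms by simp
  finally show ?thesis by simp
qed

lemma cube_mult_le: "0 \<le> a \<Longrightarrow> 0 \<le> b \<Longrightarrow> a ^ 3 * b \<le> (3 * a ^ 4 + b ^ 4) / (4::real)"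
  using am_gm4[of a a a b] by (simp add: power3_eq_cube mult.assoc)

section \<open>A trapezoid and its antiderivative\<close>

definition clamp01 :: "real \<Rightarrow> real" where "clamp01 t = max 0 (min 1 t)"

text \<open>
  The antiderivative of \<open>clamp01 (t / d)\<close> that vanishes at \<open>0\<close>: a smoothed positive part.
\<close>

definition soft_pos :: "real \<Rightarrow> real \<Rightarrow> real" where
  "soft_pos d t = ((max 0 t)\<^sup>2 - (max 0 (t - d))\<^sup>2) / (2 * d)"

text \<open>
  The odd antiderivative of the trapezoid \<open>ramp_slope d h\<close>, whose top is \<open>[-h, h]\<close> and whose sides
  have horizontal length \<open>d\<close>. A closed form in \<open>h\<close> is used because \<open>h\<close> will be random, and the
  dependence on \<open>h\<close> has to be controlled as well.
\<close>

definition ramp :: "real \<Rightarrow> real \<Rightarrow> real \<Rightarrow> real" where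
  "ramp d h y = y - soft_pos d (y - h) + soft_pos d (- y - h)"

definition ramp_slope :: "real \<Rightarrow> real \<Rightarrow> real \<Rightarrow> real" where
  "ramp_slope d h y = clamp01 ((h + d - \<bar>y\<bar>) / d)"

lemma DERIV_pos_part_square: "((\<lambda>t::real. (max 0 t)\<^sup>2) has_real_derivative 2 * max 0 t) (at t)"
proof (cases t "0::real" rule: linorder_cases)
  case less
  have "((\<lambda>t::real. 0) has_real_derivative 0) (at t)" by simp
  then have "((\<lambda>t::real. (max 0 t)\<^sup>2) has_real_derivative 0) (at t)"
    by (rule has_field_derivative_transform_within_open[where S="{..<0}"]) (use less in auto)
  then show ?thesis using less by simp
next
  case greater
  have "((\<lambda>t::real. t\<^sup>2) has_real_derivative 2 * t) (at t)" 
    by (auto intro!: derivative_eq_intros)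
  then have "((\<lambda>t::real. (max 0 t)\<^sup>2) has_real_derivative 2 * t) (at t)"
    by (rule has_field_derivative_transform_within_open[where S="{0<..}"]) (use greater in auto)
  then show ?thesis using greater by simp
next
  case equal
  have "((\<lambda>h. (max 0 (0 + h))\<^sup>2 / h) \<longlongrightarrow> (0::real)) (at 0)"
  proof (rule tendsto_rabs_zero_cancel, rule tendsto_sandwich)
    show "\<forall>\<^sub>F h::real in at 0. (0::real) \<le> \<bar>(max 0 (0 + h))\<^sup>2 / h\<bar>" by simp
    show "\<forall>\<^sub>F h::real in at 0. \<bar>(max 0 (0 + h))\<^sup>2 / h\<bar> \<le> \<bar>h\<bar>"
      by (intro always_eventually allI) (auto simp: max_def power2_eq_square abs_mult)
    show "((\<lambda>h::real. \<bar>h\<bar>) \<longlongrightarrow> 0) (at 0)" by (auto intro!: tendsto_eq_intros)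
  qed auto
  then show ?thesis using equal by (simp add: DERIV_def)
qed

lemma DERIV_soft_pos:
  assumes "d > 0"
  shows "(soft_pos d has_real_derivative clamp01 (t / d)) (at t)"
proof -
  have "((\<lambda>t. (max 0 (t - d))\<^sup>2) has_real_derivative 2 * max 0 (t - d) * 1) (at t)"
    by (rule DERIV_chain2[OF DERIV_pos_part_square, where g="\<lambda>t. t - d"])
      (auto intro!: derivative_eq_intros)
  then have "((\<lambda>t. ((max 0 t)\<^sup>2 - (max 0 (t - d))\<^sup>2) / (2 * d)) has_real_derivative
      (2 * max 0 t - 2 * max 0 (t - d) * 1) / (2 * d)) (at t)"
    by (intro DERIV_cdivide DERIV_diff DERIV_pos_part_square)
  moreover have "(2 * max 0 t - 2 * max 0 (t - d) * 1) / (2 * d) = clamp01 (t / d)"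
    using assms by (auto simp: clamp01_def max_def min_def field_simps)
  ultimately show ?thesis unfolding soft_pos_def[abs_def] by simp
qed

lemma soft_pos_cases:
  assumes "d > 0"
  shows "t \<le> 0 \<Longrightarrow> soft_pos d t = 0" "t \<ge> d \<Longrightarrow> soft_pos d t = t - d / 2"
  using assms by (auto simp: soft_pos_def max_def field_simps power2_eq_square)

lemma soft_pos_bounds:
  assumes "d > 0"
  shows "0 \<le> soft_pos d t" "t - d \<le> soft_pos d t" "soft_pos d t \<le> max 0 t"
proof -
  consider "t \<le> 0" | "0 < t" "t < d" | "t \<ge> d" by linarith
  then have "0 \<le> soft_pos d t \<and> t - d \<le> soft_pos d t \<and> soft_pos d t \<le> max 0 t"
  proof cases
    case 2
    then have "soft_pos d t = t\<^sup>2 / (2 * d)" by (simp add: soft_pos_def max_def)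
    moreover have "t\<^sup>2 / (2 * d) \<le> t" using 2
      by (simp add: power2_eq_square divide_le_eq)
    moreover have "0 \<le> t\<^sup>2 / (2 * d)" using assms by simp
    ultimately show ?thesis using 2 by (smt (verit))
  qed (use assms soft_pos_cases[OF assms] in auto)
  then show "0 \<le> soft_pos d t" "t - d \<le> soft_pos d t" "soft_pos d t \<le> max 0 t" by auto
qed

lemma abs_ramp_le:
  assumes "d > 0" "h \<ge> 0"
  shows "\<bar>ramp d h y\<bar> \<le> h + d"
proof (cases "y \<ge> 0")
  case True
  then show ?thesis
    using soft_pos_bounds[OF assms(1), of "y - h"] soft_pos_cases(1)[OF assms(1), of "- y - h"] assms
    by (auto simp: ramp_def)
next
  case False
  then show ?thesis
    using soft_pos_bounds[OF assms(1), of "- y - h"] soft_pos_cases(1)[OF assms(1), of "y - h"] assms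
    by (auto simp: ramp_def)
qed

lemma DERIV_ramp:
  assumes "d > 0" "h \<ge> 0"
  shows "(ramp d h has_real_derivative ramp_slope d h y) (at y)"
proof -
  have 1: "((\<lambda>y. soft_pos d (y - h)) has_real_derivative clamp01 ((y - h) / d) * 1) (at y)"
    by (rule DERIV_chain2[OF DERIV_soft_pos[OF assms(1)], where g="\<lambda>y. y - h"])
      (auto intro!: derivative_eq_intros)
  have 2: "((\<lambda>y. soft_pos d (- y - h)) has_real_derivative clamp01 ((- y - h) / d) * (-1)) (at y)"
    by (rule DERIV_chain2[OF DERIV_soft_pos[OF assms(1)], where g="\<lambda>y. - y - h"])
      (auto intro!: derivative_eq_intros)
  have "(ramp d h has_real_derivative (1 - clamp01 ((y - h) / d) * 1 + clamp01 ((- y - h) / d) * (-1))) (at y)"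
    unfolding ramp_def[abs_def] by (intro DERIV_add DERIV_diff DERIV_ident 1 2)
  moreover have "1 - clamp01 ((y - h) / d) * 1 + clamp01 ((- y - h) / d) * (-1) = ramp_slope d h y"
  proof (cases "y \<ge> 0")
    case True
    then show ?thesis using assms
      by (auto simp: ramp_slope_def clamp01_def max_def min_def field_simps)
  next
    case False
    then show ?thesis using assms
      by (auto simp: ramp_slope_def clamp01_def max_def min_def field_simps)
  qed
  ultimately show ?thesis by simp
qed

lemma ramp_slope_bounds: "0 \<le> ramp_slope d h y" "ramp_slope d h y \<le> 1"
  by (auto simp: ramp_slope_def clamp01_def)

lemma ramp_slope_eq_1: "d > 0 \<Longrightarrow> \<bar>y\<bar> \<le> h \<Longrightarrow> ramp_slope d h y = 1"
  by (auto simp: ramp_slope_def clamp01_def max_def min_def field_simps)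

lemma ramp_slope_eq_0: "d > 0 \<Longrightarrow> \<bar>y\<bar> \<ge> h + d \<Longrightarrow> ramp_slope d h y = 0"
  by (auto simp: ramp_slope_def clamp01_def max_def min_def field_simps)

lemma MVT_real:
  fixes f :: "real \<Rightarrow> real"
  assumes "\<And>z. (f has_real_derivative f' z) (at z)"
  obtains z where "\<bar>z - x\<bar> \<le> \<bar>y - x\<bar>" "f y - f x = (y - x) * f' z"
proof (cases x y rule: linorder_cases)
  case less
  from MVT2[OF less assms] obtain z where "z > x" "z < y" "f y - f x = (y - x) * f' z" by auto
  then show ?thesis using that[of z] by auto
next
  case greater
  from MVT2[OF greater assms] obtain z where z: "z > y" "z < x" "f x - f y = (x - y) * f' z" by auto
  have "f y - f x = (y - x) * f' z" using z(3) by (simp add: algebra_simps)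
  then show ?thesis using that[of z] z by auto
qed (use that in auto)

text \<open>
  The derivative in \<open>h\<close> is a difference of two numbers in \<open>[0, 1]\<close>, so a change of the half-width
  costs no more than a shift of the argument.
\<close>

lemma ramp_lipschitz:
  assumes "d > 0" "h \<ge> 0" "h' \<ge> 0"
  shows "\<bar>ramp d h y - ramp d h' y'\<bar> \<le> \<bar>y - y'\<bar> + \<bar>h - h'\<bar>"
proof -
  obtain z where "ramp d h y - ramp d h y' = (y - y') * ramp_slope d h z"
    using MVT_real[OF DERIV_ramp[OF assms(1,2)]] by metis
  then have 1: "\<bar>ramp d h y - ramp d h y'\<bar> \<le> \<bar>y - y'\<bar>"
    using ramp_slope_bounds[of d h z] by (simp add: abs_mult mult_left_le)
  have D: "((\<lambda>h. ramp d h y') has_real_derivative clamp01 ((y' - h) / d) - clamp01 ((- y' - h) / d)) (at h)" for h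
  proof -
    have 1: "((\<lambda>h. soft_pos d (y' - h)) has_real_derivative clamp01 ((y' - h) / d) * (-1)) (at h)"
      by (rule DERIV_chain2[OF DERIV_soft_pos[OF assms(1)], where g="\<lambda>h. y' - h"])
        (auto intro!: derivative_eq_intros)
    have 2: "((\<lambda>h. soft_pos d (- y' - h)) has_real_derivative clamp01 ((- y' - h) / d) * (-1)) (at h)"
      by (rule DERIV_chain2[OF DERIV_soft_pos[OF assms(1)], where g="\<lambda>h. - y' - h"])
        (auto intro!: derivative_eq_intros)
    have "((\<lambda>h. ramp d h y') has_real_derivative (0 - clamp01 ((y' - h) / d) * (-1) + clamp01 ((- y' - h) / d) * (-1))) (at h)"
      unfolding ramp_def by (intro DERIV_add DERIV_diff DERIV_const 1 2)
    then show ?thesis by simp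
  qed
  obtain z where "ramp d h y' - ramp d h' y' = (h - h') * (clamp01 ((y' - z) / d) - clamp01 ((- y' - z) / d))"
    using MVT_real[OF D] by metis
  moreover have "\<bar>clamp01 s - clamp01 t\<bar> \<le> 1" for s t by (auto simp: clamp01_def)
  ultimately have 2: "\<bar>ramp d h y' - ramp d h' y'\<bar> \<le> \<bar>h - h'\<bar>"
    by (simp add: abs_mult mult_left_le)
  from 1 2 show ?thesis by linarith
qed

text \<open>
  The slope is \<open>1 / d\<close>-Lipschitz, and constant away from the two sides of the trapezoid. Hence the
  linear approximation is exact unless the segment between the two arguments comes near a side.
  Keeping this indicator in the error is what makes the induction possible.
\<close>

lemma ramp_taylor:
  assumes d: "d > 0" and h: "h \<ge> 0"
  shows "\<bar>ramp d h y - ramp d h (y - u) - u * ramp_slope d h y\<bar>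
    \<le> u\<^sup>2 / d * (if h - \<bar>u\<bar> \<le> \<bar>y\<bar> \<and> \<bar>y\<bar> \<le> h + d + \<bar>u\<bar> then 1 else 0)"
proof -
  consider "\<bar>y\<bar> < h - \<bar>u\<bar>" | "\<bar>y\<bar> > h + d + \<bar>u\<bar>" | "h - \<bar>u\<bar> \<le> \<bar>y\<bar>" "\<bar>y\<bar> \<le> h + d + \<bar>u\<bar>" by linarith
  then show ?thesis
  proof cases
    case 1
    then show ?thesis using soft_pos_cases(1)[OF d] ramp_slope_eq_1[OF d, of y h]
      by (auto simp: ramp_def)
  next
    case 2
    then have 0: "ramp_slope d h y = 0" using d by (intro ramp_slope_eq_0) auto
    show ?thesis
    proof (cases "y \<ge> 0")
      case True
      then show ?thesis using 2 0 h d soft_pos_cases[OF d] by (auto simp: ramp_def)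
    next
      case False
      then show ?thesis using 2 0 h d soft_pos_cases[OF d] by (auto simp: ramp_def)
    qed
  next
    case 3
    obtain z where z: "\<bar>z - y\<bar> \<le> \<bar>(y - u) - y\<bar>" 
      and z1: "ramp d h (y - u) - ramp d h y = ((y - u) - y) * ramp_slope d h z"
      using MVT_real[OF DERIV_ramp[OF assms]] by metis
    have "\<bar>ramp_slope d h z - ramp_slope d h y\<bar> \<le> \<bar>(h + d - \<bar>z\<bar>) / d - (h + d - \<bar>y\<bar>) / d\<bar>"
      unfolding ramp_slope_def clamp01_def by linarith
    also have "\<dots> = \<bar>\<bar>y\<bar> - \<bar>z\<bar>\<bar> / d" using d by (simp flip: diff_divide_distrib)
    also have "\<dots> \<le> \<bar>u\<bar> / d" using z d by (intro divide_right_mono) auto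
    finally have l: "\<bar>ramp_slope d h z - ramp_slope d h y\<bar> \<le> \<bar>u\<bar> / d" .
    have "ramp d h y - ramp d h (y - u) - u * ramp_slope d h y = u * (ramp_slope d h z - ramp_slope d h y)"
      using z1 by (simp add: algebra_simps)
    then have "\<bar>ramp d h y - ramp d h (y - u) - u * ramp_slope d h y\<bar> = \<bar>u\<bar> * \<bar>ramp_slope d h z - ramp_slope d h y\<bar>"
      by (simp add: abs_mult)
    also have "\<dots> \<le> \<bar>u\<bar> * (\<bar>u\<bar> / d)" using l by (intro mult_left_mono) auto
    also have "\<dots> = u\<^sup>2 / d" by (simp add: power2_eq_square)
    finally show ?thesis using 3 by simp
  qed
qed

lemma borel_measurable_ramp[measurable]:
  assumes [measurable]: "f \<in> borel_measurable N" "g \<in> borel_measurable N"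
  shows "(\<lambda>x. ramp d (f x) (g x)) \<in> borel_measurable N"
  unfolding ramp_def soft_pos_def by measurable

lemma borel_measurable_ramp_slope[measurable]:
  assumes [measurable]: "f \<in> borel_measurable N" "g \<in> borel_measurable N"
  shows "(\<lambda>x. ramp_slope d (f x) (g x)) \<in> borel_measurable N"
  unfolding ramp_slope_def clamp01_def by measurable

section \<open>The truncated standard deviation\<close>

lemma psi_1_bounds: "1 / 2 \<le> psi 1 x" "psi 1 x \<le> sqrt 2"
proof -
  have "sqrt (1 / 4) \<le> psi 1 x" unfolding psi_def by (intro real_sqrt_le_mono) auto
  then show "1 / 2 \<le> psi 1 x" by (simp add: real_sqrt_divide)
  show "psi 1 x \<le> sqrt 2" unfolding psi_def by (intro real_sqrt_le_mono) auto
qed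

lemma inverse_psi_1_bounds: "0.7 \<le> 1 / psi 1 x" "1 / psi 1 x \<le> 2"
proof -
  have p: "psi 1 x > 0" using psi_1_bounds(1)[of x] by simp
  have "sqrt 2 \<le> 1.42" by (rule real_le_lsqrt) (auto simp: power2_eq_square)
  then have "psi 1 x * 0.7 \<le> 1" using psi_1_bounds(2)[of x] by simp
  then show "0.7 \<le> 1 / psi 1 x" using p by (simp add: field_simps)
  show "1 / psi 1 x \<le> 2" using psi_1_bounds(1)[of x] p by (simp add: field_simps)
qed

lemma inverse_psi_1_lipschitz: "\<bar>1 / psi 1 x - 1 / psi 1 y\<bar> \<le> 4 * \<bar>x - y\<bar>"
proof -
  let ?p = "psi 1 x" and ?q = "psi 1 y"
  have b: "?p \<ge> 1/2" "?q \<ge> 1/2" using psi_1_bounds by auto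
  have sq: "(psi 1 z)\<^sup>2 = min (max z 0.25) 2" for z
    unfolding psi_def by simp
  have "\<bar>?p - ?q\<bar> * 1 \<le> \<bar>?p - ?q\<bar> * (?p + ?q)" using b by (intro mult_left_mono) auto
  also have "\<dots> = \<bar>(?p - ?q) * (?p + ?q)\<bar>" using b by (simp add: abs_mult)
  also have "\<dots> = \<bar>?p\<^sup>2 - ?q\<^sup>2\<bar>" by (simp add: power2_eq_square algebra_simps)
  also have "\<dots> \<le> \<bar>x - y\<bar>" unfolding sq by auto
  finally have 1: "\<bar>?p - ?q\<bar> \<le> \<bar>x - y\<bar>" by simp
  have "1 / ?p - 1 / ?q = (?q - ?p) * ((1 / ?p) * (1 / ?q))" using b by (simp add: field_simps)
  then have "\<bar>1 / ?p - 1 / ?q\<bar> = \<bar>?p - ?q\<bar> * ((1 / ?p) * (1 / ?q))"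
    using b by (simp add: abs_mult abs_minus_commute)
  also have "\<dots> \<le> \<bar>?p - ?q\<bar> * (2 * 2)"
    using inverse_psi_1_bounds b by (intro mult_left_mono mult_mono) auto
  also have "\<dots> \<le> 4 * \<bar>x - y\<bar>" using 1 by simp
  finally show ?thesis .
qed

section \<open>Locally dependent random variables with unit variance\<close>

text \<open>
  The sum is normalised to variance \<open>1\<close>, and all fourth moments are finite. The numbers \<open>\<kappa>\<close> and
  \<open>\<tau>\<close> are only required to be upper bounds for the sizes of the neighbourhoods.
\<close>

locale local_dependence = prob_space M for M :: "'a measure" +
  fixes n :: nat and X :: "nat \<Rightarrow> 'a \<Rightarrow> real"
    and nb :: "nat \<Rightarrow> nat set" and nb2 :: "nat \<Rightarrow> nat \<Rightarrow> nat set"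
    and I :: "nat set" and \<kappa> \<tau> :: real
  assumes I_def: "I = {1..n}"
    and X_meas: "\<And>i. i \<in> I \<Longrightarrow> X i \<in> borel_measurable M"
    and X4_int: "\<And>i. i \<in> I \<Longrightarrow> integrable M (\<lambda>\<omega>. X i \<omega> ^ 4)"
    and mean_zero: "\<And>i. i \<in> I \<Longrightarrow> expectation (X i) = 0"
    and nb: "\<And>i. i \<in> I \<Longrightarrow> nb i \<subseteq> I"
    and indep1: "\<And>i. i \<in> I \<Longrightarrow> indep_families M X {i} (I - nb i)"
    and nb2: "\<And>i j. i \<in> I \<Longrightarrow> j \<in> nb i \<Longrightarrow> nb i \<subseteq> nb2 i j \<and> nb2 i j \<subseteq> I"
    and indep2: "\<And>i j. i \<in> I \<Longrightarrow> j \<in> nb i \<Longrightarrow> indep_families M X {i, j} (I - nb2 i j)"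
    and card_N_idx: "\<And>i. i \<in> I \<Longrightarrow> real (card (N_idx n nb i)) \<le> \<kappa>"
    and card_nb2: "\<And>i j. i \<in> I \<Longrightarrow> j \<in> nb i \<Longrightarrow> real (card (nb2 i j)) \<le> \<kappa>"
    and card_D_idx: "\<And>i. i \<in> I \<Longrightarrow> real (card (D_idx n nb nb2 i)) \<le> \<tau>"
    and variance_1: "expectation (\<lambda>\<omega>. (\<Sum>i\<in>I. X i \<omega>)\<^sup>2) = 1"
begin

abbreviation "Nb \<equiv> N_idx n nb"
abbreviation "NA \<equiv> N_set n nb"
abbreviation "K \<equiv> N_set_compl n nb"

text \<open>
  The \<open>\<sigma>\<close>-algebra generated by \<open>X\<^sub>i\<close>, \<open>i \<in> J\<close>. Being a function of \<open>X\<^sub>J\<close> is expressed as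
  measurability with respect to it, so that the closure properties of measurable functions apply.
\<close>

definition gen :: "nat set \<Rightarrow> 'a measure" where
  "gen J = vimage_algebra (space M) (\<lambda>\<omega>. \<lambda>i\<in>J. X i \<omega>) (Pi\<^sub>M J (\<lambda>_. borel))"

lemma space_gen[simp]: "space (gen J) = space M"
  by (simp add: gen_def)

lemma X_measurable_gen: "i \<in> J \<Longrightarrow> X i \<in> borel_measurable (gen J)"
proof -
  assume i: "i \<in> J"
  have "(\<lambda>\<omega>. \<lambda>i\<in>J. X i \<omega>) \<in> measurable (gen J) (Pi\<^sub>M J (\<lambda>_. borel))"
    unfolding gen_def by (rule measurable_vimage_algebra1) (auto simp: space_PiM)
  from measurable_compose[OF this measurable_component_singleton[OF i]]
  show ?thesis using i by simp
qed

lemma measurable_genI: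
  assumes f: "f \<in> borel_measurable (gen J)"
    and X: "\<And>i. i \<in> J \<Longrightarrow> X i \<in> borel_measurable N" and sp: "space N = space M"
  shows "f \<in> borel_measurable N"
proof -
  have "(\<lambda>x. x) \<in> measurable N (gen J)"
    unfolding gen_def
    by (rule measurable_vimage_algebra2) (auto simp: sp intro!: measurable_restrict X)
  from measurable_compose[OF this f] show ?thesis by simp
qed

lemma gen_mono: "f \<in> borel_measurable (gen J) \<Longrightarrow> J \<subseteq> L \<Longrightarrow> f \<in> borel_measurable (gen L)"
  by (erule measurable_genI) (auto intro: X_measurable_gen)

lemma gen_measurable: "f \<in> borel_measurable (gen J) \<Longrightarrow> J \<subseteq> I \<Longrightarrow> f \<in> borel_measurable M"
  by (erule measurable_genI) (auto intro: X_meas)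

lemma indep_var_gen:
  fixes f g :: "'a \<Rightarrow> real"
  assumes ind: "indep_families M X J L"
    and f: "f \<in> borel_measurable (gen J)" and g: "g \<in> borel_measurable (gen L)"
  shows "indep_var borel f borel g"
proof -
  note * = ind[unfolded indep_families_def indep_var_eq]
  have sp: "sigma_sets (space M) {h -` A \<inter> space M | A. A \<in> sets borel} \<subseteq> sets (gen J')"
    if "h \<in> borel_measurable (gen J')" for h :: "'a \<Rightarrow> real" and J'
  proof -
    have "{h -` A \<inter> space M | A. A \<in> sets borel} \<subseteq> sets (gen J')"
      using measurable_sets[OF that] by auto
    from sets.sigma_sets_subset[OF this] show ?thesis by simp
  qed
  have s: "sets (gen J') = sigma_sets (space M) {(\<lambda>\<omega>. \<lambda>i\<in>J'. X i \<omega>) -` A \<inter> space M |A. A \<in> sets (Pi\<^sub>M J' (\<lambda>_. borel))}" for J'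
    unfolding gen_def sets_vimage_algebra ..
  have i: "indep_set (sets (gen J)) (sets (gen L))" using * s by simp
  have sub: "sets (gen J) \<subseteq> sets M" "sets (gen L) \<subseteq> sets M"
    using indep_setD_ev1[OF i] indep_setD_ev2[OF i] by auto
  have "f \<in> borel_measurable M" "g \<in> borel_measurable M"
    using f g sub by (auto intro!: measurableI dest: measurable_sets simp: measurable_def)
  moreover have "indep_set (sigma_sets (space M) {f -` A \<inter> space M | A. A \<in> sets borel})
      (sigma_sets (space M) {g -` A \<inter> space M | A. A \<in> sets borel})"
    using i sp[OF f] sp[OF g] unfolding indep_sets2_eq by blast
  ultimately show ?thesis unfolding indep_var_eq by simp
qed

lemma indep1_gen:
  fixes f g :: "'a \<Rightarrow> real"
  assumes "k \<in> I" "J \<subseteq> I - nb k" "f \<in> borel_measurable (gen {k})" "g \<in> borel_measurable (gen J)"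
  shows "indep_var borel f borel g"
  using indep_var_gen[OF indep1[OF assms(1)] assms(3) gen_mono[OF assms(4,2)]] .

lemma indep2_gen:
  fixes f g :: "'a \<Rightarrow> real"
  assumes "k \<in> I" "l \<in> nb k" "J \<subseteq> I - nb2 k l" "f \<in> borel_measurable (gen {k, l})" "g \<in> borel_measurable (gen J)"
  shows "indep_var borel f borel g"
  using indep_var_gen[OF indep2[OF assms(1,2)] assms(4) gen_mono[OF assms(5,3)]] .

definition x :: "nat \<Rightarrow> real" where "x i = root 4 (expectation (\<lambda>\<omega>. X i \<omega> ^ 4))"

lemma x_nonneg[simp]: "0 \<le> x i"
  by (simp add: x_def)

lemma x_pow4: "x i ^ 4 = expectation (\<lambda>\<omega>. X i \<omega> ^ 4)"
  by (simp add: x_def)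

lemma L4_X: "i \<in> I \<Longrightarrow> L4_bound M (X i) (x i)"
  using X_meas[of i] X4_int[of i] x_pow4[of i] by (simp add: L4_bound_def)

lemma L4_1: "L4_bound M (\<lambda>_. 1) 1"
  by (simp add: L4_bound_def prob_space)

lemma integrable_XX: "i \<in> I \<Longrightarrow> j \<in> I \<Longrightarrow> integrable M (\<lambda>\<omega>. X i \<omega> * X j \<omega>)"
  using L4_bound_mult4(1)[OF L4_X L4_X L4_1 L4_1, of i j] by simp

lemma integrable_X: "i \<in> I \<Longrightarrow> integrable M (X i)"
  using L4_bound_mult4(1)[OF L4_X L4_1 L4_1 L4_1, of i] by simp

lemma expectation_abs_XX_le: "i \<in> I \<Longrightarrow> j \<in> I \<Longrightarrow> expectation (\<lambda>\<omega>. \<bar>X i \<omega> * X j \<omega>\<bar>) \<le> x i * x j"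
  using L4_bound_mult4(2)[OF L4_X L4_X L4_1 L4_1, of i j] by simp

lemma finite_I[simp]: "finite I" by (simp add: I_def)

lemma finite_nb[simp]: "i \<in> I \<Longrightarrow> finite (nb i)"
  by (rule finite_subset[OF nb finite_I])

lemma Nb_subset: "Nb i \<subseteq> I" by (auto simp: N_idx_def I_def)

lemma finite_Nb[simp]: "finite (Nb i)"
  by (rule finite_subset[OF Nb_subset finite_I])

lemma NA_subset: "NA A \<subseteq> I" by (auto simp: N_set_def I_def)

lemma K_subset: "K A \<subseteq> I" by (auto simp: N_set_compl_def I_def)

lemma finite_NA[simp]: "finite (NA A)"
  by (rule finite_subset[OF NA_subset finite_I])

lemma finite_K[simp]: "finite (K A)"
  by (rule finite_subset[OF K_subset finite_I])

lemma K_iff: "k \<in> K A \<longleftrightarrow> k \<in> I \<and> nb k \<inter> A = {}"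
  by (auto simp: N_set_compl_def N_set_def I_def)

lemma K_disjoint: "k \<in> K A \<Longrightarrow> A \<subseteq> I \<Longrightarrow> A \<subseteq> I - nb k"
  by (auto simp: K_iff)

text \<open>
  If \<open>k \<in> K A\<close>, then \<open>X\<^sub>k\<close> is independent of any function of \<open>X\<^sub>A\<close>, so multiplication by the
  weight \<open>v\<close> just multiplies the norms. Joint products such as \<open>X\<^sub>k X\<^sub>l\<close> need not be independent
  of \<open>X\<^sub>A\<close>; they are always split into single factors by Hoelder's inequality.
\<close>

lemma L4_weighted_X:
  assumes A: "A \<subseteq> I" and v: "v \<in> borel_measurable (gen A)" "L4_bound M v \<rho>" and k: "k \<in> K A"
  shows "L4_bound M (\<lambda>\<omega>. v \<omega> * X k \<omega>) (\<rho> * x k)"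
proof -
  have kI: "k \<in> I" using k K_subset by blast
  have [measurable]: "X k \<in> borel_measurable (gen {k})" by (rule X_measurable_gen) simp
  note [measurable] = v(1)
  have "indep_var borel (\<lambda>\<omega>. X k \<omega> ^ 4) borel (\<lambda>\<omega>. v \<omega> ^ 4)"
    by (rule indep1_gen[OF kI K_disjoint[OF k A]]) measurable
  note i = indep_var_integrable[OF this X4_int[OF kI]] indep_var_lebesgue_integral[OF this X4_int[OF kI]]
  have v4: "integrable M (\<lambda>\<omega>. v \<omega> ^ 4)" "expectation (\<lambda>\<omega>. v \<omega> ^ 4) \<le> \<rho> ^ 4" "0 \<le> \<rho>"
    using v by (auto simp: L4_bound_def)
  have "expectation (\<lambda>\<omega>. X k \<omega> ^ 4) * expectation (\<lambda>\<omega>. v \<omega> ^ 4) \<le> x k ^ 4 * \<rho> ^ 4"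
    unfolding x_pow4[symmetric] using v4 by (intro mult_left_mono) auto
  moreover have "(\<lambda>\<omega>. v \<omega> * X k \<omega>) \<in> borel_measurable M"
    using X_meas[OF kI] gen_measurable[OF v(1) A] by measurable
  ultimately show ?thesis
    using i[OF v4(1)] v4(3) unfolding L4_bound_def power_mult_distrib
    by (simp add: mult.commute[of "v _ ^ 4"] mult.commute[of "\<rho> ^ 4"])
qed

lemma card_nb: assumes "i \<in> I" shows "real (card (nb i)) \<le> \<kappa>"
proof (cases "nb i = {}")
  case True
  then show ?thesis using card_N_idx[OF assms] by simp
next
  case False
  then obtain j where j: "j \<in> nb i" by auto
  have "finite (nb2 i j)" using nb2[OF assms j] by (intro finite_subset[OF _ finite_I]) simp
  then have "card (nb i) \<le> card (nb2 i j)" using nb2[OF assms j] by (intro card_mono) auto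
  then show ?thesis using card_nb2[OF assms j] by simp
qed

lemma sum_nb_swap: "(\<Sum>k\<in>I. \<Sum>l\<in>nb k. f k l) = (\<Sum>l\<in>I. \<Sum>k\<in>Nb l. f k l)"
proof -
  have "(\<Sum>k\<in>I. \<Sum>l\<in>nb k. f k l) = (\<Sum>k\<in>I. \<Sum>l\<in>{l\<in>I. l \<in> nb k}. f k l)"
  proof (intro sum.cong refl)
    fix k assume "k \<in> I"
    from nb[OF this] show "nb k = {l\<in>I. l \<in> nb k}" by auto
  qed
  also have "\<dots> = (\<Sum>l\<in>I. \<Sum>k\<in>{k\<in>I. l \<in> nb k}. f k l)"
    by (rule sum.swap_restrict) auto
  finally show ?thesis by (simp add: N_idx_def I_def)
qed

context
  fixes g :: "nat \<Rightarrow> real"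
  assumes g: "\<And>i. i \<in> I \<Longrightarrow> 0 \<le> g i"
begin

lemma sum_nb_first: "(\<Sum>k\<in>I. \<Sum>l\<in>nb k. g k) \<le> \<kappa> * (\<Sum>k\<in>I. g k)"
  unfolding sum_constant sum_distrib_left
  by (intro sum_mono mult_right_mono) (auto simp: card_nb g)

lemma sum_Nb_first: "(\<Sum>k\<in>I. \<Sum>l\<in>Nb k. g k) \<le> \<kappa> * (\<Sum>k\<in>I. g k)"
  unfolding sum_constant sum_distrib_left
  by (intro sum_mono mult_right_mono) (auto simp: card_N_idx g)

lemma sum_nb_second: "(\<Sum>k\<in>I. \<Sum>l\<in>nb k. g l) \<le> \<kappa> * (\<Sum>k\<in>I. g k)"
  unfolding sum_nb_swap by (rule sum_Nb_first)

lemma sum_Nb_second: "(\<Sum>k\<in>I. \<Sum>l\<in>Nb k. g l) \<le> \<kappa> * (\<Sum>k\<in>I. g k)"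
  unfolding sum_nb_swap[symmetric] by (rule sum_nb_first)

end

definition lam :: real where "lam = \<kappa> * (\<Sum>i\<in>I. expectation (\<lambda>\<omega>. (X i \<omega>)\<^sup>2))"

lemma uncorrelated:
  assumes "k \<in> I" "l \<in> I" "l \<notin> nb k"
  shows "expectation (\<lambda>\<omega>. X k \<omega> * X l \<omega>) = 0"
proof -
  have "indep_var borel (X k) borel (X l)"
    by (rule indep1_gen[of k "{l}"]) (use assms in \<open>auto intro: X_measurable_gen\<close>)
  from indep_var_lebesgue_integral[OF this integrable_X integrable_X] assms
  show ?thesis using mean_zero by simp
qed

text \<open>
  Only the covariances of neighbours contribute to the variance.
\<close>

lemma sum_cov_eq_1: "(\<Sum>k\<in>I. \<Sum>l\<in>nb k. expectation (\<lambda>\<omega>. X k \<omega> * X l \<omega>)) = 1"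
proof -
  have "1 = expectation (\<lambda>\<omega>. \<Sum>k\<in>I. \<Sum>l\<in>I. X k \<omega> * X l \<omega>)"
    unfolding variance_1[symmetric] by (simp add: power2_eq_square sum_product)
  also have "\<dots> = (\<Sum>k\<in>I. \<Sum>l\<in>I. expectation (\<lambda>\<omega>. X k \<omega> * X l \<omega>))"
    by (subst Bochner_Integration.integral_sum, (intro Bochner_Integration.integrable_sum integrable_XX; assumption),
        intro sum.cong refl Bochner_Integration.integral_sum integrable_XX)
  also have "\<dots> = (\<Sum>k\<in>I. \<Sum>l\<in>nb k. expectation (\<lambda>\<omega>. X k \<omega> * X l \<omega>))"
    by (intro sum.cong refl sum.mono_neutral_right nb finite_I) (auto intro: uncorrelated)
  finally show ?thesis by simp
qed

lemma sum_abs_moment_le_lam: "(\<Sum>k\<in>I. \<Sum>l\<in>nb k. expectation (\<lambda>\<omega>. \<bar>X k \<omega> * X l \<omega>\<bar>)) \<le> lam"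
proof -
  let ?g = "\<lambda>i. expectation (\<lambda>\<omega>. (X i \<omega>)\<^sup>2)"
  have X2: "integrable M (\<lambda>\<omega>. (X i \<omega>)\<^sup>2)" if "i \<in> I" for i
    using integrable_XX[OF that that] by (simp add: power2_eq_square)
  have "expectation (\<lambda>\<omega>. \<bar>X k \<omega> * X l \<omega>\<bar>) \<le> (?g k + ?g l) / 2" if "k \<in> I" "l \<in> I" for k l
  proof -
    have "expectation (\<lambda>\<omega>. \<bar>X k \<omega> * X l \<omega>\<bar>) \<le> expectation (\<lambda>\<omega>. ((X k \<omega>)\<^sup>2 + (X l \<omega>)\<^sup>2) / 2)"
    proof (rule integral_mono)
      fix \<omega>
      show "\<bar>X k \<omega> * X l \<omega>\<bar> \<le> ((X k \<omega>)\<^sup>2 + (X l \<omega>)\<^sup>2) / 2"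
        using sum_squares_bound[of "\<bar>X k \<omega>\<bar>" "\<bar>X l \<omega>\<bar>"] by (simp add: abs_mult)
    qed (use that X2 integrable_XX in auto)
    then show ?thesis using X2 that by simp
  qed
  then have "(\<Sum>k\<in>I. \<Sum>l\<in>nb k. expectation (\<lambda>\<omega>. \<bar>X k \<omega> * X l \<omega>\<bar>)) \<le> (\<Sum>k\<in>I. \<Sum>l\<in>nb k. (?g k + ?g l) / 2)"
    by (intro sum_mono) (use nb in \<open>simp add: subset_iff\<close>)
  also have "\<dots> = ((\<Sum>k\<in>I. \<Sum>l\<in>nb k. ?g k) + (\<Sum>k\<in>I. \<Sum>l\<in>nb k. ?g l)) / 2"
    by (simp add: sum.distrib flip: sum_divide_distrib)
  also have "\<dots> \<le> lam"
    using sum_nb_first[of ?g] sum_nb_second[of ?g] unfolding lam_def by simp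
  finally show ?thesis .
qed

lemma lam_ge_1: "1 \<le> lam"
proof -
  have "(\<Sum>k\<in>I. \<Sum>l\<in>nb k. expectation (\<lambda>\<omega>. X k \<omega> * X l \<omega>)) \<le> (\<Sum>k\<in>I. \<Sum>l\<in>nb k. expectation (\<lambda>\<omega>. \<bar>X k \<omega> * X l \<omega>\<bar>))"
    by (intro sum_mono order_trans[OF abs_ge_self integral_abs_bound])
  then show ?thesis using sum_cov_eq_1 sum_abs_moment_le_lam by simp
qed

lemma kappa_pos: "\<kappa> > 0"
proof (rule ccontr)
  assume "\<not> \<kappa> > 0"
  then have "lam \<le> 0" unfolding lam_def by (intro mult_nonpos_nonneg sum_nonneg) auto
  then show False using lam_ge_1 by simp
qed

end

section \<open>Weighted variance of a sum over neighbouring pairs\<close>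

context local_dependence
begin

text \<open>
  The index set of the double sum inside \<open>\<psi>\<close>.
\<close>

definition pairs :: "nat set \<Rightarrow> (nat \<times> nat) set" where
  "pairs A = (SIGMA k:K A. K A \<inter> nb k)"

definition sum_x4 :: real where "sum_x4 = (\<Sum>i\<in>I. x i ^ 4)"

text \<open>
  The natural size of the variance of sums over \<open>pairs A\<close>; \<open>\<delta>\<^sub>3\<close> dominates its square root.
\<close>

definition var_scale :: "nat set \<Rightarrow> real" where
  "var_scale A = \<kappa> * (\<kappa>\<^sup>2 + \<tau> * card A) * sum_x4"

lemma finite_pairs[simp]: "finite (pairs A)"
  unfolding pairs_def by (intro finite_SigmaI) auto

lemma pairs_iff: "j \<in> pairs A \<longleftrightarrow> fst j \<in> K A \<and> snd j \<in> K A \<and> snd j \<in> nb (fst j)"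
  by (cases j) (auto simp: pairs_def)

lemma sum_pairs: "(\<Sum>j\<in>pairs A. f (fst j) (snd j)) = (\<Sum>k\<in>K A. \<Sum>l\<in>K A \<inter> nb k. f k l)"
  unfolding pairs_def by (subst sum.Sigma) (auto simp: case_prod_beta)

lemma sum_pairs_le:
  fixes g :: "nat \<Rightarrow> real"
  assumes g: "\<And>i. i \<in> I \<Longrightarrow> 0 \<le> g i"
  shows "(\<Sum>j\<in>pairs A. g (fst j)) \<le> \<kappa> * (\<Sum>i\<in>I. g i)" "(\<Sum>j\<in>pairs A. g (snd j)) \<le> \<kappa> * (\<Sum>i\<in>I. g i)"
proof -
  have *: "(\<Sum>j\<in>pairs A. f (fst j) (snd j)) \<le> (\<Sum>k\<in>I. \<Sum>l\<in>nb k. f k l)"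
    if f: "\<And>k l. k \<in> I \<Longrightarrow> l \<in> I \<Longrightarrow> 0 \<le> f k l" for f :: "nat \<Rightarrow> nat \<Rightarrow> real"
  proof -
    have fI: "0 \<le> f k l" if "k \<in> I" "l \<in> nb k" for k l
      using nb[OF that(1)] that by (auto intro: f)
    have "(\<Sum>j\<in>pairs A. f (fst j) (snd j)) \<le> (\<Sum>k\<in>K A. \<Sum>l\<in>nb k. f k l)"
      unfolding sum_pairs
      by (intro sum_mono sum_mono2 finite_nb) (use K_subset in \<open>auto intro!: fI\<close>)
    also have "\<dots> \<le> (\<Sum>k\<in>I. \<Sum>l\<in>nb k. f k l)"
      by (intro sum_mono2 sum_nonneg fI finite_I K_subset) auto
    finally show ?thesis .
  qed
  show "(\<Sum>j\<in>pairs A. g (fst j)) \<le> \<kappa> * (\<Sum>i\<in>I. g i)"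
    by (rule order_trans[OF *[of "\<lambda>k l. g k"] sum_nb_first]) (auto intro: g)
  show "(\<Sum>j\<in>pairs A. g (snd j)) \<le> \<kappa> * (\<Sum>i\<in>I. g i)"
    by (rule order_trans[OF *[of "\<lambda>k l. g l"] sum_nb_second]) (auto intro: g)
qed

lemma sum_x4_nonneg: "0 \<le> sum_x4" by (simp add: sum_x4_def sum_nonneg)

lemma tau_nonneg: "i \<in> I \<Longrightarrow> 0 \<le> \<tau>"
  using card_D_idx[of i] by linarith

text \<open>
  Either end point of the second pair lies in the set \<open>A\<^sub>k\<^sub>l\<close> of the first, which has at most \<open>\<kappa>\<close>
  elements, and then at most \<open>\<kappa>\<close> choices remain for the other end point.
\<close>

lemma card_pairs_meeting:
  assumes j: "j \<in> pairs A"
  shows "real (card {j' \<in> pairs A. nb2 (fst j) (snd j) \<inter> {fst j', snd j'} \<noteq> {}}) \<le> 2 * \<kappa>\<^sup>2"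
proof -
  let ?N = "nb2 (fst j) (snd j)"
  have jI: "fst j \<in> I" "snd j \<in> nb (fst j)" using j K_subset by (auto simp: pairs_iff)
  have NI: "?N \<subseteq> I" and Nk: "real (card ?N) \<le> \<kappa>" using nb2[OF jI] card_nb2[OF jI] by auto
  have finN: "finite ?N" using NI by (rule finite_subset) simp
  let ?S1 = "SIGMA k:?N. nb k" and ?S2 = "(\<lambda>(l, k). (k, l)) ` (SIGMA l:?N. Nb l)"
  have fin1: "finite ?S1" using finN NI by (intro finite_SigmaI) auto
  have fin2: "finite (SIGMA l:?N. Nb l)" using finN by (intro finite_SigmaI) auto
  have "{j' \<in> pairs A. ?N \<inter> {fst j', snd j'} \<noteq> {}} \<subseteq> ?S1 \<union> ?S2"
  proof
    fix j' assume "j' \<in> {j' \<in> pairs A. ?N \<inter> {fst j', snd j'} \<noteq> {}}"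
    then have *: "fst j' \<in> K A" "snd j' \<in> nb (fst j')" "fst j' \<in> ?N \<or> snd j' \<in> ?N"
      by (auto simp: pairs_iff)
    have "fst j' \<in> I" using * K_subset by blast
    then have "fst j' \<in> Nb (snd j')" using *(2) by (simp add: N_idx_def I_def)
    then show "j' \<in> ?S1 \<union> ?S2" using * by (cases j') (auto intro!: image_eqI[of _ _ "(snd j', fst j')"])
  qed
  then have "card {j' \<in> pairs A. ?N \<inter> {fst j', snd j'} \<noteq> {}} \<le> card (?S1 \<union> ?S2)"
    using fin1 fin2 by (intro card_mono) auto
  also have "\<dots> \<le> card ?S1 + card (SIGMA l:?N. Nb l)"
    by (rule order_trans[OF card_Un_le]) (use fin2 in \<open>auto intro!: add_mono card_image_le\<close>)
  also have "\<dots> = (\<Sum>k\<in>?N. card (nb k)) + (\<Sum>k\<in>?N. card (Nb k))"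
    using finN NI by (auto simp: card_SigmaI subset_iff)
  finally have "real (card {j' \<in> pairs A. ?N \<inter> {fst j', snd j'} \<noteq> {}}) \<le> (\<Sum>k\<in>?N. real (card (nb k))) + (\<Sum>k\<in>?N. real (card (Nb k)))"
    by (simp flip: of_nat_sum of_nat_add)
  also have "\<dots> \<le> (\<Sum>k\<in>?N. \<kappa>) + (\<Sum>k\<in>?N. \<kappa>)"
    using NI by (intro add_mono sum_mono card_nb card_N_idx) auto
  also have "\<dots> = 2 * (real (card ?N) * \<kappa>)" by simp
  also have "\<dots> \<le> 2 * (\<kappa> * \<kappa>)" using Nk kappa_pos by (intro mult_left_mono mult_right_mono) auto
  finally show ?thesis by (simp add: power2_eq_square)
qed

lemma finite_D_idx: "finite (D_idx n nb nb2 i)"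
proof (rule finite_subset)
  show "D_idx n nb nb2 i \<subseteq> (SIGMA k:I. nb k)" by (auto simp: D_idx_def I_def)
  show "finite (SIGMA k:I. nb k)" by (intro finite_SigmaI) auto
qed

text \<open>
  The sets \<open>D\<^sub>i\<close> count the pairs \<open>(k, l)\<close> with \<open>i \<in> A\<^sub>k\<^sub>l\<close>.
\<close>

lemma card_pairs_covering:
  assumes L: "L \<subseteq> I"
  shows "real (card {j \<in> pairs A. nb2 (fst j) (snd j) \<inter> L \<noteq> {}}) \<le> \<tau> * card L"
proof -
  have fL: "finite L" using L by (rule finite_subset) simp
  have "{j \<in> pairs A. nb2 (fst j) (snd j) \<inter> L \<noteq> {}} \<subseteq> (\<Union>i\<in>L. D_idx n nb nb2 i)"
    using K_subset[of A] by (auto simp: pairs_iff D_idx_def I_def)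
  then have "card {j \<in> pairs A. nb2 (fst j) (snd j) \<inter> L \<noteq> {}} \<le> card (\<Union>i\<in>L. D_idx n nb nb2 i)"
    using fL finite_D_idx by (intro card_mono) auto
  also have "\<dots> \<le> (\<Sum>i\<in>L. card (D_idx n nb nb2 i))" using fL by (rule card_UN_le)
  finally have "real (card {j \<in> pairs A. nb2 (fst j) (snd j) \<inter> L \<noteq> {}}) \<le> (\<Sum>i\<in>L. real (card (D_idx n nb nb2 i)))"
    by (simp flip: of_nat_sum)
  also have "\<dots> \<le> (\<Sum>i\<in>L. \<tau>)" using L by (intro sum_mono card_D_idx) auto
  finally show ?thesis by (simp add: mult.commute)
qed

text \<open>
  Expand the square into covariances of centred pair functions. Such a covariance vanishes, even in
  the presence of the weight, as soon as the set \<open>A\<^sub>k\<^sub>l\<close> of one pair avoids both \<open>A\<close> and the other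
  pair. For the remaining terms, either both these sets meet \<open>A\<close>, which leaves at most \<open>\<tau> |A|\<close> choices
  for each pair, or one of them meets the other pair. The general form \<open>\<phi>\<close> covers both the
  products \<open>X\<^sub>k X\<^sub>l\<close> and their absolute values.
\<close>

lemma weighted_variance:
  assumes A: "A \<subseteq> I" "A \<noteq> {}" and v: "v \<in> borel_measurable (gen A)" "L4_bound M v \<rho>"
    and \<phi>_meas: "\<And>j. j \<in> pairs A \<Longrightarrow> \<phi> j \<in> borel_measurable (gen {fst j, snd j})"
    and \<phi>_le: "\<And>j \<omega>. j \<in> pairs A \<Longrightarrow> \<bar>\<phi> j \<omega>\<bar> \<le> \<bar>X (fst j) \<omega> * X (snd j) \<omega>\<bar>"
  shows "integrable M (\<lambda>\<omega>. v \<omega> ^ 4 * ((\<Sum>j\<in>pairs A. \<phi> j \<omega>) - (\<Sum>j\<in>pairs A. expectation (\<phi> j)))\<^sup>2)"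
    and "expectation (\<lambda>\<omega>. v \<omega> ^ 4 * ((\<Sum>j\<in>pairs A. \<phi> j \<omega>) - (\<Sum>j\<in>pairs A. expectation (\<phi> j)))\<^sup>2)
      \<le> 12 * \<rho> ^ 4 * var_scale A"
proof -
  let ?J = "pairs A"
  define \<psi> where "\<psi> j \<omega> = \<phi> j \<omega> - expectation (\<phi> j)" for j \<omega>
  define e where "e j = 4 * \<rho> ^ 4 * ((x (fst j))\<^sup>2 * (x (snd j))\<^sup>2)" for j
  have v4: "integrable M (\<lambda>\<omega>. v \<omega> ^ 4)" "expectation (\<lambda>\<omega>. v \<omega> ^ 4) \<le> \<rho> ^ 4" "0 \<le> \<rho>"
    using v by (auto simp: L4_bound_def)
  have vM[measurable]: "v \<in> borel_measurable M" using v(2) by (simp add: L4_bound_def)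
  have e_nonneg: "0 \<le> e j" for j by (simp add: e_def)
  have inI: "fst j \<in> I" "snd j \<in> I" "snd j \<in> nb (fst j)" if "j \<in> ?J" for j
    using that K_subset by (auto simp: pairs_iff)
  have \<phi>M[measurable]: "\<phi> j \<in> borel_measurable M" if "j \<in> ?J" for j
    using gen_measurable[OF \<phi>_meas[OF that]] inI[OF that] by simp
  have \<psi>_gen: "\<psi> j \<in> borel_measurable (gen {fst j, snd j})" if "j \<in> ?J" for j
    unfolding \<psi>_def using \<phi>_meas[OF that] by measurable
  have \<psi>M[measurable]: "\<psi> j \<in> borel_measurable M" if "j \<in> ?J" for j
    unfolding \<psi>_def using \<phi>M[OF that] by measurable
  have \<phi>_int: "integrable M (\<phi> j)" and \<phi>_mean: "\<bar>expectation (\<phi> j)\<bar> \<le> x (fst j) * x (snd j)" if "j \<in> ?J" for j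
  proof -
    show i: "integrable M (\<phi> j)"
      by (rule Bochner_Integration.integrable_bound[OF integrable_XX[OF inI(1,2)[OF that]]])
        (use \<phi>_le[OF that] \<phi>M[OF that] in auto)
    have "\<bar>expectation (\<phi> j)\<bar> \<le> expectation (\<lambda>\<omega>. \<bar>\<phi> j \<omega>\<bar>)" by (rule integral_abs_bound)
    also have "\<dots> \<le> expectation (\<lambda>\<omega>. \<bar>X (fst j) \<omega> * X (snd j) \<omega>\<bar>)"
      by (rule integral_mono) (use i integrable_XX[OF inI(1,2)[OF that]] \<phi>_le[OF that] in auto)
    also have "\<dots> \<le> x (fst j) * x (snd j)" by (rule expectation_abs_XX_le[OF inI(1,2)[OF that]])
    finally show "\<bar>expectation (\<phi> j)\<bar> \<le> x (fst j) * x (snd j)" .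
  qed
  have \<psi>2: "integrable M (\<lambda>\<omega>. v \<omega> ^ 4 * (\<psi> j \<omega>)\<^sup>2)" "expectation (\<lambda>\<omega>. v \<omega> ^ 4 * (\<psi> j \<omega>)\<^sup>2) \<le> e j"
    if j: "j \<in> ?J" for j
  proof -
    let ?m = "(x (fst j) * x (snd j))\<^sup>2"
    let ?h = "\<lambda>\<omega>. 2 * (v \<omega> * X (fst j) \<omega> * (v \<omega> * X (fst j) \<omega>) * (v \<omega> * X (snd j) \<omega>) * (v \<omega> * X (snd j) \<omega>)) + 2 * (v \<omega> ^ 4 * ?m)"
    note L = L4_weighted_X[OF A(1) v, of "fst j"] L4_weighted_X[OF A(1) v, of "snd j"]
    have k: "fst j \<in> K A" "snd j \<in> K A" using j by (auto simp: pairs_iff)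
    note B = L4_bound_mult4[OF L(1)[OF k(1)] L(1)[OF k(1)] L(2)[OF k(2)] L(2)[OF k(2)]]
    have h: "integrable M ?h" using B(1) v4(1) by simp
    have le: "v \<omega> ^ 4 * (\<psi> j \<omega>)\<^sup>2 \<le> ?h \<omega>" for \<omega>
    proof -
      have "(\<psi> j \<omega>)\<^sup>2 \<le> 2 * (\<phi> j \<omega>)\<^sup>2 + 2 * (expectation (\<phi> j))\<^sup>2"
        using sum_squares_bound[of "\<phi> j \<omega>" "- expectation (\<phi> j)"] by (simp add: \<psi>_def power2_diff)
      also have "(\<phi> j \<omega>)\<^sup>2 \<le> (X (fst j) \<omega> * X (snd j) \<omega>)\<^sup>2" using \<phi>_le[OF j] by (simp add: abs_le_square_iff)
      also have "(expectation (\<phi> j))\<^sup>2 \<le> ?m" using \<phi>_mean[OF j] abs_le_square_iff by fastforce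
      finally have "v \<omega> ^ 4 * (\<psi> j \<omega>)\<^sup>2 \<le> v \<omega> ^ 4 * (2 * (X (fst j) \<omega> * X (snd j) \<omega>)\<^sup>2 + 2 * ?m)"
        by (intro mult_left_mono) auto
      also have "\<dots> = ?h \<omega>" by (simp add: power2_eq_square power4_eq_xxxx algebra_simps)
      finally show ?thesis .
    qed
    show i: "integrable M (\<lambda>\<omega>. v \<omega> ^ 4 * (\<psi> j \<omega>)\<^sup>2)"
    proof (rule Bochner_Integration.integrable_bound[OF h])
      show "(\<lambda>\<omega>. v \<omega> ^ 4 * (\<psi> j \<omega>)\<^sup>2) \<in> borel_measurable M" using \<psi>M[OF j] by measurable
      show "AE \<omega> in M. norm (v \<omega> ^ 4 * (\<psi> j \<omega>)\<^sup>2) \<le> norm (?h \<omega>)"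
        using le by (intro AE_I2) (smt (verit) real_norm_def zero_le_even_power zero_le_power2 even_numeral mult_nonneg_nonneg)
    qed
    have "expectation (\<lambda>\<omega>. v \<omega> ^ 4 * (\<psi> j \<omega>)\<^sup>2) \<le> expectation ?h"
      by (rule integral_mono[OF i h le])
    also have "\<dots> = 2 * expectation (\<lambda>\<omega>. v \<omega> * X (fst j) \<omega> * (v \<omega> * X (fst j) \<omega>) * (v \<omega> * X (snd j) \<omega>) * (v \<omega> * X (snd j) \<omega>))
        + 2 * (expectation (\<lambda>\<omega>. v \<omega> ^ 4) * ?m)"
      using B(1) v4(1) by simp
    also have "\<dots> \<le> 2 * (\<rho> * x (fst j) * (\<rho> * x (fst j)) * (\<rho> * x (snd j)) * (\<rho> * x (snd j))) + 2 * (\<rho> ^ 4 * ?m)"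
      using order_trans[OF order_trans[OF abs_ge_self integral_abs_bound] B(2)] v4(2)
      by (intro add_mono mult_left_mono mult_right_mono) auto
    also have "\<dots> = e j" by (simp add: e_def power2_eq_square power4_eq_xxxx)
    finally show "expectation (\<lambda>\<omega>. v \<omega> ^ 4 * (\<psi> j \<omega>)\<^sup>2) \<le> e j" .
  qed
  have cross_le: "\<bar>v \<omega> ^ 4 * \<psi> j \<omega> * \<psi> j' \<omega>\<bar> \<le> (v \<omega> ^ 4 * (\<psi> j \<omega>)\<^sup>2 + v \<omega> ^ 4 * (\<psi> j' \<omega>)\<^sup>2) / 2" for j j' \<omega>
  proof -
    have "\<bar>\<psi> j \<omega>\<bar> * \<bar>\<psi> j' \<omega>\<bar> \<le> ((\<psi> j \<omega>)\<^sup>2 + (\<psi> j' \<omega>)\<^sup>2) / 2"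
      using sum_squares_bound[of "\<bar>\<psi> j \<omega>\<bar>" "\<bar>\<psi> j' \<omega>\<bar>"] by simp
    then have "v \<omega> ^ 4 * (\<bar>\<psi> j \<omega>\<bar> * \<bar>\<psi> j' \<omega>\<bar>) \<le> v \<omega> ^ 4 * (((\<psi> j \<omega>)\<^sup>2 + (\<psi> j' \<omega>)\<^sup>2) / 2)"
      by (intro mult_left_mono) auto
    then show ?thesis by (simp add: abs_mult algebra_simps)
  qed
  have cross_int: "integrable M (\<lambda>\<omega>. v \<omega> ^ 4 * \<psi> j \<omega> * \<psi> j' \<omega>)" if "j \<in> ?J" "j' \<in> ?J" for j j'
  proof (rule Bochner_Integration.integrable_bound)
    show "integrable M (\<lambda>\<omega>. (v \<omega> ^ 4 * (\<psi> j \<omega>)\<^sup>2 + v \<omega> ^ 4 * (\<psi> j' \<omega>)\<^sup>2) / 2)" using \<psi>2(1) that by simp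
    show "(\<lambda>\<omega>. v \<omega> ^ 4 * \<psi> j \<omega> * \<psi> j' \<omega>) \<in> borel_measurable M" using that by measurable
    show "AE \<omega> in M. norm (v \<omega> ^ 4 * \<psi> j \<omega> * \<psi> j' \<omega>) \<le> norm ((v \<omega> ^ 4 * (\<psi> j \<omega>)\<^sup>2 + v \<omega> ^ 4 * (\<psi> j' \<omega>)\<^sup>2) / 2)"
      unfolding real_norm_def using cross_le by (intro AE_I2 order_trans[OF _ abs_ge_self])
  qed
  have cross_bound: "expectation (\<lambda>\<omega>. v \<omega> ^ 4 * \<psi> j \<omega> * \<psi> j' \<omega>) \<le> (e j + e j') / 2" if "j \<in> ?J" "j' \<in> ?J" for j j'
  proof -
    have "expectation (\<lambda>\<omega>. v \<omega> ^ 4 * \<psi> j \<omega> * \<psi> j' \<omega>)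
        \<le> expectation (\<lambda>\<omega>. (v \<omega> ^ 4 * (\<psi> j \<omega>)\<^sup>2 + v \<omega> ^ 4 * (\<psi> j' \<omega>)\<^sup>2) / 2)"
      by (rule integral_mono[OF cross_int[OF that] _ order_trans[OF abs_ge_self cross_le]]) (use \<psi>2(1) that in auto)
    also have "\<dots> \<le> (e j + e j') / 2" using \<psi>2[OF that(1)] \<psi>2[OF that(2)] by simp
    finally show ?thesis .
  qed
  define rel where "rel j j' \<longleftrightarrow> nb2 (fst j) (snd j) \<inter> (A \<union> {fst j', snd j'}) \<noteq> {}" for j j'
  have cross_0: "expectation (\<lambda>\<omega>. v \<omega> ^ 4 * \<psi> j \<omega> * \<psi> j' \<omega>) = 0" if "j \<in> ?J" "j' \<in> ?J" "\<not> rel j j'" for j j'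
  proof -
    have sub: "A \<union> {fst j', snd j'} \<subseteq> I - nb2 (fst j) (snd j)"
      using that(3) A(1) inI[OF that(2)] by (auto simp: rel_def)
    have "v \<in> borel_measurable (gen (A \<union> {fst j', snd j'}))" "\<psi> j' \<in> borel_measurable (gen (A \<union> {fst j', snd j'}))"
      by (rule gen_mono[OF v(1)] gen_mono[OF \<psi>_gen[OF that(2)]], blast)+
    then have g: "(\<lambda>\<omega>. v \<omega> ^ 4 * \<psi> j' \<omega>) \<in> borel_measurable (gen (A \<union> {fst j', snd j'}))" by measurable
    have i1: "integrable M (\<psi> j)" unfolding \<psi>_def using \<phi>_int[OF that(1)] by simp
    have i2: "integrable M (\<lambda>\<omega>. v \<omega> ^ 4 * \<psi> j' \<omega>)"
    proof (rule Bochner_Integration.integrable_bound)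
      show "integrable M (\<lambda>\<omega>. v \<omega> ^ 4 + v \<omega> ^ 4 * (\<psi> j' \<omega>)\<^sup>2)" using \<psi>2(1)[OF that(2)] v4 by simp
      show "(\<lambda>\<omega>. v \<omega> ^ 4 * \<psi> j' \<omega>) \<in> borel_measurable M" using that by measurable
      have "\<bar>t\<bar> \<le> 1 + t\<^sup>2" for t :: real using sum_squares_bound[of 1 "\<bar>t\<bar>"] by simp
      then have "v \<omega> ^ 4 * \<bar>\<psi> j' \<omega>\<bar> \<le> v \<omega> ^ 4 * (1 + (\<psi> j' \<omega>)\<^sup>2)" for \<omega> by (intro mult_left_mono) auto
      then show "AE \<omega> in M. norm (v \<omega> ^ 4 * \<psi> j' \<omega>) \<le> norm (v \<omega> ^ 4 + v \<omega> ^ 4 * (\<psi> j' \<omega>)\<^sup>2)"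
        by (intro AE_I2) (simp add: abs_mult algebra_simps)
    qed
    have "indep_var borel (\<psi> j) borel (\<lambda>\<omega>. v \<omega> ^ 4 * \<psi> j' \<omega>)"
      by (rule indep2_gen[OF inI(1,3)[OF that(1)] sub \<psi>_gen[OF that(1)] g])
    from indep_var_lebesgue_integral[OF this i1 i2]
    have "expectation (\<lambda>\<omega>. \<psi> j \<omega> * (v \<omega> ^ 4 * \<psi> j' \<omega>)) = expectation (\<psi> j) * expectation (\<lambda>\<omega>. v \<omega> ^ 4 * \<psi> j' \<omega>)" .
    also have "expectation (\<psi> j) = 0" unfolding \<psi>_def using \<phi>_int[OF that(1)] by (simp add: prob_space)
    finally show ?thesis by (simp add: ac_simps)
  qed
  define b where "b j = (of_bool (nb2 (fst j) (snd j) \<inter> A \<noteq> {}) :: real)" for j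
  define m where "m j j' = (of_bool (nb2 (fst j) (snd j) \<inter> {fst j', snd j'} \<noteq> {}) :: real)" for j j'
  have cross: "expectation (\<lambda>\<omega>. v \<omega> ^ 4 * \<psi> j \<omega> * \<psi> j' \<omega>) \<le> (e j + e j') / 2 * (b j * b j' + m j j' + m j' j)"
    if "j \<in> ?J" "j' \<in> ?J" for j j'
  proof (cases "rel j j' \<and> rel j' j")
    case True
    then have "1 \<le> b j * b j' + m j j' + m j' j" by (auto simp: rel_def b_def m_def)
    then have "(e j + e j') / 2 * 1 \<le> (e j + e j') / 2 * (b j * b j' + m j j' + m j' j)"
      using e_nonneg by (intro mult_left_mono) auto
    with cross_bound[OF that] show ?thesis by simp
  next
    case False
    then have "expectation (\<lambda>\<omega>. v \<omega> ^ 4 * \<psi> j \<omega> * \<psi> j' \<omega>) = 0"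
      using cross_0[OF that] cross_0[OF that(2,1)] by (auto simp: ac_simps)
    moreover have "0 \<le> (e j + e j') / 2 * (b j * b j' + m j j' + m j' j)"
      using e_nonneg by (auto simp: b_def m_def)
    ultimately show ?thesis by simp
  qed
  have expand: "v \<omega> ^ 4 * ((\<Sum>j\<in>?J. \<phi> j \<omega>) - (\<Sum>j\<in>?J. expectation (\<phi> j)))\<^sup>2
      = (\<Sum>j\<in>?J. \<Sum>j'\<in>?J. v \<omega> ^ 4 * \<psi> j \<omega> * \<psi> j' \<omega>)" for \<omega>
  proof -
    have "(\<Sum>j\<in>?J. \<phi> j \<omega>) - (\<Sum>j\<in>?J. expectation (\<phi> j)) = (\<Sum>j\<in>?J. \<psi> j \<omega>)"
      by (simp add: \<psi>_def sum_subtractf)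
    then show ?thesis
      by (simp only: power2_eq_square sum_product) (simp only: sum_distrib_left mult.assoc)
  qed
  show "integrable M (\<lambda>\<omega>. v \<omega> ^ 4 * ((\<Sum>j\<in>?J. \<phi> j \<omega>) - (\<Sum>j\<in>?J. expectation (\<phi> j)))\<^sup>2)"
    unfolding expand by (intro Bochner_Integration.integrable_sum cross_int)
  obtain i0 where i0: "i0 \<in> A" using A by auto
  have t0: "0 \<le> \<tau>" using tau_nonneg i0 A by auto
  have cA: "1 \<le> real (card A)"
    using A finite_subset[OF A(1) finite_I] by (simp add: Suc_le_eq card_gt_0_iff)
  have bsum: "(\<Sum>j\<in>?J. b j) \<le> \<tau> * card A"
    unfolding b_def using card_pairs_covering[OF A(1), of A] by (simp add: sum_of_bool_eq Int_def)
  have m1: "(\<Sum>j'\<in>?J. m j j') \<le> 2 * \<kappa>\<^sup>2" if "j \<in> ?J" for j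
    unfolding m_def using card_pairs_meeting[OF that] by (simp add: sum_of_bool_eq Int_def)
  have m2: "(\<Sum>j\<in>?J. m j j') \<le> 2 * \<tau>" if "j' \<in> ?J" for j'
  proof -
    have "(\<Sum>j\<in>?J. m j j') \<le> \<tau> * card {fst j', snd j'}"
      unfolding m_def using card_pairs_covering[of "{fst j', snd j'}" A] inI[OF that] by (simp add: sum_of_bool_eq Int_def)
    also have "\<dots> \<le> \<tau> * 2" using t0 by (intro mult_left_mono) (auto simp: card_insert_if)
    finally show ?thesis by simp
  qed
  define E where "E = (\<Sum>j\<in>?J. e j)"
  have E0: "0 \<le> E" unfolding E_def using e_nonneg by (rule sum_nonneg)
  have E: "E \<le> 4 * \<rho> ^ 4 * (\<kappa> * sum_x4)"
  proof -
    have "E \<le> (\<Sum>j\<in>?J. 2 * \<rho> ^ 4 * (x (fst j) ^ 4 + x (snd j) ^ 4))"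
      unfolding E_def
    proof (intro sum_mono)
      fix j
      have "2 * ((x (fst j))\<^sup>2 * (x (snd j))\<^sup>2) \<le> x (fst j) ^ 4 + x (snd j) ^ 4"
        using sum_squares_bound[of "(x (fst j))\<^sup>2" "(x (snd j))\<^sup>2"] by simp
      then have "2 * \<rho> ^ 4 * (2 * ((x (fst j))\<^sup>2 * (x (snd j))\<^sup>2)) \<le> 2 * \<rho> ^ 4 * (x (fst j) ^ 4 + x (snd j) ^ 4)"
        by (intro mult_left_mono) auto
      then show "e j \<le> 2 * \<rho> ^ 4 * (x (fst j) ^ 4 + x (snd j) ^ 4)" by (simp add: e_def)
    qed
    also have "\<dots> = 2 * \<rho> ^ 4 * ((\<Sum>j\<in>?J. x (fst j) ^ 4) + (\<Sum>j\<in>?J. x (snd j) ^ 4))"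
      by (simp only: sum.distrib flip: sum_distrib_left)
    also have "\<dots> \<le> 2 * \<rho> ^ 4 * (\<kappa> * sum_x4 + \<kappa> * sum_x4)"
      unfolding sum_x4_def by (intro mult_left_mono add_mono sum_pairs_le) auto
    finally show ?thesis by simp
  qed
  have "expectation (\<lambda>\<omega>. v \<omega> ^ 4 * ((\<Sum>j\<in>?J. \<phi> j \<omega>) - (\<Sum>j\<in>?J. expectation (\<phi> j)))\<^sup>2)
      = (\<Sum>j\<in>?J. \<Sum>j'\<in>?J. expectation (\<lambda>\<omega>. v \<omega> ^ 4 * \<psi> j \<omega> * \<psi> j' \<omega>))"
    unfolding expand
    by (subst Bochner_Integration.integral_sum, (intro Bochner_Integration.integrable_sum cross_int; assumption),
        intro sum.cong refl Bochner_Integration.integral_sum cross_int)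
  also have "\<dots> \<le> (\<Sum>j\<in>?J. \<Sum>j'\<in>?J. (e j + e j') / 2 * (b j * b j' + m j j' + m j' j))"
    by (intro sum_mono cross)
  also have "\<dots> = (\<Sum>j\<in>?J. \<Sum>j'\<in>?J. e j * (b j * b j' + m j j' + m j' j))"
  proof -
    let ?w = "\<lambda>j j'. b j * b j' + m j j' + m j' j"
    \<comment> \<open>The weights are symmetric, so both halves of \<open>(e j + e j') / 2\<close> contribute the same.\<close>
    have "(\<Sum>j\<in>?J. \<Sum>j'\<in>?J. e j' * ?w j j') = (\<Sum>j\<in>?J. \<Sum>j'\<in>?J. e j * ?w j j')"
      by (subst sum.swap) (simp add: ac_simps)
    moreover have "(\<Sum>j\<in>?J. \<Sum>j'\<in>?J. (e j + e j') / 2 * ?w j j')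
      = ((\<Sum>j\<in>?J. \<Sum>j'\<in>?J. e j * ?w j j') + (\<Sum>j\<in>?J. \<Sum>j'\<in>?J. e j' * ?w j j')) / 2"
      unfolding sum.distrib[symmetric] sum_divide_distrib by (intro sum.cong refl) (simp add: field_simps)
    ultimately show ?thesis by simp
  qed
  also have "\<dots> = (\<Sum>j\<in>?J. e j * (b j * (\<Sum>j'\<in>?J. b j') + (\<Sum>j'\<in>?J. m j j') + (\<Sum>j'\<in>?J. m j' j)))"
    by (simp add: sum_distrib_left sum.distrib distrib_left)
  also have "\<dots> \<le> (\<Sum>j\<in>?J. e j * (1 * (\<tau> * card A) + 2 * \<kappa>\<^sup>2 + 2 * \<tau>))"
    using e_nonneg t0
    by (intro sum_mono mult_left_mono add_mono mult_mono m1 m2 bsum) (auto simp: b_def intro!: sum_nonneg)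
  also have "\<dots> = E * (\<tau> * card A + 2 * \<kappa>\<^sup>2 + 2 * \<tau>)"
    by (simp add: E_def sum_distrib_right)
  also have "\<dots> \<le> E * (3 * (\<kappa>\<^sup>2 + \<tau> * card A))"
  proof -
    have "\<tau> * 1 \<le> \<tau> * card A" using cA t0 by (intro mult_left_mono)
    moreover have "0 \<le> \<kappa>\<^sup>2" by simp
    ultimately have "\<tau> * card A + 2 * \<kappa>\<^sup>2 + 2 * \<tau> \<le> 3 * (\<kappa>\<^sup>2 + \<tau> * card A)"
      unfolding distrib_left by linarith
    then show ?thesis using E0 by (rule mult_left_mono)
  qed
  also have "\<dots> \<le> (4 * \<rho> ^ 4 * (\<kappa> * sum_x4)) * (3 * (\<kappa>\<^sup>2 + \<tau> * card A))"
    using E t0 by (intro mult_right_mono) auto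
  also have "\<dots> = 12 * \<rho> ^ 4 * var_scale A" by (simp add: var_scale_def)
  finally show "expectation (\<lambda>\<omega>. v \<omega> ^ 4 * ((\<Sum>j\<in>?J. \<phi> j \<omega>) - (\<Sum>j\<in>?J. expectation (\<phi> j)))\<^sup>2)
      \<le> 12 * \<rho> ^ 4 * var_scale A" .
qed

end

section \<open>Weighted fourth moments\<close>

lemma L4_bound_sum_integrable:
  assumes "finite J" "\<And>j. j \<in> J \<Longrightarrow> f j \<in> borel_measurable M" "\<And>j. j \<in> J \<Longrightarrow> integrable M (\<lambda>\<omega>. (f j \<omega> :: real) ^ 4)"
  shows "integrable M (\<lambda>\<omega>. (\<Sum>j\<in>J. f j \<omega>) ^ 4)"
  using assms
proof (induction J rule: finite_induct)
  case (insert j J)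
  have *: "(a + b) ^ 4 \<le> 8 * (a ^ 4 + b ^ 4)" for a b :: real
  proof -
    have "(a + b)\<^sup>2 \<le> 2 * (a\<^sup>2 + b\<^sup>2)" using sum_squares_bound[of a b] by (simp add: power2_sum)
    then have "((a + b)\<^sup>2)\<^sup>2 \<le> (2 * (a\<^sup>2 + b\<^sup>2))\<^sup>2" by (intro power_mono) auto
    also have "\<dots> = 4 * (a\<^sup>2 + b\<^sup>2)\<^sup>2" by (simp only: power_mult_distrib) simp
    also have "\<dots> \<le> 4 * (2 * ((a\<^sup>2)\<^sup>2 + (b\<^sup>2)\<^sup>2))"
      using sum_squares_bound[of "a\<^sup>2" "b\<^sup>2"] by (simp add: power2_sum)
    finally show ?thesis by (simp flip: power_mult)
  qed
  have IH: "integrable M (\<lambda>\<omega>. (\<Sum>j\<in>J. f j \<omega>) ^ 4)" using insert by auto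
  have i: "integrable M (\<lambda>\<omega>. 8 * (f j \<omega> ^ 4 + (\<Sum>j\<in>J. f j \<omega>) ^ 4))" using IH insert by auto
  have m: "(\<lambda>\<omega>. (f j \<omega> + (\<Sum>j\<in>J. f j \<omega>)) ^ 4) \<in> borel_measurable M"
    using insert.prems(1) by (intro borel_measurable_power borel_measurable_add borel_measurable_sum) auto
  have "integrable M (\<lambda>\<omega>. (f j \<omega> + (\<Sum>j\<in>J. f j \<omega>)) ^ 4)"
  proof (rule Bochner_Integration.integrable_bound[OF i m], rule AE_I2)
    fix \<omega>
    show "norm ((f j \<omega> + (\<Sum>j\<in>J. f j \<omega>)) ^ 4) \<le> norm (8 * (f j \<omega> ^ 4 + (\<Sum>j\<in>J. f j \<omega>) ^ 4))"
      using *[of "f j \<omega>" "\<Sum>j\<in>J. f j \<omega>"] by simp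
  qed
  then show ?case using insert by simp
qed simp

context local_dependence
begin

definition S :: "nat set \<Rightarrow> 'a \<Rightarrow> real" where "S A \<omega> = (\<Sum>k\<in>K A. X k \<omega>)"

text \<open>
  The part of \<open>S A\<close> that may depend on \<open>X\<^sub>k\<close>.
\<close>

definition Y :: "nat set \<Rightarrow> nat \<Rightarrow> 'a \<Rightarrow> real" where "Y A k \<omega> = (\<Sum>l\<in>K A \<inter> nb k. X l \<omega>)"

definition U :: "nat set \<Rightarrow> 'a \<Rightarrow> real" where
  "U A \<omega> = (\<Sum>j\<in>pairs A. X (fst j) \<omega> * X (snd j) \<omega>)"

definition mean_U :: "nat set \<Rightarrow> real" where
  "mean_U A = (\<Sum>j\<in>pairs A. expectation (\<lambda>\<omega>. X (fst j) \<omega> * X (snd j) \<omega>))"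

definition sum_x3 :: real where "sum_x3 = (\<Sum>i\<in>I. x i ^ 3)"

text \<open>
  The size of the contribution of \<open>N\<^sub>A\<close> to the variance of the full sum; \<open>\<delta>\<^sub>4\<close> is \<open>c \<lambda>\<close> times
  its square root.
\<close>

definition Dsum :: "nat set \<Rightarrow> real" where
  "Dsum A = (\<Sum>k\<in>NA A. \<Sum>l\<in>Nb k \<union> nb k. x k * x l)"

definition Tsq :: "nat set \<Rightarrow> 'a \<Rightarrow> real" where
  "Tsq A \<omega> = (\<Sum>k\<in>NA A. \<Sum>l\<in>nb k. \<bar>X k \<omega> * X l \<omega>\<bar>) + (\<Sum>k\<in>NA A. \<Sum>l\<in>Nb k. \<bar>X k \<omega> * X l \<omega>\<bar>)"

text \<open>
  A single random variable that bounds all the local sums \<open>\<Sum>k\<in>J. |X\<^sub>k|\<close> with \<open>J \<subseteq> K A\<close> of size at most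
  \<open>2 \<kappa>\<close>, see \<open>sum_abs_le_Zstar\<close>. It replaces local sums that depend on the index under
  consideration.
\<close>

definition Zstar :: "nat set \<Rightarrow> 'a \<Rightarrow> real" where
  "Zstar A \<omega> = root 4 (8 * \<kappa> ^ 3 * (\<Sum>k\<in>K A. X k \<omega> ^ 4))"

definition cubes :: "nat set \<Rightarrow> 'a \<Rightarrow> real" where
  "cubes A \<omega> = \<kappa>\<^sup>2 * (\<Sum>k\<in>K A. \<bar>X k \<omega>\<bar> ^ 3)"

lemma NA_I: "k \<in> NA A \<Longrightarrow> k \<in> I" using NA_subset by blast
lemma K_I: "k \<in> K A \<Longrightarrow> k \<in> I" using K_subset by blast
lemma Nb_I: "k \<in> Nb l \<Longrightarrow> k \<in> I" using Nb_subset by blast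
lemma nb_I: "k \<in> I \<Longrightarrow> l \<in> nb k \<Longrightarrow> l \<in> I" using nb by blast

lemma sum_pairs_le_K:
  fixes g :: "nat \<Rightarrow> real"
  assumes g: "\<And>i. i \<in> K A \<Longrightarrow> 0 \<le> g i"
  shows "(\<Sum>j\<in>pairs A. g (fst j)) \<le> \<kappa> * (\<Sum>i\<in>K A. g i)" "(\<Sum>j\<in>pairs A. g (snd j)) \<le> \<kappa> * (\<Sum>i\<in>K A. g i)"
proof -
  let ?g = "\<lambda>i. if i \<in> K A then g i else 0"
  have s: "(\<Sum>i\<in>I. ?g i) = (\<Sum>i\<in>K A. g i)"
    by (rule sum.mono_neutral_cong_right) (auto simp: K_subset)
  have 1: "(\<Sum>j\<in>pairs A. g (fst j)) = (\<Sum>j\<in>pairs A. ?g (fst j))"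
    by (intro sum.cong refl) (auto simp: pairs_iff)
  have 2: "(\<Sum>j\<in>pairs A. g (snd j)) = (\<Sum>j\<in>pairs A. ?g (snd j))"
    by (intro sum.cong refl) (auto simp: pairs_iff)
  show "(\<Sum>j\<in>pairs A. g (fst j)) \<le> \<kappa> * (\<Sum>i\<in>K A. g i)"
    unfolding 1 s[symmetric] by (rule sum_pairs_le) (auto intro: g)
  show "(\<Sum>j\<in>pairs A. g (snd j)) \<le> \<kappa> * (\<Sum>i\<in>K A. g i)"
    unfolding 2 s[symmetric] by (rule sum_pairs_le) (auto intro: g)
qed

lemma card_K_nb: "k \<in> I \<Longrightarrow> real (card (K A \<inter> nb k)) \<le> \<kappa>"
  using card_nb[of k] card_mono[OF finite_nb, of k "K A \<inter> nb k"] by simp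

lemma sum_XY: "(\<Sum>k\<in>K A. X k \<omega> * Y A k \<omega>) = U A \<omega>"
  unfolding U_def sum_pairs[where f="\<lambda>k l. X k \<omega> * X l \<omega>"] Y_def by (simp add: sum_distrib_left)

lemma S_minus_Y: "k \<in> K A \<Longrightarrow> S A \<omega> - Y A k \<omega> = (\<Sum>l\<in>K A - nb k. X l \<omega>)"
  unfolding S_def Y_def using sum.Int_Diff[OF finite_K, of "\<lambda>l. X l \<omega>" A "nb k"] by simp

text \<open>
  Cubes of single variables are what the induction can take as new weights.
\<close>

lemma XY2_le:
  assumes k: "k \<in> K A"
  shows "\<bar>X k \<omega>\<bar> * (Y A k \<omega>)\<^sup>2 \<le> \<kappa> * (\<Sum>l\<in>K A \<inter> nb k. (\<bar>X k \<omega>\<bar> ^ 3 + 2 * \<bar>X l \<omega>\<bar> ^ 3) / 3)"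
proof -
  have "(Y A k \<omega>)\<^sup>2 \<le> (\<Sum>l\<in>K A \<inter> nb k. (X l \<omega>)\<^sup>2) * card (K A \<inter> nb k)"
    unfolding Y_def by (rule sum_squared_le_sum_of_squares)
  also have "\<dots> \<le> (\<Sum>l\<in>K A \<inter> nb k. (X l \<omega>)\<^sup>2) * \<kappa>"
    using card_K_nb[OF K_I[OF k]] by (intro mult_left_mono sum_nonneg) auto
  finally have "\<bar>X k \<omega>\<bar> * (Y A k \<omega>)\<^sup>2 \<le> \<bar>X k \<omega>\<bar> * ((\<Sum>l\<in>K A \<inter> nb k. (X l \<omega>)\<^sup>2) * \<kappa>)"
    by (intro mult_left_mono) auto
  also have "\<dots> = \<kappa> * (\<Sum>l\<in>K A \<inter> nb k. \<bar>X k \<omega>\<bar> * \<bar>X l \<omega>\<bar> * \<bar>X l \<omega>\<bar>)"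
  proof -
    have "(X l \<omega>)\<^sup>2 = \<bar>X l \<omega>\<bar> * \<bar>X l \<omega>\<bar>" for l by (simp add: power2_eq_square)
    then show ?thesis by (simp only: sum_distrib_left sum_distrib_right ac_simps)
  qed
  also have "\<dots> \<le> \<kappa> * (\<Sum>l\<in>K A \<inter> nb k. (\<bar>X k \<omega>\<bar> ^ 3 + 2 * \<bar>X l \<omega>\<bar> ^ 3) / 3)"
  proof (intro mult_left_mono sum_mono)
    fix l show "\<bar>X k \<omega>\<bar> * \<bar>X l \<omega>\<bar> * \<bar>X l \<omega>\<bar> \<le> (\<bar>X k \<omega>\<bar> ^ 3 + 2 * \<bar>X l \<omega>\<bar> ^ 3) / 3"
      using am_gm3[of "\<bar>X k \<omega>\<bar>" "\<bar>X l \<omega>\<bar>" "\<bar>X l \<omega>\<bar>"] by simp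
  qed (use kappa_pos in simp)
  finally show ?thesis .
qed

lemma sum_XY2_le: "(\<Sum>k\<in>K A. \<bar>X k \<omega>\<bar> * (Y A k \<omega>)\<^sup>2) \<le> cubes A \<omega>"
proof -
  have "(\<Sum>k\<in>K A. \<bar>X k \<omega>\<bar> * (Y A k \<omega>)\<^sup>2) \<le> (\<Sum>k\<in>K A. \<kappa> * (\<Sum>l\<in>K A \<inter> nb k. (\<bar>X k \<omega>\<bar> ^ 3 + 2 * \<bar>X l \<omega>\<bar> ^ 3) / 3))"
    by (intro sum_mono XY2_le)
  also have "\<dots> = \<kappa> * (\<Sum>j\<in>pairs A. (\<bar>X (fst j) \<omega>\<bar> ^ 3 + 2 * \<bar>X (snd j) \<omega>\<bar> ^ 3) / 3)"
    unfolding sum_pairs[where f="\<lambda>k l. (\<bar>X k \<omega>\<bar> ^ 3 + 2 * \<bar>X l \<omega>\<bar> ^ 3) / 3"] by (rule sum_distrib_left[symmetric])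
  also have "\<dots> = \<kappa> * (((\<Sum>j\<in>pairs A. \<bar>X (fst j) \<omega>\<bar> ^ 3) + 2 * (\<Sum>j\<in>pairs A. \<bar>X (snd j) \<omega>\<bar> ^ 3)) / 3)"
    by (simp add: sum.distrib sum_distrib_left flip: sum_divide_distrib)
  also have "\<dots> \<le> \<kappa> * ((\<kappa> * (\<Sum>k\<in>K A. \<bar>X k \<omega>\<bar> ^ 3) + 2 * (\<kappa> * (\<Sum>k\<in>K A. \<bar>X k \<omega>\<bar> ^ 3))) / 3)"
    using kappa_pos by (intro mult_left_mono divide_right_mono add_mono sum_pairs_le_K) auto
  finally show ?thesis by (simp add: cubes_def power2_eq_square)
qed

lemma sum_XY3_le: "(\<Sum>k\<in>K A. \<bar>X k \<omega>\<bar> * \<bar>Y A k \<omega>\<bar> ^ 3) \<le> \<kappa> ^ 3 * (\<Sum>k\<in>K A. X k \<omega> ^ 4)"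
proof -
  have *: "\<bar>X k \<omega>\<bar> * \<bar>Y A k \<omega>\<bar> ^ 3 \<le> \<kappa>\<^sup>2 * (\<Sum>l\<in>K A \<inter> nb k. (X k \<omega> ^ 4 + 3 * X l \<omega> ^ 4) / 4)" if k: "k \<in> K A" for k
  proof -
    let ?c = "real (card (K A \<inter> nb k))"
    have ck: "?c \<le> \<kappa>" by (rule card_K_nb[OF K_I[OF k]])
    have c4: "\<bar>Y A k \<omega>\<bar> ^ 4 \<le> ?c ^ 3 * (\<Sum>l\<in>K A \<inter> nb k. X l \<omega> ^ 4)"
    proof -
      have "\<bar>Y A k \<omega>\<bar> ^ 4 = ((Y A k \<omega>)\<^sup>2)\<^sup>2" by simp
      also have "\<dots> \<le> ((\<Sum>l\<in>K A \<inter> nb k. (X l \<omega>)\<^sup>2) * ?c)\<^sup>2"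
        unfolding Y_def by (intro power_mono sum_squared_le_sum_of_squares) auto
      also have "\<dots> = (\<Sum>l\<in>K A \<inter> nb k. (X l \<omega>)\<^sup>2)\<^sup>2 * ?c\<^sup>2" by (simp add: power_mult_distrib)
      also have "\<dots> \<le> ((\<Sum>l\<in>K A \<inter> nb k. ((X l \<omega>)\<^sup>2)\<^sup>2) * ?c) * ?c\<^sup>2"
        by (intro mult_right_mono sum_squared_le_sum_of_squares) auto
      finally show ?thesis by (simp add: power2_eq_square power3_eq_cube power4_eq_xxxx ac_simps)
    qed
    show ?thesis
    proof (cases "?c = 0")
      case True
      then have "K A \<inter> nb k = {}" using finite_nb[OF K_I[OF k]] by simp
      then show ?thesis by (simp add: Y_def)
    next
      case False
      then have cp: "?c > 0" by linarith
      \<comment> \<open>With \<open>c\<close> the number of summands of \<open>Y\<close>, the quotient \<open>Y / c\<close> has the size of one summand; with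
        this scaling the inequality between the means is sharp when all variables are equal.\<close>
      have alg1: "t * y ^ 3 = c ^ 3 * ((y / c) ^ 3 * t)"
        and alg2: "c ^ 3 * ((3 * (y / c) ^ 4 + z) / 4) = (3 * (y ^ 4 / c) + c ^ 3 * z) / 4"
        and alg3: "y \<le> c ^ 3 * s \<Longrightarrow> y / c \<le> c\<^sup>2 * s"
        if "c > 0" for c t y z s :: real
        using that by (auto simp: power_divide field_simps power2_eq_square power3_eq_cube power4_eq_xxxx)
      have "\<bar>X k \<omega>\<bar> * \<bar>Y A k \<omega>\<bar> ^ 3 = ?c ^ 3 * ((\<bar>Y A k \<omega>\<bar> / ?c) ^ 3 * \<bar>X k \<omega>\<bar>)"
        by (rule alg1[OF cp])
      also have "\<dots> \<le> ?c ^ 3 * ((3 * (\<bar>Y A k \<omega>\<bar> / ?c) ^ 4 + \<bar>X k \<omega>\<bar> ^ 4) / 4)"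
        using cp by (intro mult_left_mono cube_mult_le) auto
      also have "\<dots> = (3 * (\<bar>Y A k \<omega>\<bar> ^ 4 / ?c) + ?c ^ 3 * X k \<omega> ^ 4) / 4"
        unfolding alg2[OF cp] by simp
      also have "\<dots> \<le> (3 * (?c\<^sup>2 * (\<Sum>l\<in>K A \<inter> nb k. X l \<omega> ^ 4)) + ?c ^ 3 * X k \<omega> ^ 4) / 4"
        using alg3[OF cp c4] by simp
      also have "\<dots> = ?c\<^sup>2 * (\<Sum>l\<in>K A \<inter> nb k. (X k \<omega> ^ 4 + 3 * X l \<omega> ^ 4) / 4)"
        by (simp add: sum.distrib power2_eq_square power3_eq_cube algebra_simps flip: sum_divide_distrib sum_distrib_left)
      also have "\<dots> \<le> \<kappa>\<^sup>2 * (\<Sum>l\<in>K A \<inter> nb k. (X k \<omega> ^ 4 + 3 * X l \<omega> ^ 4) / 4)"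
        using ck by (intro mult_right_mono power_mono sum_nonneg) auto
      finally show ?thesis .
    qed
  qed
  have "(\<Sum>k\<in>K A. \<bar>X k \<omega>\<bar> * \<bar>Y A k \<omega>\<bar> ^ 3) \<le> (\<Sum>k\<in>K A. \<kappa>\<^sup>2 * (\<Sum>l\<in>K A \<inter> nb k. (X k \<omega> ^ 4 + 3 * X l \<omega> ^ 4) / 4))"
    by (intro sum_mono *)
  also have "\<dots> = \<kappa>\<^sup>2 * (\<Sum>j\<in>pairs A. (X (fst j) \<omega> ^ 4 + 3 * X (snd j) \<omega> ^ 4) / 4)"
    unfolding sum_pairs[where f="\<lambda>k l. (X k \<omega> ^ 4 + 3 * X l \<omega> ^ 4) / 4"] by (rule sum_distrib_left[symmetric])
  also have "\<dots> = \<kappa>\<^sup>2 * (((\<Sum>j\<in>pairs A. X (fst j) \<omega> ^ 4) + 3 * (\<Sum>j\<in>pairs A. X (snd j) \<omega> ^ 4)) / 4)"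
    by (simp add: sum.distrib sum_distrib_left flip: sum_divide_distrib)
  also have "\<dots> \<le> \<kappa>\<^sup>2 * ((\<kappa> * (\<Sum>k\<in>K A. X k \<omega> ^ 4) + 3 * (\<kappa> * (\<Sum>k\<in>K A. X k \<omega> ^ 4))) / 4)"
    by (intro mult_left_mono divide_right_mono add_mono sum_pairs_le_K) auto
  finally show ?thesis by (simp add: power2_eq_square power3_eq_cube)
qed

definition edges :: "(nat \<times> nat) set" where "edges = (SIGMA k:I. nb k)"

lemma finite_edges[simp]: "finite edges" unfolding edges_def by (intro finite_SigmaI) auto

lemma pairs_subset_edges: "pairs A \<subseteq> edges"
  using K_subset by (auto simp: pairs_def edges_def)

text \<open>
  A neighbouring pair outside \<open>pairs A\<close> has its first or its second component in \<open>N\<^sub>A\<close>. This is why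
  both \<open>nb k\<close> and its converse \<open>Nb k\<close> appear in the definition of \<open>T\<^sub>A\<close>.
\<close>

lemma sum_edges_minus_pairs_le:
  fixes f :: "nat \<Rightarrow> nat \<Rightarrow> real"
  assumes f: "\<And>k l. 0 \<le> f k l"
  shows "(\<Sum>j\<in>edges - pairs A. f (fst j) (snd j)) \<le> (\<Sum>k\<in>NA A. \<Sum>l\<in>nb k. f k l) + (\<Sum>k\<in>NA A. \<Sum>l\<in>Nb k. f l k)"
proof -
  let ?P1 = "SIGMA k:NA A. nb k" and ?P2 = "SIGMA k:NA A. Nb k"
  have fin: "finite ?P1" "finite ?P2" by (auto intro!: finite_SigmaI dest: NA_I)
  have sub: "edges - pairs A \<subseteq> ?P1 \<union> prod.swap ` ?P2"
  proof
    fix j assume j: "j \<in> edges - pairs A"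
    obtain k l where [simp]: "j = (k, l)" by (cases j)
    have kl: "k \<in> I" "l \<in> nb k" "l \<in> I" using j nb by (auto simp: edges_def)
    then have lk: "k \<in> Nb l" by (simp add: N_idx_def I_def)
    have "k \<notin> K A \<or> l \<notin> K A" using j kl by (auto simp: pairs_def)
    then have "k \<in> NA A \<or> l \<in> NA A" using kl by (auto simp: N_set_compl_def I_def)
    then show "j \<in> ?P1 \<union> prod.swap ` ?P2" using kl lk by (auto simp: image_iff)
  qed
  have "(\<Sum>j\<in>edges - pairs A. f (fst j) (snd j)) \<le> (\<Sum>j\<in>?P1 \<union> prod.swap ` ?P2. f (fst j) (snd j))"
    using fin sub f by (intro sum_mono2) auto
  also have "\<dots> \<le> (\<Sum>j\<in>?P1. f (fst j) (snd j)) + (\<Sum>j\<in>prod.swap ` ?P2. f (fst j) (snd j))"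
    using fin f by (subst sum_Un) (auto intro!: sum_nonneg)
  also have "(\<Sum>j\<in>prod.swap ` ?P2. f (fst j) (snd j)) = (\<Sum>j\<in>?P2. f (snd j) (fst j))"
    by (subst sum.reindex) (auto simp: inj_on_def)
  also have "(\<Sum>j\<in>?P1. f (fst j) (snd j)) = (\<Sum>k\<in>NA A. \<Sum>l\<in>nb k. f k l)"
    by (subst sum.Sigma) (auto simp: case_prod_beta dest: NA_I)
  also have "(\<Sum>j\<in>?P2. f (snd j) (fst j)) = (\<Sum>k\<in>NA A. \<Sum>l\<in>Nb k. f l k)"
    by (subst sum.Sigma) (auto simp: case_prod_beta)
  finally show ?thesis .
qed

lemma Dsum_ge: "(\<Sum>k\<in>NA A. \<Sum>l\<in>nb k. x k * x l) \<le> Dsum A" "(\<Sum>k\<in>NA A. \<Sum>l\<in>Nb k. x k * x l) \<le> Dsum A"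
  unfolding Dsum_def by (intro sum_mono sum_mono2; auto dest: NA_I)+

lemma Dsum_nonneg: "0 \<le> Dsum A" unfolding Dsum_def by (auto intro!: sum_nonneg)

text \<open>
  Over all neighbouring pairs the covariances add up to \<open>1\<close>.
\<close>

lemma mean_U_near_1: "\<bar>mean_U A - 1\<bar> \<le> 2 * Dsum A"
proof -
  let ?f = "\<lambda>k l. expectation (\<lambda>\<omega>. X k \<omega> * X l \<omega>)"
  have "1 = (\<Sum>j\<in>edges. ?f (fst j) (snd j))"
    unfolding sum_cov_eq_1[symmetric] edges_def by (subst sum.Sigma) (auto simp: case_prod_beta)
  also have "\<dots> = (\<Sum>j\<in>edges - pairs A. ?f (fst j) (snd j)) + mean_U A"
    unfolding mean_U_def by (rule sum.subset_diff[OF pairs_subset_edges finite_edges])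
  finally have "\<bar>mean_U A - 1\<bar> = \<bar>\<Sum>j\<in>edges - pairs A. ?f (fst j) (snd j)\<bar>" by simp
  also have "\<dots> \<le> (\<Sum>j\<in>edges - pairs A. \<bar>?f (fst j) (snd j)\<bar>)" by (rule sum_abs)
  also have "\<dots> \<le> (\<Sum>j\<in>edges - pairs A. x (fst j) * x (snd j))"
  proof (intro sum_mono)
    fix j assume "j \<in> edges - pairs A"
    then have "fst j \<in> I" "snd j \<in> I" using nb_I by (auto simp: edges_def)
    then show "\<bar>?f (fst j) (snd j)\<bar> \<le> x (fst j) * x (snd j)"
      by (intro order_trans[OF integral_abs_bound] expectation_abs_XX_le)
  qed
  also have "\<dots> \<le> (\<Sum>k\<in>NA A. \<Sum>l\<in>nb k. x k * x l) + (\<Sum>k\<in>NA A. \<Sum>l\<in>Nb k. x l * x k)"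
    by (rule sum_edges_minus_pairs_le[where f="\<lambda>k l. x k * x l"]) auto
  also have "\<dots> \<le> 2 * Dsum A" using Dsum_ge[of A] by (simp add: mult.commute)
  finally show ?thesis .
qed

lemma mean_absU_le: "(\<Sum>j\<in>pairs A. expectation (\<lambda>\<omega>. \<bar>X (fst j) \<omega> * X (snd j) \<omega>\<bar>)) \<le> lam"
proof -
  have "(\<Sum>j\<in>pairs A. expectation (\<lambda>\<omega>. \<bar>X (fst j) \<omega> * X (snd j) \<omega>\<bar>)) \<le> (\<Sum>j\<in>edges. expectation (\<lambda>\<omega>. \<bar>X (fst j) \<omega> * X (snd j) \<omega>\<bar>))"
    by (intro sum_mono2 pairs_subset_edges finite_edges) auto
  also have "\<dots> = (\<Sum>k\<in>I. \<Sum>l\<in>nb k. expectation (\<lambda>\<omega>. \<bar>X k \<omega> * X l \<omega>\<bar>))"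
    unfolding edges_def by (subst sum.Sigma) (auto simp: case_prod_beta)
  finally show ?thesis using sum_abs_moment_le_lam by simp
qed

lemma S_measurable[measurable]: "S A \<in> borel_measurable M"
  unfolding S_def[abs_def] by (intro borel_measurable_sum) (auto dest: K_I intro: X_meas)

lemma U_measurable[measurable]: "U A \<in> borel_measurable M"
  unfolding U_def[abs_def] by (intro borel_measurable_sum borel_measurable_times) (auto simp: pairs_iff dest: K_I intro!: X_meas)

lemma Tsq_measurable[measurable]: "Tsq A \<in> borel_measurable M"
  unfolding Tsq_def[abs_def]
  by (intro borel_measurable_sum borel_measurable_add borel_measurable_abs borel_measurable_times) (auto dest: NA_I Nb_I intro: nb_I intro!: X_meas)

lemma Zstar_measurable[measurable]: "Zstar A \<in> borel_measurable M"
  unfolding Zstar_def[abs_def]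
proof -
  have [measurable]: "(\<lambda>\<omega>. \<Sum>k\<in>K A. X k \<omega> ^ 4) \<in> borel_measurable M"
    by (intro borel_measurable_sum borel_measurable_power) (auto dest: K_I intro: X_meas)
  show "(\<lambda>\<omega>. root 4 (8 * \<kappa> ^ 3 * (\<Sum>k\<in>K A. X k \<omega> ^ 4))) \<in> borel_measurable M"
    by measurable
qed

lemma Tsq_nonneg: "0 \<le> Tsq A \<omega>" unfolding Tsq_def by (auto intro!: sum_nonneg add_nonneg_nonneg)

text \<open>
  The fourth power of \<open>T\<^sub>A\<close> is the square of a sum of products of two variables. The factor \<open>sqrt 2\<close>
  comes from indices that belong to both \<open>nb k\<close> and \<open>Nb k\<close> and so are counted twice.
\<close>

lemma L4_T: "L4_bound M (\<lambda>\<omega>. sqrt (Tsq A \<omega>)) (sqrt 2 * sqrt (Dsum A))"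
proof -
  let ?P = "SIGMA k:NA A. Nb k \<union> nb k"
  let ?t = "\<lambda>j \<omega>. \<bar>X (fst j) \<omega> * X (snd j) \<omega>\<bar>"
  have inI: "fst j \<in> I" "snd j \<in> I" if "j \<in> ?P" for j using that by (auto dest: NA_I Nb_I intro: nb_I)
  have le: "Tsq A \<omega> \<le> 2 * (\<Sum>j\<in>?P. ?t j \<omega>)" for \<omega>
  proof -
    have "(\<Sum>k\<in>NA A. \<Sum>l\<in>nb k. \<bar>X k \<omega> * X l \<omega>\<bar>) \<le> (\<Sum>k\<in>NA A. \<Sum>l\<in>Nb k \<union> nb k. \<bar>X k \<omega> * X l \<omega>\<bar>)"
      by (intro sum_mono sum_mono2) (auto dest: NA_I)
    moreover have "(\<Sum>k\<in>NA A. \<Sum>l\<in>Nb k. \<bar>X k \<omega> * X l \<omega>\<bar>) \<le> (\<Sum>k\<in>NA A. \<Sum>l\<in>Nb k \<union> nb k. \<bar>X k \<omega> * X l \<omega>\<bar>)"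
      by (intro sum_mono sum_mono2) (auto dest: NA_I)
    moreover have "(\<Sum>j\<in>?P. ?t j \<omega>) = (\<Sum>k\<in>NA A. \<Sum>l\<in>Nb k \<union> nb k. \<bar>X k \<omega> * X l \<omega>\<bar>)"
      by (subst sum.Sigma) (auto simp: case_prod_beta dest: NA_I)
    ultimately show ?thesis unfolding Tsq_def by simp
  qed
  have sq: "(\<Sum>j\<in>?P. ?t j \<omega>)\<^sup>2 = (\<Sum>j\<in>?P. \<Sum>j'\<in>?P. ?t j \<omega> * ?t j' \<omega>)" for \<omega>
    by (simp add: power2_eq_square sum_product)
  have int: "integrable M (\<lambda>\<omega>. ?t j \<omega> * ?t j' \<omega>)" and
    bd: "expectation (\<lambda>\<omega>. ?t j \<omega> * ?t j' \<omega>) \<le> (x (fst j) * x (snd j)) * (x (fst j') * x (snd j'))"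
    if "j \<in> ?P" "j' \<in> ?P" for j j'
  proof -
    note B = L4_bound_mult4[OF L4_X[OF inI(1)[OF that(1)]] L4_X[OF inI(2)[OF that(1)]] L4_X[OF inI(1)[OF that(2)]] L4_X[OF inI(2)[OF that(2)]]]
    have eq: "?t j \<omega> * ?t j' \<omega> = \<bar>X (fst j) \<omega> * X (snd j) \<omega> * X (fst j') \<omega> * X (snd j') \<omega>\<bar>" for \<omega>
      by (simp add: abs_mult)
    show "integrable M (\<lambda>\<omega>. ?t j \<omega> * ?t j' \<omega>)" unfolding eq using B(1) by simp
    show "expectation (\<lambda>\<omega>. ?t j \<omega> * ?t j' \<omega>) \<le> (x (fst j) * x (snd j)) * (x (fst j') * x (snd j'))"
      unfolding eq using B(2) by (simp add: mult.assoc)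
  qed
  have int2: "integrable M (\<lambda>\<omega>. (\<Sum>j\<in>?P. ?t j \<omega>)\<^sup>2)"
    unfolding sq by (intro Bochner_Integration.integrable_sum int)
  have D: "Dsum A = (\<Sum>j\<in>?P. x (fst j) * x (snd j))"
    unfolding Dsum_def by (subst sum.Sigma) (auto simp: case_prod_beta dest: NA_I)
  have E: "expectation (\<lambda>\<omega>. (\<Sum>j\<in>?P. ?t j \<omega>)\<^sup>2) \<le> (Dsum A)\<^sup>2"
  proof -
    have "expectation (\<lambda>\<omega>. (\<Sum>j\<in>?P. ?t j \<omega>)\<^sup>2) = (\<Sum>j\<in>?P. \<Sum>j'\<in>?P. expectation (\<lambda>\<omega>. ?t j \<omega> * ?t j' \<omega>))"
      unfolding sq
      by (subst Bochner_Integration.integral_sum, (intro Bochner_Integration.integrable_sum int; assumption),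
        intro sum.cong refl Bochner_Integration.integral_sum int)
    also have "\<dots> \<le> (\<Sum>j\<in>?P. \<Sum>j'\<in>?P. (x (fst j) * x (snd j)) * (x (fst j') * x (snd j')))"
      by (intro sum_mono bd)
    also have "\<dots> = (Dsum A)\<^sup>2" unfolding D by (simp add: power2_eq_square sum_product)
    finally show ?thesis .
  qed
  have le2: "(Tsq A \<omega>)\<^sup>2 \<le> 4 * (\<Sum>j\<in>?P. ?t j \<omega>)\<^sup>2" for \<omega>
    using power_mono[OF le Tsq_nonneg, of \<omega> 2] by (simp add: power_mult_distrib)
  have sqrt4: "sqrt t ^ 4 = t\<^sup>2" if "0 \<le> t" for t :: real
    using that power_mult[of "sqrt t" 2 2] by simp
  have i: "integrable M (\<lambda>\<omega>. (Tsq A \<omega>)\<^sup>2)"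
  proof (rule Bochner_Integration.integrable_bound)
    show "integrable M (\<lambda>\<omega>. 4 * (\<Sum>j\<in>?P. ?t j \<omega>)\<^sup>2)" using int2 by simp
    show "AE \<omega> in M. norm ((Tsq A \<omega>)\<^sup>2) \<le> norm (4 * (\<Sum>j\<in>?P. ?t j \<omega>)\<^sup>2)"
      using le2 by (intro AE_I2) simp
  qed measurable
  have "expectation (\<lambda>\<omega>. (Tsq A \<omega>)\<^sup>2) \<le> expectation (\<lambda>\<omega>. 4 * (\<Sum>j\<in>?P. ?t j \<omega>)\<^sup>2)"
    using int2 by (intro integral_mono i le2) simp
  also have "\<dots> \<le> 4 * (Dsum A)\<^sup>2" using E by simp
  also have "\<dots> = (sqrt 2 * sqrt (Dsum A)) ^ 4"
    using sqrt4[of 2] sqrt4[OF Dsum_nonneg] by (simp add: power_mult_distrib)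
  finally show ?thesis
    unfolding L4_bound_def using i Tsq_nonneg Dsum_nonneg by (simp add: sqrt4)
qed

text \<open>
  The power mean inequality, in the form of the Cauchy--Schwarz inequality used twice.
\<close>

lemma sum_abs_le_Zstar:
  assumes J: "J \<subseteq> K A" "real (card J) \<le> 2 * \<kappa>"
  shows "(\<Sum>k\<in>J. \<bar>X k \<omega>\<bar>) \<le> Zstar A \<omega>"
proof -
  let ?s = "\<Sum>k\<in>J. \<bar>X k \<omega>\<bar>"
  have "?s ^ 4 = (?s\<^sup>2)\<^sup>2" by (simp flip: power_mult)
  also have "\<dots> \<le> ((\<Sum>l\<in>J. (X l \<omega>)\<^sup>2) * card J)\<^sup>2"
    using sum_squared_le_sum_of_squares[of "\<lambda>k. \<bar>X k \<omega>\<bar>" J] by (intro power_mono) auto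
  also have "\<dots> = (\<Sum>l\<in>J. (X l \<omega>)\<^sup>2)\<^sup>2 * (real (card J))\<^sup>2" by (simp add: power_mult_distrib)
  also have "\<dots> \<le> ((\<Sum>l\<in>J. ((X l \<omega>)\<^sup>2)\<^sup>2) * card J) * (real (card J))\<^sup>2"
    by (intro mult_right_mono sum_squared_le_sum_of_squares) auto
  also have "\<dots> = (real (card J)) ^ 3 * (\<Sum>l\<in>J. X l \<omega> ^ 4)" 
    by (simp add: power2_eq_square power3_eq_cube power4_eq_xxxx ac_simps)
  also have "\<dots> \<le> (2 * \<kappa>) ^ 3 * (\<Sum>k\<in>K A. X k \<omega> ^ 4)"
    using J kappa_pos by (intro mult_mono power_mono sum_mono2 sum_nonneg) auto
  also have "\<dots> = 8 * \<kappa> ^ 3 * (\<Sum>k\<in>K A. X k \<omega> ^ 4)" by (simp add: power_mult_distrib)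
  finally have "root 4 (?s ^ 4) \<le> Zstar A \<omega>" unfolding Zstar_def by (rule real_root_le_mono[rotated]) simp
  then show ?thesis by (simp add: real_root_power_cancel sum_nonneg)
qed

lemma Zstar_nonneg: "0 \<le> Zstar A \<omega>"
  using kappa_pos unfolding Zstar_def by (auto intro!: mult_nonneg_nonneg sum_nonneg)

lemma Zstar_pow4: "Zstar A \<omega> ^ 4 = 8 * \<kappa> ^ 3 * (\<Sum>k\<in>K A. X k \<omega> ^ 4)"
  unfolding Zstar_def using kappa_pos by (simp add: sum_nonneg)

lemma sum_K_x_le: "(\<Sum>k\<in>K A. x k ^ 4) \<le> sum_x4" "(\<Sum>k\<in>K A. x k ^ 3) \<le> sum_x3"
  unfolding sum_x4_def sum_x3_def by (intro sum_mono2 K_subset finite_I; simp)+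

context
  fixes A v \<rho>
  assumes A: "A \<subseteq> I" "A \<noteq> {}" and v: "v \<in> borel_measurable (gen A)" "L4_bound M v \<rho>"
begin

lemma v_measurable: "v \<in> borel_measurable M" using v(2) by (simp add: L4_bound_def)

lemma rho_nonneg: "0 \<le> \<rho>" using v(2) by (simp add: L4_bound_def)

lemma L4_Zstar:
  assumes small: "8 * \<kappa> ^ 3 * sum_x4 \<le> 1"
  shows "L4_bound M (\<lambda>\<omega>. v \<omega> * Zstar A \<omega>) \<rho>"
proof -
  note L = L4_weighted_X[OF A(1) v, unfolded L4_bound_def]
  have eq: "(v \<omega> * Zstar A \<omega>) ^ 4 = 8 * \<kappa> ^ 3 * (\<Sum>k\<in>K A. (v \<omega> * X k \<omega>) ^ 4)" for \<omega>
    by (simp add: power_mult_distrib Zstar_pow4 sum_distrib_left ac_simps)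
  have i: "integrable M (\<lambda>\<omega>. (v \<omega> * Zstar A \<omega>) ^ 4)"
    unfolding eq using L by (intro integrable_mult_right Bochner_Integration.integrable_sum) auto
  have "expectation (\<lambda>\<omega>. (v \<omega> * Zstar A \<omega>) ^ 4) = 8 * \<kappa> ^ 3 * (\<Sum>k\<in>K A. expectation (\<lambda>\<omega>. (v \<omega> * X k \<omega>) ^ 4))"
    unfolding eq using L by (subst integral_mult_right_zero, subst Bochner_Integration.integral_sum) auto
  also have "\<dots> \<le> 8 * \<kappa> ^ 3 * (\<Sum>k\<in>K A. (\<rho> * x k) ^ 4)"
    using L kappa_pos by (intro mult_left_mono sum_mono) auto
  also have "\<dots> = \<rho> ^ 4 * (8 * \<kappa> ^ 3 * (\<Sum>k\<in>K A. x k ^ 4))"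
    by (simp add: power_mult_distrib sum_distrib_left ac_simps)
  also have "\<dots> \<le> \<rho> ^ 4 * (8 * \<kappa> ^ 3 * sum_x4)"
    using kappa_pos sum_K_x_le by (intro mult_left_mono) auto
  also have "\<dots> \<le> \<rho> ^ 4" using small by (intro mult_left_le) auto
  finally show ?thesis using i rho_nonneg v_measurable by (simp add: L4_bound_def)
qed

text \<open>
  The second moment of a sum of pair functions is the square of its mean up to the small variance.
\<close>

lemma L4_pair_sum:
  assumes \<phi>_meas: "\<And>j. j \<in> pairs A \<Longrightarrow> \<phi> j \<in> borel_measurable (gen {fst j, snd j})"
    and \<phi>_le: "\<And>j \<omega>. j \<in> pairs A \<Longrightarrow> \<bar>\<phi> j \<omega>\<bar> \<le> \<bar>X (fst j) \<omega> * X (snd j) \<omega>\<bar>"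
    and m: "\<bar>\<Sum>j\<in>pairs A. expectation (\<phi> j)\<bar> \<le> \<mu>" "1 \<le> \<mu>" and small: "var_scale A \<le> 1 / 2000"
  shows "L4_bound M (\<lambda>\<omega>. sqrt \<bar>(v \<omega>)\<^sup>2 * (\<Sum>j\<in>pairs A. \<phi> j \<omega>)\<bar>) (sqrt (\<rho>\<^sup>2 * (1.1 * \<mu>)))"
proof (rule L4_bound_sqrt_abs)
  let ?m = "\<Sum>j\<in>pairs A. expectation (\<phi> j)"
  note V = weighted_variance[OF A v \<phi>_meas \<phi>_le]
  have v4: "integrable M (\<lambda>\<omega>. v \<omega> ^ 4)" "expectation (\<lambda>\<omega>. v \<omega> ^ 4) \<le> \<rho> ^ 4"
    using v by (auto simp: L4_bound_def)
  have \<phi>M: "\<phi> j \<in> borel_measurable M" if "j \<in> pairs A" for j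
    using that by (intro gen_measurable[OF \<phi>_meas]) (auto simp: pairs_iff dest: K_I)
  show meas: "(\<lambda>\<omega>. (v \<omega>)\<^sup>2 * (\<Sum>j\<in>pairs A. \<phi> j \<omega>)) \<in> borel_measurable M"
    using v_measurable \<phi>M by (intro borel_measurable_times borel_measurable_power borel_measurable_sum)
  let ?h = "\<lambda>\<omega>. 1.1 * ?m\<^sup>2 * v \<omega> ^ 4 + 11 * (v \<omega> ^ 4 * ((\<Sum>j\<in>pairs A. \<phi> j \<omega>) - ?m)\<^sup>2)"
  have le: "((v \<omega>)\<^sup>2 * (\<Sum>j\<in>pairs A. \<phi> j \<omega>))\<^sup>2 \<le> ?h \<omega>" for \<omega>
  proof -
    \<comment> \<open>The two coefficients belong together: \<open>1 / 1.1 + 1 / 11 = 1\<close>.\<close>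
    have "(a::real)\<^sup>2 \<le> 1.1 * b\<^sup>2 + 11 * (a - b)\<^sup>2" for a b
    proof -
      have "1.1 * b\<^sup>2 + 11 * (a - b)\<^sup>2 - a\<^sup>2 = (10 * a - 11 * b)\<^sup>2 / 10"
        by (simp add: power2_eq_square algebra_simps)
      also have "\<dots> \<ge> 0" by simp
      finally show ?thesis by simp
    qed
    from mult_left_mono[OF this, of "v \<omega> ^ 4" "\<Sum>j\<in>pairs A. \<phi> j \<omega>" ?m]
    show ?thesis by (simp add: power_mult_distrib algebra_simps flip: power_mult)
  qed
  have hi: "integrable M ?h" using v4 V(1) by simp
  show int: "integrable M (\<lambda>\<omega>. ((v \<omega>)\<^sup>2 * (\<Sum>j\<in>pairs A. \<phi> j \<omega>))\<^sup>2)"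
  proof (rule Bochner_Integration.integrable_bound[OF hi])
    show "(\<lambda>\<omega>. ((v \<omega>)\<^sup>2 * (\<Sum>j\<in>pairs A. \<phi> j \<omega>))\<^sup>2) \<in> borel_measurable M" using meas by measurable
    show "AE \<omega> in M. norm (((v \<omega>)\<^sup>2 * (\<Sum>j\<in>pairs A. \<phi> j \<omega>))\<^sup>2) \<le> norm (?h \<omega>)"
    proof (intro AE_I2)
      fix \<omega> show "norm (((v \<omega>)\<^sup>2 * (\<Sum>j\<in>pairs A. \<phi> j \<omega>))\<^sup>2) \<le> norm (?h \<omega>)"
        using order_trans[OF le[of \<omega>] abs_ge_self] by simp
    qed
  qed
  have "expectation (\<lambda>\<omega>. ((v \<omega>)\<^sup>2 * (\<Sum>j\<in>pairs A. \<phi> j \<omega>))\<^sup>2) \<le> expectation ?h"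
    by (rule integral_mono[OF int hi le])
  also have "\<dots> = 1.1 * ?m\<^sup>2 * expectation (\<lambda>\<omega>. v \<omega> ^ 4) + 11 * expectation (\<lambda>\<omega>. v \<omega> ^ 4 * ((\<Sum>j\<in>pairs A. \<phi> j \<omega>) - ?m)\<^sup>2)"
    using v4 V(1) by simp
  also have "\<dots> \<le> 1.1 * \<mu>\<^sup>2 * \<rho> ^ 4 + 11 * (12 * \<rho> ^ 4 * var_scale A)"
  proof (intro add_mono mult_mono)
    show "?m\<^sup>2 \<le> \<mu>\<^sup>2" using m by (metis abs_ge_zero power2_abs power_mono)
  qed (use v4 V(2) in auto)
  also have "\<dots> \<le> 1.1 * \<mu>\<^sup>2 * \<rho> ^ 4 + 11 * (12 * \<rho> ^ 4 * (1 / 2000))"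
    using small by (intro add_left_mono mult_left_mono) auto
  also have "\<dots> \<le> 121 / 100 * \<mu>\<^sup>2 * \<rho> ^ 4"
  proof -
    have "1 \<le> \<mu>\<^sup>2" using m(2) by simp
    then have "1 * \<rho> ^ 4 \<le> \<mu>\<^sup>2 * \<rho> ^ 4" by (intro mult_right_mono) auto
    moreover have "0 \<le> \<rho> ^ 4" by simp
    ultimately show ?thesis by linarith
  qed
  also have "\<dots> = (\<rho>\<^sup>2 * (1.1 * \<mu>))\<^sup>2" by (simp add: power2_eq_square power4_eq_xxxx)
  finally show "expectation (\<lambda>\<omega>. ((v \<omega>)\<^sup>2 * (\<Sum>j\<in>pairs A. \<phi> j \<omega>))\<^sup>2) \<le> (\<rho>\<^sup>2 * (1.1 * \<mu>))\<^sup>2" .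
  show "0 \<le> \<rho>\<^sup>2 * (1.1 * \<mu>)" using m by simp
qed

lemma pair_product_gen: "(\<lambda>\<omega>. X (fst j) \<omega> * X (snd j) \<omega>) \<in> borel_measurable (gen {fst j, snd j})"
proof -
  have [measurable]: "X (fst j) \<in> borel_measurable (gen {fst j, snd j})" "X (snd j) \<in> borel_measurable (gen {fst j, snd j})"
    by (auto intro: X_measurable_gen)
  show ?thesis by measurable
qed

text \<open>
  Stein's method for the function \<open>s\<^sup>3\<close>: since \<open>X\<^sub>k\<close> is independent of \<open>v\<close> and of
  \<open>S A - Y A k\<close>, the expectation of \<open>v\<^sup>4 S\<^sup>4\<close> is that of \<open>v\<^sup>4 \<Sum>\<^sub>k X\<^sub>k (S\<^sup>3 - (S - Y\<^sub>k)\<^sup>3)\<close>. The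
  leading term is \<open>3 S\<^sup>2 U\<close>. Up to small terms, this bounds the fourth power of the norm of \<open>v S\<close>
  by \<open>3.4 \<rho>\<^sup>2\<close> times its square, and the resulting inequality for the norm excludes values
  above \<open>2 \<rho>\<close>.
\<close>

lemma L4_S:
  assumes small: "8 * \<kappa> ^ 3 * sum_x4 \<le> 1" "var_scale A \<le> 1 / 2000" "\<kappa>\<^sup>2 * sum_x3 \<le> 1 / 100" "Dsum A \<le> 1 / 200"
  shows "L4_bound M (\<lambda>\<omega>. v \<omega> * S A \<omega>) (2 * \<rho>)"
proof -
  note [measurable] = v_measurable
  note L = L4_weighted_X[OF A(1) v]
  have vJ: "integrable M (\<lambda>\<omega>. (v \<omega> * (\<Sum>k\<in>J. X k \<omega>)) ^ 4)" "(\<lambda>\<omega>. v \<omega> * (\<Sum>k\<in>J. X k \<omega>)) \<in> borel_measurable M"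
    if "J \<subseteq> K A" for J
  proof -
    have "integrable M (\<lambda>\<omega>. (\<Sum>k\<in>J. v \<omega> * X k \<omega>) ^ 4)"
      by (rule L4_bound_sum_integrable) (use that L finite_subset[OF that] in \<open>auto simp: L4_bound_def\<close>)
    then show "integrable M (\<lambda>\<omega>. (v \<omega> * (\<Sum>k\<in>J. X k \<omega>)) ^ 4)" by (simp add: sum_distrib_left)
    show "(\<lambda>\<omega>. v \<omega> * (\<Sum>k\<in>J. X k \<omega>)) \<in> borel_measurable M"
      using that by (intro borel_measurable_times borel_measurable_sum v_measurable) (auto dest: K_I intro: X_meas)
  qed
  define r where "r = root 4 (expectation (\<lambda>\<omega>. (v \<omega> * S A \<omega>) ^ 4))"
  have r0: "0 \<le> r" by (simp add: r_def)
  have r4: "r ^ 4 = expectation (\<lambda>\<omega>. (v \<omega> * S A \<omega>) ^ 4)" by (simp add: r_def)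
  have LS: "L4_bound M (\<lambda>\<omega>. v \<omega> * S A \<omega>) r"
    using vJ[OF order_refl] r0 r4 by (simp add: L4_bound_def S_def)
  define Sk where "Sk k \<omega> = (\<Sum>l\<in>K A - nb k. X l \<omega>)" for k \<omega>
  have LSk: "L4_bound M (\<lambda>\<omega>. v \<omega> * Sk k \<omega>) (root 4 (expectation (\<lambda>\<omega>. (v \<omega> * Sk k \<omega>) ^ 4)))" for k
    using vJ[of "K A - nb k"] by (auto simp: L4_bound_def Sk_def)
  have zero: "integrable M (\<lambda>\<omega>. X k \<omega> * (v \<omega> ^ 4 * Sk k \<omega> ^ 3))" "expectation (\<lambda>\<omega>. X k \<omega> * (v \<omega> ^ 4 * Sk k \<omega> ^ 3)) = 0"
    if k: "k \<in> K A" for k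
  proof -
    have [measurable]: "v \<in> borel_measurable (gen (I - nb k))" by (rule gen_mono[OF v(1) K_disjoint[OF k A(1)]])
    have [measurable]: "Sk k \<in> borel_measurable (gen (I - nb k))"
      unfolding Sk_def[abs_def] by (intro borel_measurable_sum X_measurable_gen) (auto dest: K_I)
    have "(\<lambda>\<omega>. v \<omega> ^ 4 * Sk k \<omega> ^ 3) \<in> borel_measurable (gen (I - nb k))" by measurable
    then have iv: "indep_var borel (X k) borel (\<lambda>\<omega>. v \<omega> ^ 4 * Sk k \<omega> ^ 3)"
      using X_measurable_gen[of k "{k}"] by (intro indep1_gen[OF K_I[OF k] order_refl]) auto
    have "integrable M (\<lambda>\<omega>. v \<omega> * (v \<omega> * Sk k \<omega>) * (v \<omega> * Sk k \<omega>) * (v \<omega> * Sk k \<omega>))"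
      by (rule L4_bound_mult4(1)[OF v(2) LSk LSk LSk])
    then have i: "integrable M (\<lambda>\<omega>. v \<omega> ^ 4 * Sk k \<omega> ^ 3)"
      by (simp add: power4_eq_xxxx power3_eq_cube ac_simps)
    show "integrable M (\<lambda>\<omega>. X k \<omega> * (v \<omega> ^ 4 * Sk k \<omega> ^ 3))" "expectation (\<lambda>\<omega>. X k \<omega> * (v \<omega> ^ 4 * Sk k \<omega> ^ 3)) = 0"
      using indep_var_integrable[OF iv integrable_X[OF K_I[OF k]] i] indep_var_lebesgue_integral[OF iv integrable_X[OF K_I[OF k]] i]
      mean_zero[OF K_I[OF k]] by auto
  qed
  let ?g1 = "\<lambda>\<omega>. (v \<omega> * S A \<omega>) * (v \<omega> * S A \<omega>) * sqrt \<bar>(v \<omega>)\<^sup>2 * U A \<omega>\<bar> * sqrt \<bar>(v \<omega>)\<^sup>2 * U A \<omega>\<bar>"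
  let ?g2 = "\<lambda>k \<omega>. (v \<omega> * S A \<omega>) * (v \<omega> * X k \<omega>) * (v \<omega> * X k \<omega>) * (v \<omega> * X k \<omega>)"
  let ?g3 = "\<lambda>k \<omega>. (v \<omega> * X k \<omega>) ^ 4"
  have point: "(v \<omega> * S A \<omega>) ^ 4 \<le> (\<Sum>k\<in>K A. X k \<omega> * (v \<omega> ^ 4 * Sk k \<omega> ^ 3)) + (3 * \<bar>?g1 \<omega>\<bar> + 3 * (\<kappa>\<^sup>2 * (\<Sum>k\<in>K A. \<bar>?g2 k \<omega>\<bar>)) + \<kappa> ^ 3 * (\<Sum>k\<in>K A. ?g3 k \<omega>))"
    for \<omega>
  proof -
    let ?s = "S A \<omega>" and ?y = "\<lambda>k. Y A k \<omega>"
    have "?s ^ 4 - (\<Sum>k\<in>K A. X k \<omega> * Sk k \<omega> ^ 3) = (\<Sum>k\<in>K A. X k \<omega> * (?s ^ 3 - (?s - ?y k) ^ 3))"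
    proof -
      have "?s ^ 4 = (\<Sum>k\<in>K A. X k \<omega> * ?s ^ 3)"
        unfolding sum_distrib_right[symmetric] S_def[symmetric] by (simp add: power4_eq_xxxx power3_eq_cube)
      moreover have "(\<Sum>k\<in>K A. X k \<omega> * Sk k \<omega> ^ 3) = (\<Sum>k\<in>K A. X k \<omega> * (?s - ?y k) ^ 3)"
        by (intro sum.cong refl) (simp add: S_minus_Y Sk_def)
      ultimately show ?thesis by (simp add: sum_subtractf right_diff_distrib)
    qed
    also have "\<dots> = (\<Sum>k\<in>K A. 3 * ?s\<^sup>2 * (X k \<omega> * ?y k) - 3 * ?s * (X k \<omega> * (?y k)\<^sup>2) + X k \<omega> * ?y k ^ 3)"
      by (intro sum.cong refl) (simp add: power2_eq_square power3_eq_cube algebra_simps)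
    also have "\<dots> = 3 * ?s\<^sup>2 * U A \<omega> - 3 * ?s * (\<Sum>k\<in>K A. X k \<omega> * (?y k)\<^sup>2) + (\<Sum>k\<in>K A. X k \<omega> * ?y k ^ 3)"
      by (simp only: sum.distrib sum_subtractf sum_XY flip: sum_distrib_left)
    also have "\<dots> \<le> 3 * ?s\<^sup>2 * \<bar>U A \<omega>\<bar> + 3 * \<bar>?s\<bar> * cubes A \<omega> + \<kappa> ^ 3 * (\<Sum>k\<in>K A. X k \<omega> ^ 4)"
    proof -
      have "3 * ?s\<^sup>2 * U A \<omega> \<le> 3 * ?s\<^sup>2 * \<bar>U A \<omega>\<bar>" by (intro mult_left_mono) auto
      moreover have "- (3 * ?s * (\<Sum>k\<in>K A. X k \<omega> * (?y k)\<^sup>2)) \<le> 3 * \<bar>?s\<bar> * cubes A \<omega>"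
      proof -
        have "\<bar>\<Sum>k\<in>K A. X k \<omega> * (?y k)\<^sup>2\<bar> \<le> (\<Sum>k\<in>K A. \<bar>X k \<omega>\<bar> * (?y k)\<^sup>2)"
          by (rule order_trans[OF sum_abs]) (simp add: abs_mult)
        then have "\<bar>\<Sum>k\<in>K A. X k \<omega> * (?y k)\<^sup>2\<bar> \<le> cubes A \<omega>" using sum_XY2_le[where A=A and \<omega>=\<omega>] by linarith
        then have "\<bar>?s\<bar> * \<bar>\<Sum>k\<in>K A. X k \<omega> * (?y k)\<^sup>2\<bar> \<le> \<bar>?s\<bar> * cubes A \<omega>" by (intro mult_left_mono) auto
        then show ?thesis by (simp add: mult.assoc flip: abs_mult)
      qed
      moreover have "(\<Sum>k\<in>K A. X k \<omega> * ?y k ^ 3) \<le> \<kappa> ^ 3 * (\<Sum>k\<in>K A. X k \<omega> ^ 4)"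
      proof -
        have "(\<Sum>k\<in>K A. X k \<omega> * ?y k ^ 3) \<le> (\<Sum>k\<in>K A. \<bar>X k \<omega>\<bar> * \<bar>?y k\<bar> ^ 3)"
        proof (intro sum_mono)
          fix k
          have "X k \<omega> * ?y k ^ 3 \<le> \<bar>X k \<omega> * ?y k ^ 3\<bar>" by (rule abs_ge_self)
          then show "X k \<omega> * ?y k ^ 3 \<le> \<bar>X k \<omega>\<bar> * \<bar>?y k\<bar> ^ 3" by (simp only: abs_mult power_abs)
        qed
        then show ?thesis using sum_XY3_le[where A=A and \<omega>=\<omega>] by linarith
      qed
      ultimately show ?thesis by linarith
    qed
    finally have "v \<omega> ^ 4 * ?s ^ 4 \<le> v \<omega> ^ 4 * ((\<Sum>k\<in>K A. X k \<omega> * Sk k \<omega> ^ 3) + (3 * ?s\<^sup>2 * \<bar>U A \<omega>\<bar> + 3 * \<bar>?s\<bar> * cubes A \<omega> + \<kappa> ^ 3 * (\<Sum>k\<in>K A. X k \<omega> ^ 4)))"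
      by (intro mult_left_mono) auto
    also have "\<dots> = (\<Sum>k\<in>K A. X k \<omega> * (v \<omega> ^ 4 * Sk k \<omega> ^ 3)) + (3 * \<bar>?g1 \<omega>\<bar> + 3 * (\<kappa>\<^sup>2 * (\<Sum>k\<in>K A. \<bar>?g2 k \<omega>\<bar>)) + \<kappa> ^ 3 * (\<Sum>k\<in>K A. ?g3 k \<omega>))"
    proof -
      have "\<bar>?g1 \<omega>\<bar> = v \<omega> ^ 4 * (?s\<^sup>2 * \<bar>U A \<omega>\<bar>)"
      proof -
        have "sqrt \<bar>(v \<omega>)\<^sup>2 * U A \<omega>\<bar> * sqrt \<bar>(v \<omega>)\<^sup>2 * U A \<omega>\<bar> = (v \<omega>)\<^sup>2 * \<bar>U A \<omega>\<bar>"
          by (simp add: abs_mult)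
        then have "?g1 \<omega> = v \<omega> * ?s * (v \<omega> * ?s) * ((v \<omega>)\<^sup>2 * \<bar>U A \<omega>\<bar>)" by (simp only: mult.assoc)
        also have "\<dots> = v \<omega> ^ 4 * (?s\<^sup>2 * \<bar>U A \<omega>\<bar>)" by (simp only: power2_eq_square power4_eq_xxxx ac_simps)
        finally show ?thesis by simp
      qed
      moreover have "\<bar>?g2 k \<omega>\<bar> = v \<omega> ^ 4 * (\<bar>?s\<bar> * \<bar>X k \<omega>\<bar> ^ 3)" for k
      proof -
        have "v \<omega> ^ 4 = \<bar>v \<omega>\<bar> ^ 4" by simp
        then show ?thesis by (simp only: abs_mult power3_eq_cube power4_eq_xxxx ac_simps)
      qed
      ultimately show ?thesis
        by (simp add: cubes_def power_mult_distrib distrib_left sum_distrib_left ac_simps)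
    qed
    finally show ?thesis by (simp add: power_mult_distrib)
  qed
  have LU: "L4_bound M (\<lambda>\<omega>. sqrt \<bar>(v \<omega>)\<^sup>2 * U A \<omega>\<bar>) (sqrt (\<rho>\<^sup>2 * (1.1 * (101 / 100))))"
    unfolding U_def
  proof (rule L4_pair_sum[OF pair_product_gen _ _ _ small(2)])
    show "\<bar>\<Sum>j\<in>pairs A. expectation (\<lambda>\<omega>. X (fst j) \<omega> * X (snd j) \<omega>)\<bar> \<le> 101 / 100"
      using mean_U_near_1[of A] small(4) unfolding mean_U_def by linarith
  qed auto
  note B1 = L4_bound_mult4[OF LS LS LU LU]
  note B2 = L4_bound_mult4[OF LS L L L]
  have g3: "integrable M (?g3 k)" "expectation (?g3 k) \<le> (\<rho> * x k) ^ 4" if "k \<in> K A" for k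
    using L[OF that] by (auto simp: L4_bound_def)
  have "r ^ 4 \<le> expectation (\<lambda>\<omega>. (\<Sum>k\<in>K A. X k \<omega> * (v \<omega> ^ 4 * Sk k \<omega> ^ 3)) + (3 * \<bar>?g1 \<omega>\<bar> + 3 * (\<kappa>\<^sup>2 * (\<Sum>k\<in>K A. \<bar>?g2 k \<omega>\<bar>)) + \<kappa> ^ 3 * (\<Sum>k\<in>K A. ?g3 k \<omega>)))"
    unfolding r4
  proof (rule integral_mono[OF _ _ point])
    show "integrable M (\<lambda>\<omega>. (v \<omega> * S A \<omega>) ^ 4)" using LS by (simp add: L4_bound_def)
    show "integrable M (\<lambda>\<omega>. (\<Sum>k\<in>K A. X k \<omega> * (v \<omega> ^ 4 * Sk k \<omega> ^ 3)) + (3 * \<bar>?g1 \<omega>\<bar> + 3 * (\<kappa>\<^sup>2 * (\<Sum>k\<in>K A. \<bar>?g2 k \<omega>\<bar>)) + \<kappa> ^ 3 * (\<Sum>k\<in>K A. ?g3 k \<omega>)))"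
      by (intro Bochner_Integration.integrable_add Bochner_Integration.integrable_sum integrable_mult_right integrable_abs zero(1) B1(1) B2(1) g3(1))
  qed
  also have "\<dots> = (\<Sum>k\<in>K A. expectation (\<lambda>\<omega>. X k \<omega> * (v \<omega> ^ 4 * Sk k \<omega> ^ 3))) + (3 * expectation (\<lambda>\<omega>. \<bar>?g1 \<omega>\<bar>) + 3 * (\<kappa>\<^sup>2 * (\<Sum>k\<in>K A. expectation (\<lambda>\<omega>. \<bar>?g2 k \<omega>\<bar>))) + \<kappa> ^ 3 * (\<Sum>k\<in>K A. expectation (?g3 k)))"
  proof -
    have "integrable M (\<lambda>\<omega>. \<bar>?g1 \<omega>\<bar>)" using B1(1) by (rule integrable_abs)
    moreover have "integrable M (\<lambda>\<omega>. \<bar>?g2 k \<omega>\<bar>)" if "k \<in> K A" for k using B2(1)[OF that that that] by (rule integrable_abs)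
    ultimately show ?thesis
      using zero(1) g3(1) by (simp add: Bochner_Integration.integral_sum)
  qed
  also have "\<dots> \<le> 0 + (3 * (r * r * sqrt (\<rho>\<^sup>2 * (1.1 * (101 / 100))) * sqrt (\<rho>\<^sup>2 * (1.1 * (101 / 100)))) + 3 * (\<kappa>\<^sup>2 * (\<Sum>k\<in>K A. r * (\<rho> * x k) * (\<rho> * x k) * (\<rho> * x k))) + \<kappa> ^ 3 * (\<Sum>k\<in>K A. (\<rho> * x k) ^ 4))"
    using zero(2) B1(2) B2(2) g3(2) kappa_pos by (intro add_mono mult_left_mono sum_mono) (auto simp: sum_nonpos)
  also have "\<dots> = 3 * (r\<^sup>2 * (\<rho>\<^sup>2 * (1.1 * (101 / 100)))) + 3 * r * \<rho> ^ 3 * (\<kappa>\<^sup>2 * (\<Sum>k\<in>K A. x k ^ 3)) + \<rho> ^ 4 * (\<kappa> ^ 3 * (\<Sum>k\<in>K A. x k ^ 4))"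
  proof -
    have "sqrt (\<rho>\<^sup>2 * (1.1 * (101 / 100))) * sqrt (\<rho>\<^sup>2 * (1.1 * (101 / 100))) = \<rho>\<^sup>2 * (1.1 * (101 / 100))" by simp
    then show ?thesis
      by (simp add: power_mult_distrib sum_distrib_left power2_eq_square power3_eq_cube ac_simps)
  qed
  also have "\<dots> \<le> 3 * (r\<^sup>2 * (\<rho>\<^sup>2 * (1.1 * (101 / 100)))) + 3 * r * \<rho> ^ 3 * (\<kappa>\<^sup>2 * sum_x3) + \<rho> ^ 4 * (\<kappa> ^ 3 * sum_x4)"
    using sum_K_x_le kappa_pos r0 rho_nonneg by (intro add_mono mult_left_mono order_refl) auto
  also have "\<dots> \<le> 3 * (r\<^sup>2 * (\<rho>\<^sup>2 * (1.1 * (101 / 100)))) + 3 * r * \<rho> ^ 3 * (1 / 100) + \<rho> ^ 4 * (1 / 8)"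
    using small r0 rho_nonneg by (intro add_mono mult_left_mono order_refl) auto
  finally have main: "r ^ 4 \<le> 3 * (r\<^sup>2 * (\<rho>\<^sup>2 * (1.1 * (101 / 100)))) + 3 * r * \<rho> ^ 3 * (1 / 100) + \<rho> ^ 4 * (1 / 8)" .
  have "r \<le> 2 * \<rho>"
  proof (rule ccontr)
    assume "\<not> r \<le> 2 * \<rho>"
    then have lt: "\<rho> < r / 2" by simp
    then have rp: "r > 0" using rho_nonneg by linarith
    have p: "\<rho> ^ m \<le> (r / 2) ^ m" for m using lt rho_nonneg by (intro power_mono) auto
    have "3 * (r\<^sup>2 * (\<rho>\<^sup>2 * (1.1 * (101 / 100)))) + 3 * r * \<rho> ^ 3 * (1 / 100) + \<rho> ^ 4 * (1 / 8)
       \<le> 3 * (r\<^sup>2 * ((r / 2)\<^sup>2 * (1.1 * (101 / 100)))) + 3 * r * (r / 2) ^ 3 * (1 / 100) + (r / 2) ^ 4 * (1 / 8)"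
      using p r0 by (intro add_mono mult_left_mono mult_right_mono) auto
    also have "\<dots> = r ^ 4 * (3 * 1.1 * (101 / 100) / 4 + 3 / 800 + 1 / 128)"
      by (simp add: power2_eq_square power3_eq_cube power4_eq_xxxx field_simps)
    also have "\<dots> < r ^ 4 * 1" using rp by (intro mult_strict_left_mono) auto
    finally show False using main by simp
  qed
  then show ?thesis using LS r0 power_mono[of r "2 * \<rho>" 4] unfolding L4_bound_def by auto
qed

end

end

section \<open>Pointwise perturbation bounds\<close>

context local_dependence
begin

definition V :: "nat set \<Rightarrow> 'a \<Rightarrow> real" where "V A \<omega> = psi 1 (U A \<omega>)"

definition Q :: "nat set \<Rightarrow> 'a \<Rightarrow> real" where "Q A \<omega> = min 1 (sqrt (Tsq A \<omega>))"

definition width :: "nat set \<Rightarrow> nat set \<Rightarrow> real \<Rightarrow> 'a \<Rightarrow> real" where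
  "width A B c \<omega> = c * (\<Sum>m\<in>B. \<bar>X m \<omega>\<bar>) + c * \<bar>S A \<omega>\<bar> * Q A \<omega>"

definition hit :: "nat set \<Rightarrow> nat set \<Rightarrow> real \<Rightarrow> real \<Rightarrow> real \<Rightarrow> 'a \<Rightarrow> real" where
  "hit A B a b c \<omega> = (if a - width A B c \<omega> \<le> S A \<omega> / V A \<omega> \<and> S A \<omega> / V A \<omega> \<le> b + width A B c \<omega> then 1 else 0)"

text \<open>
  The primed quantities are those obtained from \<open>S\<close>, \<open>U\<close>, \<open>T\<^sub>A\<^sup>2\<close>, \<open>V\<close>, \<open>Q\<close> and \<open>width\<close> by
  deleting every term that involves an index in \<open>nb k\<close>. They are functions of variables independent
  of \<open>X\<^sub>k\<close>.
\<close>

definition S' :: "nat set \<Rightarrow> nat \<Rightarrow> 'a \<Rightarrow> real" where "S' A k \<omega> = (\<Sum>l\<in>K A - nb k. X l \<omega>)"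

definition U' :: "nat set \<Rightarrow> nat \<Rightarrow> 'a \<Rightarrow> real" where
  "U' A k \<omega> = (\<Sum>j\<in>pairs A. if fst j \<in> nb k \<or> snd j \<in> nb k then 0 else X (fst j) \<omega> * X (snd j) \<omega>)"

definition Tsq' :: "nat set \<Rightarrow> nat \<Rightarrow> 'a \<Rightarrow> real" where
  "Tsq' A k \<omega> = (\<Sum>p\<in>NA A. \<Sum>l\<in>nb p. if p \<in> nb k \<or> l \<in> nb k then 0 else \<bar>X p \<omega> * X l \<omega>\<bar>)
    + (\<Sum>p\<in>NA A. \<Sum>l\<in>Nb p. if p \<in> nb k \<or> l \<in> nb k then 0 else \<bar>X p \<omega> * X l \<omega>\<bar>)"

definition V' :: "nat set \<Rightarrow> nat \<Rightarrow> 'a \<Rightarrow> real" where "V' A k \<omega> = psi 1 (U' A k \<omega>)"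

definition Q' :: "nat set \<Rightarrow> nat \<Rightarrow> 'a \<Rightarrow> real" where "Q' A k \<omega> = min 1 (sqrt (Tsq' A k \<omega>))"

definition width' :: "nat set \<Rightarrow> nat set \<Rightarrow> real \<Rightarrow> nat \<Rightarrow> 'a \<Rightarrow> real" where
  "width' A B c k \<omega> = c * (\<Sum>m\<in>B - nb k. \<bar>X m \<omega>\<bar>) + c * \<bar>S' A k \<omega>\<bar> * Q' A k \<omega>"

definition absU :: "nat set \<Rightarrow> 'a \<Rightarrow> real" where
  "absU A \<omega> = (\<Sum>j\<in>pairs A. \<bar>X (fst j) \<omega> * X (snd j) \<omega>\<bar>)"

lemma V_bounds: "0.7 \<le> 1 / V A \<omega>" "1 / V A \<omega> \<le> 2" "0 < V A \<omega>"
  using inverse_psi_1_bounds psi_1_bounds(1)[of "U A \<omega>"] unfolding V_def by auto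

lemma Q_bounds: "0 \<le> Q A \<omega>" "Q A \<omega> \<le> 1" "Q A \<omega> \<le> sqrt (Tsq A \<omega>)"
  using Tsq_nonneg[of A \<omega>] by (auto simp: Q_def)

lemma width_nonneg: "c \<ge> 0 \<Longrightarrow> 0 \<le> width A B c \<omega>"
  unfolding width_def using Q_bounds by (intro add_nonneg_nonneg mult_nonneg_nonneg sum_nonneg) auto

lemma Tsq'_bounds: "0 \<le> Tsq' A k \<omega>" "Tsq' A k \<omega> \<le> Tsq A \<omega>"
  unfolding Tsq'_def Tsq_def by (auto intro!: sum_nonneg add_nonneg_nonneg add_mono sum_mono)

lemma Q'_bounds: "0 \<le> Q' A k \<omega>" "Q' A k \<omega> \<le> 1" "Q' A k \<omega> \<le> Q A \<omega>"
  using Tsq'_bounds[of A k \<omega>] unfolding Q'_def Q_def by (auto intro: min.coboundedI2)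

lemma width'_nonneg: "c \<ge> 0 \<Longrightarrow> 0 \<le> width' A B c k \<omega>"
  unfolding width'_def using Q'_bounds by (intro add_nonneg_nonneg mult_nonneg_nonneg sum_nonneg) auto

lemma S'_eq: "k \<in> K A \<Longrightarrow> S' A k \<omega> = S A \<omega> - Y A k \<omega>"
  by (simp add: S'_def S_minus_Y)

lemma width_measurable:
  assumes "B \<subseteq> I" shows "width A B c \<in> borel_measurable M"
proof -
  have [measurable]: "(\<lambda>\<omega>. \<Sum>m\<in>B. \<bar>X m \<omega>\<bar>) \<in> borel_measurable M"
    using assms by (intro borel_measurable_sum borel_measurable_abs X_meas) auto
  show ?thesis unfolding width_def[abs_def] Q_def[abs_def] by measurable
qed

lemma psi_measurable[measurable]: "psi s \<in> borel_measurable borel"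
  unfolding psi_def[abs_def] by measurable

lemma V_measurable[measurable]: "V A \<in> borel_measurable M"
  unfolding V_def[abs_def] by measurable

lemma hit_measurable: "B \<subseteq> I \<Longrightarrow> hit A B a b c \<in> borel_measurable M"
  using width_measurable[of B A c] unfolding hit_def[abs_def] by measurable

lemma hit_bounds: "0 \<le> hit A B a b c \<omega>" "hit A B a b c \<omega> \<le> 1" by (auto simp: hit_def)

lemma Nb_count: "i \<in> I \<Longrightarrow> real (card {k \<in> K A. i \<in> nb k}) \<le> \<kappa>"
proof -
  assume i: "i \<in> I"
  have "card {k \<in> K A. i \<in> nb k} \<le> card (Nb i)"
    by (intro card_mono) (auto simp: N_idx_def I_def dest: K_I)
  then show ?thesis using card_N_idx[OF i] by simp
qed

text \<open>
  Deleting \<open>nb k\<close> removes from \<open>U\<close> the pairs with an end point in \<open>nb k\<close>, and for a given \<open>k\<close> at most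
  \<open>\<kappa>\<^sup>2\<close> pairs have their first (or second) end point there.
\<close>

lemma sum_X_diff_U'_le: "(\<Sum>k\<in>K A. \<bar>X k \<omega>\<bar> * \<bar>U A \<omega> - U' A k \<omega>\<bar>) \<le> 2 * cubes A \<omega>"
proof -
  let ?g = "\<lambda>i. \<bar>X i \<omega>\<bar> ^ 3"
  let ?G = "\<Sum>k\<in>K A. ?g k"
  let ?t = "\<lambda>j. \<bar>X (fst j) \<omega> * X (snd j) \<omega>\<bar>"
  have d: "\<bar>U A \<omega> - U' A k \<omega>\<bar> \<le> (\<Sum>j\<in>pairs A. of_bool (fst j \<in> nb k) * ?t j) + (\<Sum>j\<in>pairs A. of_bool (snd j \<in> nb k) * ?t j)" for k
  proof -
    have "\<bar>U A \<omega> - U' A k \<omega>\<bar> \<le> (\<Sum>j\<in>pairs A. \<bar>X (fst j) \<omega> * X (snd j) \<omega> - (if fst j \<in> nb k \<or> snd j \<in> nb k then 0 else X (fst j) \<omega> * X (snd j) \<omega>)\<bar>)"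
      unfolding U_def U'_def sum_subtractf[symmetric] by (rule sum_abs)
    also have "\<dots> \<le> (\<Sum>j\<in>pairs A. of_bool (fst j \<in> nb k) * ?t j + of_bool (snd j \<in> nb k) * ?t j)"
      by (intro sum_mono) auto
    finally show ?thesis by (simp add: sum.distrib)
  qed
  have one: "(\<Sum>k\<in>K A. \<bar>X k \<omega>\<bar> * (\<Sum>j\<in>pairs A. of_bool (q j \<in> nb k) * ?t j)) \<le> \<kappa>\<^sup>2 * ?G"
    if q: "\<And>g. (\<And>i. i \<in> I \<Longrightarrow> 0 \<le> g i) \<Longrightarrow> (\<Sum>j\<in>pairs A. g (q j)) \<le> \<kappa> * (\<Sum>i\<in>I. g i :: real)"
      and qI: "\<And>j. j \<in> pairs A \<Longrightarrow> q j \<in> I" for q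
  proof -
    let ?b = "\<lambda>k j. of_bool (q j \<in> nb k) :: real"
    have "(\<Sum>k\<in>K A. \<bar>X k \<omega>\<bar> * (\<Sum>j\<in>pairs A. ?b k j * ?t j)) = (\<Sum>k\<in>K A. \<Sum>j\<in>pairs A. ?b k j * (\<bar>X k \<omega>\<bar> * ?t j))"
      by (simp only: sum_distrib_left ac_simps)
    also have "\<dots> \<le> (\<Sum>k\<in>K A. \<Sum>j\<in>pairs A. ?b k j * ((?g k + ?g (fst j) + ?g (snd j)) / 3))"
    proof (intro sum_mono mult_left_mono)
      fix k j show "\<bar>X k \<omega>\<bar> * ?t j \<le> (?g k + ?g (fst j) + ?g (snd j)) / 3"
        using am_gm3[of "\<bar>X k \<omega>\<bar>" "\<bar>X (fst j) \<omega>\<bar>" "\<bar>X (snd j) \<omega>\<bar>"] by (simp add: abs_mult mult.assoc)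
    qed simp
    also have "\<dots> = ((\<Sum>k\<in>K A. \<Sum>j\<in>pairs A. ?b k j * ?g k) + (\<Sum>k\<in>K A. \<Sum>j\<in>pairs A. ?b k j * (?g (fst j) + ?g (snd j)))) / 3"
      unfolding sum.distrib[symmetric] sum_divide_distrib by (intro sum.cong refl) (simp add: field_simps)
    also have "(\<Sum>k\<in>K A. \<Sum>j\<in>pairs A. ?b k j * ?g k) \<le> \<kappa>\<^sup>2 * ?G"
    proof -
      have "(\<Sum>j\<in>pairs A. ?b k j) \<le> \<kappa>\<^sup>2" if k: "k \<in> K A" for k
      proof -
        have "(\<Sum>j\<in>pairs A. ?b k j) \<le> \<kappa> * (\<Sum>i\<in>I. of_bool (i \<in> nb k))"
          by (rule q[of "\<lambda>i. of_bool (i \<in> nb k)"]) simp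
        also have "(\<Sum>i\<in>I. of_bool (i \<in> nb k)) = real (card (nb k))"
          using nb[OF K_I[OF k]] by (simp add: sum_of_bool_eq Int_absorb1)
        also have "\<kappa> * \<dots> \<le> \<kappa> * \<kappa>" using card_nb[OF K_I[OF k]] kappa_pos by (intro mult_left_mono) auto
        finally show ?thesis by (simp add: power2_eq_square)
      qed
      then have "(\<Sum>k\<in>K A. (\<Sum>j\<in>pairs A. ?b k j) * ?g k) \<le> (\<Sum>k\<in>K A. \<kappa>\<^sup>2 * ?g k)"
        by (intro sum_mono mult_right_mono) auto
      then show ?thesis by (simp add: sum_distrib_left sum_distrib_right)
    qed
    also have "(\<Sum>k\<in>K A. \<Sum>j\<in>pairs A. ?b k j * (?g (fst j) + ?g (snd j))) \<le> 2 * (\<kappa>\<^sup>2 * ?G)"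
    proof -
      have "(\<Sum>k\<in>K A. \<Sum>j\<in>pairs A. ?b k j * (?g (fst j) + ?g (snd j))) = (\<Sum>j\<in>pairs A. (\<Sum>k\<in>K A. ?b k j) * (?g (fst j) + ?g (snd j)))"
        by (subst sum.swap) (simp add: sum_distrib_right)
      also have "\<dots> \<le> (\<Sum>j\<in>pairs A. \<kappa> * (?g (fst j) + ?g (snd j)))"
      proof (intro sum_mono mult_right_mono)
        fix j assume "j \<in> pairs A"
        from Nb_count[OF qI[OF this], of A]
        show "(\<Sum>k\<in>K A. ?b k j) \<le> \<kappa>" by (simp add: sum_of_bool_eq Int_def)
      qed auto
      also have "\<dots> = \<kappa> * ((\<Sum>j\<in>pairs A. ?g (fst j)) + (\<Sum>j\<in>pairs A. ?g (snd j)))"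
        by (simp only: sum.distrib flip: sum_distrib_left)
      also have "\<dots> \<le> \<kappa> * (\<kappa> * ?G + \<kappa> * ?G)"
        using kappa_pos by (intro mult_left_mono add_mono sum_pairs_le_K) auto
      finally show ?thesis by (simp add: power2_eq_square)
    qed
    finally show ?thesis by simp
  qed
  have "(\<Sum>k\<in>K A. \<bar>X k \<omega>\<bar> * \<bar>U A \<omega> - U' A k \<omega>\<bar>) \<le> (\<Sum>k\<in>K A. \<bar>X k \<omega>\<bar> * ((\<Sum>j\<in>pairs A. of_bool (fst j \<in> nb k) * ?t j) + (\<Sum>j\<in>pairs A. of_bool (snd j \<in> nb k) * ?t j)))"
    by (intro sum_mono mult_left_mono d) auto
  also have "\<dots> = (\<Sum>k\<in>K A. \<bar>X k \<omega>\<bar> * (\<Sum>j\<in>pairs A. of_bool (fst j \<in> nb k) * ?t j)) + (\<Sum>k\<in>K A. \<bar>X k \<omega>\<bar> * (\<Sum>j\<in>pairs A. of_bool (snd j \<in> nb k) * ?t j))"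
    by (simp only: distrib_left sum.distrib)
  also have "\<dots> \<le> \<kappa>\<^sup>2 * ?G + \<kappa>\<^sup>2 * ?G"
  proof (intro add_mono one)
    fix g :: "nat \<Rightarrow> real" assume g: "\<And>i. i \<in> I \<Longrightarrow> 0 \<le> g i"
    show "(\<Sum>j\<in>pairs A. g (fst j)) \<le> \<kappa> * (\<Sum>i\<in>I. g i)" by (rule sum_pairs_le(1)) (rule g)
    show "(\<Sum>j\<in>pairs A. g (snd j)) \<le> \<kappa> * (\<Sum>i\<in>I. g i)" by (rule sum_pairs_le(2)) (rule g)
  qed (auto simp: pairs_iff dest: K_I)
  finally show ?thesis by (simp add: cubes_def)
qed

text \<open>
  The square root is not Lipschitz at \<open>0\<close>, but \<open>sqrt s - sqrt s' \<le> (s - s') / sqrt s\<close> for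
  \<open>0 \<le> s' \<le> s\<close>. Summed over \<open>k\<close>, the differences \<open>s - s'\<close> produce \<open>T\<^sub>A\<^sup>2\<close> times a local sum, and
  one factor \<open>T\<^sub>A\<close> cancels.
\<close>

lemma sum_X_diff_T'_le:
  "(\<Sum>k\<in>K A. \<bar>X k \<omega>\<bar> * (sqrt (Tsq A \<omega>) - sqrt (Tsq' A k \<omega>))) \<le> sqrt (Tsq A \<omega>) * Zstar A \<omega>"
proof -
  let ?r = "sqrt (Tsq A \<omega>)" and ?r' = "\<lambda>k. sqrt (Tsq' A k \<omega>)"
  let ?b = "\<lambda>k p l. of_bool (p \<in> nb k \<or> l \<in> nb k) :: real"
  have half: "(\<Sum>k\<in>K A. \<bar>X k \<omega>\<bar> * (\<Sum>p\<in>NA A. \<Sum>l\<in>N p. ?b k p l * \<bar>X p \<omega> * X l \<omega>\<bar>)) \<le> (\<Sum>p\<in>NA A. \<Sum>l\<in>N p. \<bar>X p \<omega> * X l \<omega>\<bar>) * Zstar A \<omega>"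
    if N: "\<And>p l. p \<in> NA A \<Longrightarrow> l \<in> N p \<Longrightarrow> l \<in> I" for N
  proof -
    have "(\<Sum>k\<in>K A. \<bar>X k \<omega>\<bar> * (\<Sum>p\<in>NA A. \<Sum>l\<in>N p. ?b k p l * \<bar>X p \<omega> * X l \<omega>\<bar>))
        = (\<Sum>k\<in>K A. \<Sum>p\<in>NA A. \<Sum>l\<in>N p. \<bar>X p \<omega> * X l \<omega>\<bar> * (?b k p l * \<bar>X k \<omega>\<bar>))"
      by (simp add: sum_distrib_left ac_simps)
    also have "\<dots> = (\<Sum>p\<in>NA A. \<Sum>k\<in>K A. \<Sum>l\<in>N p. \<bar>X p \<omega> * X l \<omega>\<bar> * (?b k p l * \<bar>X k \<omega>\<bar>))" by (rule sum.swap)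
    also have "\<dots> = (\<Sum>p\<in>NA A. \<Sum>l\<in>N p. \<Sum>k\<in>K A. \<bar>X p \<omega> * X l \<omega>\<bar> * (?b k p l * \<bar>X k \<omega>\<bar>))"
      by (intro sum.cong refl sum.swap)
    also have "\<dots> = (\<Sum>p\<in>NA A. \<Sum>l\<in>N p. \<bar>X p \<omega> * X l \<omega>\<bar> * (\<Sum>k\<in>K A. ?b k p l * \<bar>X k \<omega>\<bar>))"
      by (simp only: sum_distrib_left)
    also have "\<dots> \<le> (\<Sum>p\<in>NA A. \<Sum>l\<in>N p. \<bar>X p \<omega> * X l \<omega>\<bar> * Zstar A \<omega>)"
    proof (intro sum_mono mult_left_mono)
      fix p l assume pl: "p \<in> NA A" "l \<in> N p"
      have "(\<Sum>k\<in>K A. ?b k p l * \<bar>X k \<omega>\<bar>) = (\<Sum>k\<in>{k\<in>K A. p \<in> nb k \<or> l \<in> nb k}. \<bar>X k \<omega>\<bar>)"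
        by (intro sum.mono_neutral_cong_right) auto
      also have "\<dots> \<le> Zstar A \<omega>"
      proof (rule sum_abs_le_Zstar)
        have "{k\<in>K A. p \<in> nb k \<or> l \<in> nb k} = {k\<in>K A. p \<in> nb k} \<union> {k\<in>K A. l \<in> nb k}" by auto
        then have "card {k\<in>K A. p \<in> nb k \<or> l \<in> nb k} \<le> card {k\<in>K A. p \<in> nb k} + card {k\<in>K A. l \<in> nb k}"
          by (simp add: card_Un_le)
        then show "real (card {k\<in>K A. p \<in> nb k \<or> l \<in> nb k}) \<le> 2 * \<kappa>"
          using Nb_count[OF NA_I[OF pl(1)], of A] Nb_count[OF N[OF pl], of A] by linarith
      qed auto
      finally show "(\<Sum>k\<in>K A. ?b k p l * \<bar>X k \<omega>\<bar>) \<le> Zstar A \<omega>" .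
    qed auto
    finally show ?thesis by (simp add: sum_distrib_right)
  qed
  have diff: "Tsq A \<omega> - Tsq' A k \<omega> = (\<Sum>p\<in>NA A. \<Sum>l\<in>nb p. ?b k p l * \<bar>X p \<omega> * X l \<omega>\<bar>) + (\<Sum>p\<in>NA A. \<Sum>l\<in>Nb p. ?b k p l * \<bar>X p \<omega> * X l \<omega>\<bar>)" for k
  proof -
    have *: "(\<Sum>p\<in>NA A. \<Sum>l\<in>N p. \<bar>X p \<omega> * X l \<omega>\<bar>) - (\<Sum>p\<in>NA A. \<Sum>l\<in>N p. if p \<in> nb k \<or> l \<in> nb k then 0 else \<bar>X p \<omega> * X l \<omega>\<bar>)
      = (\<Sum>p\<in>NA A. \<Sum>l\<in>N p. ?b k p l * \<bar>X p \<omega> * X l \<omega>\<bar>)" for N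
      unfolding sum_subtractf[symmetric] by (intro sum.cong refl) auto
    show ?thesis unfolding Tsq_def Tsq'_def using *[of nb] *[of Nb] by linarith
  qed
  have "(\<Sum>k\<in>K A. \<bar>X k \<omega>\<bar> * (Tsq A \<omega> - Tsq' A k \<omega>)) \<le> Tsq A \<omega> * Zstar A \<omega>"
    unfolding diff distrib_left sum.distrib
    unfolding Tsq_def distrib_right
    by (intro add_mono half) (auto dest: NA_I Nb_I intro: nb_I)
  moreover have "?r * (?r - ?r' k) \<le> Tsq A \<omega> - Tsq' A k \<omega>" for k
  proof -
    have "?r' k * ?r' k \<le> ?r * ?r' k" using Tsq'_bounds[of A k \<omega>] by (intro mult_right_mono) auto
    then show ?thesis using Tsq'_bounds[of A k \<omega>] Tsq_nonneg[of A \<omega>] by (simp add: right_diff_distrib)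
  qed
  then have "(\<Sum>k\<in>K A. \<bar>X k \<omega>\<bar> * (?r * (?r - ?r' k))) \<le> (\<Sum>k\<in>K A. \<bar>X k \<omega>\<bar> * (Tsq A \<omega> - Tsq' A k \<omega>))"
    by (intro sum_mono mult_left_mono) auto
  ultimately have m: "?r * (\<Sum>k\<in>K A. \<bar>X k \<omega>\<bar> * (?r - ?r' k)) \<le> ?r * (?r * Zstar A \<omega>)"
  proof -
    assume *: "(\<Sum>k\<in>K A. \<bar>X k \<omega>\<bar> * (?r * (?r - ?r' k))) \<le> (\<Sum>k\<in>K A. \<bar>X k \<omega>\<bar> * (Tsq A \<omega> - Tsq' A k \<omega>))"
      "(\<Sum>k\<in>K A. \<bar>X k \<omega>\<bar> * (Tsq A \<omega> - Tsq' A k \<omega>)) \<le> Tsq A \<omega> * Zstar A \<omega>"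
    have "?r * (\<Sum>k\<in>K A. \<bar>X k \<omega>\<bar> * (?r - ?r' k)) = (\<Sum>k\<in>K A. \<bar>X k \<omega>\<bar> * (?r * (?r - ?r' k)))"
      by (simp only: sum_distrib_left ac_simps)
    moreover have "?r * (?r * Zstar A \<omega>) = Tsq A \<omega> * Zstar A \<omega>"
      using Tsq_nonneg[of A \<omega>] by (simp flip: mult.assoc)
    ultimately show ?thesis using * by linarith
  qed
  show ?thesis
  proof (cases "?r = 0")
    case True
    then have "(\<Sum>k\<in>K A. \<bar>X k \<omega>\<bar> * (?r - ?r' k)) \<le> (\<Sum>k\<in>K A. 0)"
      using Tsq'_bounds[of A _ \<omega>] by (intro sum_mono mult_nonneg_nonpos) auto
    then show ?thesis using True by simp
  next
    case False
    then have "0 < ?r" using Tsq_nonneg[of A \<omega>] by (simp add: less_le)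
    then show ?thesis using m by (rule mult_left_le_imp_le[rotated])
  qed
qed

lemma sum_X_B_le:
  assumes B: "B \<subseteq> I"
  shows "(\<Sum>k\<in>K A. \<bar>X k \<omega>\<bar> * (\<Sum>m\<in>B \<inter> nb k. \<bar>X m \<omega>\<bar>)) \<le> (\<Sum>m\<in>B. \<bar>X m \<omega>\<bar> * Zstar A \<omega>)"
proof -
  have fB: "finite B" using B by (rule finite_subset) simp
  have "(\<Sum>k\<in>K A. \<bar>X k \<omega>\<bar> * (\<Sum>m\<in>B \<inter> nb k. \<bar>X m \<omega>\<bar>)) = (\<Sum>k\<in>K A. \<Sum>m\<in>{m\<in>B. m \<in> nb k}. \<bar>X m \<omega>\<bar> * \<bar>X k \<omega>\<bar>)"
    by (simp add: sum_distrib_left Int_def mult.commute)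
  also have "\<dots> = (\<Sum>m\<in>B. \<Sum>k\<in>{k\<in>K A. m \<in> nb k}. \<bar>X m \<omega>\<bar> * \<bar>X k \<omega>\<bar>)"
    by (rule sum.swap_restrict[OF finite_K fB])
  also have "\<dots> \<le> (\<Sum>m\<in>B. \<bar>X m \<omega>\<bar> * Zstar A \<omega>)"
    unfolding sum_distrib_left[symmetric]
  proof (intro sum_mono mult_left_mono sum_abs_le_Zstar)
    fix m assume "m \<in> B"
    then have "real (card {k\<in>K A. m \<in> nb k}) \<le> \<kappa>" using B by (intro Nb_count) auto
    then show "real (card {k\<in>K A. m \<in> nb k}) \<le> 2 * \<kappa>" using kappa_pos by simp
  qed auto
  finally show ?thesis .
qed

lemma sum_XY_abs_le: "(\<Sum>k\<in>K A. \<bar>X k \<omega>\<bar> * \<bar>Y A k \<omega>\<bar>) \<le> absU A \<omega>"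
proof -
  have "(\<Sum>k\<in>K A. \<bar>X k \<omega>\<bar> * \<bar>Y A k \<omega>\<bar>) \<le> (\<Sum>k\<in>K A. \<bar>X k \<omega>\<bar> * (\<Sum>l\<in>K A \<inter> nb k. \<bar>X l \<omega>\<bar>))"
    unfolding Y_def by (intro sum_mono mult_left_mono sum_abs) auto
  also have "\<dots> = (\<Sum>k\<in>K A. \<Sum>l\<in>K A \<inter> nb k. \<bar>X k \<omega> * X l \<omega>\<bar>)" by (simp add: sum_distrib_left abs_mult)
  also have "\<dots> = absU A \<omega>" unfolding absU_def by (rule sum_pairs[where f="\<lambda>k l. \<bar>X k \<omega> * X l \<omega>\<bar>", symmetric])
  finally show ?thesis .
qed

lemma Y_le_Zstar: "k \<in> K A \<Longrightarrow> \<bar>Y A k \<omega>\<bar> \<le> Zstar A \<omega>"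
proof -
  assume k: "k \<in> K A"
  have "\<bar>Y A k \<omega>\<bar> \<le> (\<Sum>l\<in>K A \<inter> nb k. \<bar>X l \<omega>\<bar>)" unfolding Y_def by (rule sum_abs)
  also have "\<dots> \<le> Zstar A \<omega>" using card_K_nb[OF K_I[OF k], of A] kappa_pos by (intro sum_abs_le_Zstar) auto
  finally show ?thesis .
qed

text \<open>
  Bounds the total effect of ignoring \<open>nb k\<close> in the truncated variance and in the end points; see
  \<open>perturbation_le_err\<close>.
\<close>

definition err :: "nat set \<Rightarrow> nat set \<Rightarrow> real \<Rightarrow> 'a \<Rightarrow> real" where
  "err A B c \<omega> = 8 * ((\<bar>S A \<omega>\<bar> + Zstar A \<omega>) * cubes A \<omega>) + c * (\<Sum>m\<in>B. \<bar>X m \<omega>\<bar> * Zstar A \<omega>)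
     + c * (sqrt (Tsq A \<omega>) * absU A \<omega>) + c * (\<bar>S A \<omega>\<bar> * (sqrt (Tsq A \<omega>) * Zstar A \<omega>))"

lemma perturbation_le_err:
  assumes B: "B \<subseteq> I" and c: "c \<ge> 0"
  shows "(\<Sum>k\<in>K A. \<bar>X k \<omega>\<bar> * (\<bar>S' A k \<omega>\<bar> * \<bar>1 / V A \<omega> - 1 / V' A k \<omega>\<bar> + \<bar>width A B c \<omega> - width' A B c k \<omega>\<bar>)) \<le> err A B c \<omega>"
proof -
  let ?s = "\<bar>S A \<omega>\<bar>" and ?z = "Zstar A \<omega>" and ?r = "sqrt (Tsq A \<omega>)" and ?r' = "\<lambda>k. sqrt (Tsq' A k \<omega>)"
  have fB: "finite B" using B by (rule finite_subset) simp
  have *: "\<bar>S' A k \<omega>\<bar> * \<bar>1 / V A \<omega> - 1 / V' A k \<omega>\<bar> + \<bar>width A B c \<omega> - width' A B c k \<omega>\<bar>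
      \<le> 4 * ((?s + ?z) * \<bar>U A \<omega> - U' A k \<omega>\<bar>) + c * (\<Sum>m\<in>B \<inter> nb k. \<bar>X m \<omega>\<bar>) + c * (?r * \<bar>Y A k \<omega>\<bar>) + c * (?s * (?r - ?r' k))"
    if k: "k \<in> K A" for k
  proof -
    have sd: "\<bar>?s - \<bar>S' A k \<omega>\<bar>\<bar> \<le> \<bar>Y A k \<omega>\<bar>" unfolding S'_eq[OF k] by linarith
    have "\<bar>S' A k \<omega>\<bar> * \<bar>1 / V A \<omega> - 1 / V' A k \<omega>\<bar> \<le> (?s + ?z) * (4 * \<bar>U A \<omega> - U' A k \<omega>\<bar>)"
      using sd Y_le_Zstar[OF k, of \<omega>] Zstar_nonneg[of A \<omega>] unfolding V_def V'_def
      by (intro mult_mono inverse_psi_1_lipschitz) auto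
    moreover have "\<bar>width A B c \<omega> - width' A B c k \<omega>\<bar> \<le> c * (\<Sum>m\<in>B \<inter> nb k. \<bar>X m \<omega>\<bar>) + c * (?r * \<bar>Y A k \<omega>\<bar>) + c * (?s * (?r - ?r' k))"
    proof -
      have 1: "(\<Sum>m\<in>B. \<bar>X m \<omega>\<bar>) = (\<Sum>m\<in>B \<inter> nb k. \<bar>X m \<omega>\<bar>) + (\<Sum>m\<in>B - nb k. \<bar>X m \<omega>\<bar>)"
        by (rule sum.Int_Diff[OF fB])
      have 2: "\<bar>?s * Q A \<omega> - \<bar>S' A k \<omega>\<bar> * Q' A k \<omega>\<bar> \<le> ?r * \<bar>Y A k \<omega>\<bar> + ?s * (?r - ?r' k)"
      proof -
        have "?s * Q A \<omega> - \<bar>S' A k \<omega>\<bar> * Q' A k \<omega> = (?s - \<bar>S' A k \<omega>\<bar>) * Q' A k \<omega> + ?s * (Q A \<omega> - Q' A k \<omega>)"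
          by (simp add: algebra_simps)
        then have "\<bar>?s * Q A \<omega> - \<bar>S' A k \<omega>\<bar> * Q' A k \<omega>\<bar> \<le> \<bar>(?s - \<bar>S' A k \<omega>\<bar>) * Q' A k \<omega>\<bar> + \<bar>?s * (Q A \<omega> - Q' A k \<omega>)\<bar>"
          by linarith
        also have "\<dots> = \<bar>?s - \<bar>S' A k \<omega>\<bar>\<bar> * Q' A k \<omega> + ?s * (Q A \<omega> - Q' A k \<omega>)"
          using Q'_bounds[of A k \<omega>] by (simp add: abs_mult)
        also have "\<dots> \<le> \<bar>Y A k \<omega>\<bar> * ?r + ?s * (?r - ?r' k)"
        proof (intro add_mono mult_mono mult_left_mono sd)
          show "Q' A k \<omega> \<le> ?r" using Q'_bounds(3)[of A k \<omega>] Q_bounds(3)[of A \<omega>] by linarith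
          have "?r' k \<le> ?r" using Tsq'_bounds by simp
          then show "Q A \<omega> - Q' A k \<omega> \<le> ?r - ?r' k" unfolding Q_def Q'_def by linarith
        qed (use Q'_bounds[of A k \<omega>] in auto)
        finally show ?thesis by (simp add: mult.commute)
      qed
      have "width A B c \<omega> - width' A B c k \<omega> = c * (\<Sum>m\<in>B \<inter> nb k. \<bar>X m \<omega>\<bar>) + c * (?s * Q A \<omega> - \<bar>S' A k \<omega>\<bar> * Q' A k \<omega>)"
        unfolding width_def width'_def 1 by (simp add: algebra_simps)
      also have "\<bar>\<dots>\<bar> \<le> c * (\<Sum>m\<in>B \<inter> nb k. \<bar>X m \<omega>\<bar>) + c * \<bar>?s * Q A \<omega> - \<bar>S' A k \<omega>\<bar> * Q' A k \<omega>\<bar>"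
        using c by (intro order_trans[OF abs_triangle_ineq] add_mono) (auto simp: abs_mult sum_nonneg)
      also have "\<dots> \<le> c * (\<Sum>m\<in>B \<inter> nb k. \<bar>X m \<omega>\<bar>) + c * (?r * \<bar>Y A k \<omega>\<bar> + ?s * (?r - ?r' k))"
        using 2 c by (intro add_left_mono mult_left_mono)
      finally show ?thesis by (simp add: algebra_simps)
    qed
    ultimately show ?thesis by (simp add: mult.left_commute)
  qed
  have "(\<Sum>k\<in>K A. \<bar>X k \<omega>\<bar> * (\<bar>S' A k \<omega>\<bar> * \<bar>1 / V A \<omega> - 1 / V' A k \<omega>\<bar> + \<bar>width A B c \<omega> - width' A B c k \<omega>\<bar>))
      \<le> (\<Sum>k\<in>K A. \<bar>X k \<omega>\<bar> * (4 * ((?s + ?z) * \<bar>U A \<omega> - U' A k \<omega>\<bar>) + c * (\<Sum>m\<in>B \<inter> nb k. \<bar>X m \<omega>\<bar>) + c * (?r * \<bar>Y A k \<omega>\<bar>) + c * (?s * (?r - ?r' k))))"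
    by (intro sum_mono mult_left_mono *) auto
  also have "\<dots> = 4 * ((?s + ?z) * (\<Sum>k\<in>K A. \<bar>X k \<omega>\<bar> * \<bar>U A \<omega> - U' A k \<omega>\<bar>)) + c * (\<Sum>k\<in>K A. \<bar>X k \<omega>\<bar> * (\<Sum>m\<in>B \<inter> nb k. \<bar>X m \<omega>\<bar>))
      + c * (?r * (\<Sum>k\<in>K A. \<bar>X k \<omega>\<bar> * \<bar>Y A k \<omega>\<bar>)) + c * (?s * (\<Sum>k\<in>K A. \<bar>X k \<omega>\<bar> * (?r - ?r' k)))"
    unfolding sum_distrib_left[of _ _ "K A"] sum.distrib[symmetric]
    by (intro sum.cong refl) (simp add: distrib_left ac_simps)
  also have "\<dots> \<le> 4 * ((?s + ?z) * (2 * cubes A \<omega>)) + c * (\<Sum>m\<in>B. \<bar>X m \<omega>\<bar> * ?z) + c * (?r * absU A \<omega>) + c * (?s * (?r * ?z))"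
    using c Zstar_nonneg[of A \<omega>] Tsq_nonneg[of A \<omega>]
    by (intro add_mono mult_left_mono sum_X_diff_U'_le sum_X_B_le[OF B] sum_XY_abs_le sum_X_diff_T'_le) auto
  finally show ?thesis unfolding err_def by simp
qed

lemma NA_insert: "i \<in> I \<Longrightarrow> NA (insert i A) = NA A \<union> Nb i"
  by (auto simp: N_set_def N_idx_def)

lemma K_insert: "i \<in> I \<Longrightarrow> K (insert i A) = K A - Nb i"
  unfolding N_set_compl_def using NA_insert[of i A] by auto

lemma Tsq_mono: "NA A \<subseteq> NA A' \<Longrightarrow> Tsq A \<omega> \<le> Tsq A' \<omega>"
  unfolding Tsq_def by (intro add_mono sum_mono2 sum_nonneg) auto

text \<open>
  Enlarging \<open>A\<close> changes \<open>U\<close> by at most the quantity under the square root in \<open>T\<close> for the larger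
  set. The term with \<open>Q\<close> in the random end points is there to absorb this change.
\<close>

lemma abs_diff_U_le_Tsq:
  assumes "K A' \<subseteq> K A"
  shows "\<bar>U A \<omega> - U A' \<omega>\<bar> \<le> Tsq A' \<omega>"
proof -
  let ?t = "\<lambda>j. X (fst j) \<omega> * X (snd j) \<omega>"
  have sub: "pairs A' \<subseteq> pairs A" using assms by (auto simp: pairs_def)
  have "U A \<omega> = (\<Sum>j\<in>pairs A - pairs A'. ?t j) + U A' \<omega>"
    unfolding U_def by (rule sum.subset_diff[OF sub finite_pairs])
  then have "\<bar>U A \<omega> - U A' \<omega>\<bar> \<le> (\<Sum>j\<in>pairs A - pairs A'. \<bar>?t j\<bar>)" using sum_abs by simp
  also have "\<dots> \<le> (\<Sum>j\<in>edges - pairs A'. \<bar>?t j\<bar>)"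
    by (intro sum_mono2) (use pairs_subset_edges in auto)
  also have "\<dots> \<le> (\<Sum>k\<in>NA A'. \<Sum>l\<in>nb k. \<bar>X k \<omega> * X l \<omega>\<bar>) + (\<Sum>k\<in>NA A'. \<Sum>l\<in>Nb k. \<bar>X l \<omega> * X k \<omega>\<bar>)"
    by (rule sum_edges_minus_pairs_le[where f="\<lambda>k l. \<bar>X k \<omega> * X l \<omega>\<bar>"]) auto
  finally show ?thesis unfolding Tsq_def by (simp add: mult.commute)
qed

text \<open>
  The two ratios differ through the numerators, by at most a sum over \<open>Nb i\<close>, and through \<open>1 / V\<close>.
  The latter changes by at most \<open>4 T\<^sup>2\<close>, and by at most \<open>2\<close> in any case; if \<open>T \<le> 1\<close> then
  \<open>T\<^sup>2 \<le> T\<close>, so that \<open>4 Q\<close> is a bound in both cases.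
\<close>

lemma ratio_insert_le:
  assumes i: "i \<in> I"
  shows "\<bar>S A \<omega> / V A \<omega> - S (insert i A) \<omega> / V (insert i A) \<omega>\<bar> \<le> 2 * (\<Sum>m\<in>Nb i. \<bar>X m \<omega>\<bar>) + 4 * \<bar>S (insert i A) \<omega>\<bar> * Q (insert i A) \<omega>"
    and "\<bar>S A \<omega>\<bar> * Q A \<omega> \<le> \<bar>S (insert i A) \<omega>\<bar> * Q (insert i A) \<omega> + (\<Sum>m\<in>Nb i. \<bar>X m \<omega>\<bar>)"
proof -
  let ?A = "insert i A"
  have KK: "K ?A \<subseteq> K A" and NN: "NA A \<subseteq> NA ?A" using K_insert[OF i] NA_insert[OF i] by auto
  have S: "\<bar>S A \<omega> - S ?A \<omega>\<bar> \<le> (\<Sum>m\<in>Nb i. \<bar>X m \<omega>\<bar>)"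
  proof -
    have "S A \<omega> - S ?A \<omega> = (\<Sum>m\<in>K A \<inter> Nb i. X m \<omega>)"
      unfolding S_def K_insert[OF i] using sum.Int_Diff[OF finite_K, of "\<lambda>m. X m \<omega>" A "Nb i"] by simp
    also have "\<bar>\<dots>\<bar> \<le> (\<Sum>m\<in>K A \<inter> Nb i. \<bar>X m \<omega>\<bar>)" by (rule sum_abs)
    also have "\<dots> \<le> (\<Sum>m\<in>Nb i. \<bar>X m \<omega>\<bar>)" by (intro sum_mono2) auto
    finally show ?thesis .
  qed
  have V: "\<bar>1 / V A \<omega> - 1 / V ?A \<omega>\<bar> \<le> 4 * Q ?A \<omega>"
  proof (cases "Tsq ?A \<omega> \<le> 1")
    case True
    have "\<bar>1 / V A \<omega> - 1 / V ?A \<omega>\<bar> \<le> 4 * \<bar>U A \<omega> - U ?A \<omega>\<bar>" unfolding V_def by (rule inverse_psi_1_lipschitz)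
    also have "\<dots> \<le> 4 * Tsq ?A \<omega>" using abs_diff_U_le_Tsq[OF KK] by simp
    also have "Tsq ?A \<omega> \<le> sqrt (Tsq ?A \<omega>)"
    proof -
      have "sqrt (Tsq ?A \<omega>) * sqrt (Tsq ?A \<omega>) \<le> sqrt (Tsq ?A \<omega>) * 1" using True Tsq_nonneg by (intro mult_left_mono) auto
      then show ?thesis using Tsq_nonneg by simp
    qed
    finally show ?thesis using True by (simp add: Q_def)
  next
    case False
    then have "Q ?A \<omega> = 1" by (simp add: Q_def)
    then show ?thesis using V_bounds[of A \<omega>] V_bounds[of ?A \<omega>] by (simp add: abs_le_iff)
  qed
  have "S A \<omega> / V A \<omega> - S ?A \<omega> / V ?A \<omega> = (S A \<omega> - S ?A \<omega>) * (1 / V A \<omega>) + S ?A \<omega> * (1 / V A \<omega> - 1 / V ?A \<omega>)"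
    by (simp add: algebra_simps)
  also have "\<bar>\<dots>\<bar> \<le> \<bar>S A \<omega> - S ?A \<omega>\<bar> * \<bar>1 / V A \<omega>\<bar> + \<bar>S ?A \<omega>\<bar> * \<bar>1 / V A \<omega> - 1 / V ?A \<omega>\<bar>"
    by (rule order_trans[OF abs_triangle_ineq]) (simp only: abs_mult order_refl)
  also have "\<dots> \<le> (\<Sum>m\<in>Nb i. \<bar>X m \<omega>\<bar>) * 2 + \<bar>S ?A \<omega>\<bar> * (4 * Q ?A \<omega>)"
    using S V V_bounds[of A \<omega>] by (intro add_mono mult_mono) (auto intro: sum_nonneg)
  finally show "\<bar>S A \<omega> / V A \<omega> - S ?A \<omega> / V ?A \<omega>\<bar> \<le> 2 * (\<Sum>m\<in>Nb i. \<bar>X m \<omega>\<bar>) + 4 * \<bar>S ?A \<omega>\<bar> * Q ?A \<omega>" by simp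
  have "\<bar>S A \<omega>\<bar> * Q A \<omega> \<le> (\<bar>S ?A \<omega>\<bar> + \<bar>S A \<omega> - S ?A \<omega>\<bar>) * Q A \<omega>"
    using Q_bounds by (intro mult_right_mono) auto
  also have "\<dots> = \<bar>S ?A \<omega>\<bar> * Q A \<omega> + \<bar>S A \<omega> - S ?A \<omega>\<bar> * Q A \<omega>" by (simp add: algebra_simps)
  also have "\<dots> \<le> \<bar>S ?A \<omega>\<bar> * Q ?A \<omega> + (\<Sum>m\<in>Nb i. \<bar>X m \<omega>\<bar>) * 1"
  proof (intro add_mono mult_left_mono mult_mono S)
    show "Q A \<omega> \<le> Q ?A \<omega>" using Tsq_mono[OF NN, of \<omega>] unfolding Q_def by (intro min.mono) auto
  qed (use Q_bounds in \<open>auto intro: sum_nonneg\<close>)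
  finally show "\<bar>S A \<omega>\<bar> * Q A \<omega> \<le> \<bar>S ?A \<omega>\<bar> * Q ?A \<omega> + (\<Sum>m\<in>Nb i. \<bar>X m \<omega>\<bar>)" by simp
qed

text \<open>
  If the ratio for \<open>A\<close> is near one of the two sides of the trapezoid, then the ratio for the enlarged set
  lies in an interval of the admissible form around \<open>[b, b + d]\<close> or \<open>[a - d, a]\<close>. The coefficient
  of \<open>|X\<^sub>m|\<close> has to be at least \<open>2 c + 4\<close>: twice \<open>c\<close> from the old width, \<open>2\<close> from the change of
  the ratio and \<open>2\<close> from \<open>Y / V\<close>. The coefficient of \<open>Q\<close> has to be at least \<open>c + 4\<close>. Both are at
  most \<open>6 c\<close>.
\<close>

lemma near_ramp_hits:
  assumes i: "i \<in> I" and k: "k \<in> K A" and B: "B \<subseteq> I" and c: "c \<ge> 1" and d: "d > 0" and ab: "a \<le> b"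
    and near: "(b - a) / 2 + width A B c \<omega> - \<bar>Y A k \<omega> / V A \<omega>\<bar> \<le> \<bar>S A \<omega> / V A \<omega> - (a + b) / 2\<bar>"
      "\<bar>S A \<omega> / V A \<omega> - (a + b) / 2\<bar> \<le> (b - a) / 2 + width A B c \<omega> + d + \<bar>Y A k \<omega> / V A \<omega>\<bar>"
  shows "1 \<le> hit (insert i A) (B \<union> Nb i \<union> nb k) b (b + d) (6 * c) \<omega> + hit (insert i A) (B \<union> Nb i \<union> nb k) (a - d) a (6 * c) \<omega>"
proof -
  let ?A = "insert i A" and ?B = "B \<union> Nb i \<union> nb k"
  let ?t = "\<lambda>J. \<Sum>m\<in>J. \<bar>X m \<omega>\<bar>"
  define q where "q = \<bar>S ?A \<omega>\<bar> * Q ?A \<omega>"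
  have q0: "0 \<le> q" unfolding q_def using Q_bounds by simp
  have kI: "k \<in> I" by (rule K_I[OF k])
  have fB: "finite B" using B by (rule finite_subset) simp
  have le: "?t B \<le> ?t ?B" "?t (Nb i) \<le> ?t ?B" "?t (nb k) \<le> ?t ?B"
    using fB finite_nb[OF kI] by (auto intro!: sum_mono2)
  have Y: "\<bar>Y A k \<omega> / V A \<omega>\<bar> \<le> 2 * ?t (nb k)"
  proof -
    have "\<bar>Y A k \<omega> / V A \<omega>\<bar> = \<bar>Y A k \<omega>\<bar> * (1 / V A \<omega>)" using V_bounds(3)[of A \<omega>] by (simp add: abs_divide)
    also have "\<dots> \<le> ?t (nb k) * 2"
    proof (intro mult_mono V_bounds)
      have "\<bar>Y A k \<omega>\<bar> \<le> ?t (K A \<inter> nb k)" unfolding Y_def by (rule sum_abs)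
      also have "\<dots> \<le> ?t (nb k)" using finite_nb[OF kI] by (intro sum_mono2) auto
      finally show "\<bar>Y A k \<omega>\<bar> \<le> ?t (nb k)" .
    qed (use V_bounds(3)[of A \<omega>] in \<open>auto intro: sum_nonneg less_imp_le\<close>)
    finally show ?thesis by simp
  qed
  have R: "\<bar>S A \<omega> / V A \<omega> - S ?A \<omega> / V ?A \<omega>\<bar> \<le> 2 * ?t (Nb i) + 4 * q"
    using ratio_insert_le(1)[OF i, of A \<omega>] by (simp add: q_def)
  have W: "width A B c \<omega> \<le> c * ?t B + c * (q + ?t (Nb i))"
  proof -
    have "c * (\<bar>S A \<omega>\<bar> * Q A \<omega>) \<le> c * (q + ?t (Nb i))"
      using ratio_insert_le(2)[OF i, of A \<omega>] c by (intro mult_left_mono) (auto simp: q_def)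
    then show ?thesis by (simp add: width_def)
  qed
  have W0: "0 \<le> width A B c \<omega>" using c by (intro width_nonneg) auto
  have W': "width ?A ?B (6 * c) \<omega> = 6 * c * ?t ?B + 6 * c * q" by (simp add: width_def q_def mult.assoc)
  have t0: "0 \<le> ?t ?B" by (auto intro: sum_nonneg)
  have ct: "?t ?B \<le> c * ?t ?B" "q \<le> c * q" using c t0 q0 by (auto intro: mult_right_mono[of 1 c, simplified])
  have cB: "c * ?t B \<le> c * ?t ?B" "c * ?t (Nb i) \<le> c * ?t ?B" using le c by (auto intro: mult_left_mono)
  have up: "width A B c \<omega> + \<bar>Y A k \<omega> / V A \<omega>\<bar> + \<bar>S A \<omega> / V A \<omega> - S ?A \<omega> / V ?A \<omega>\<bar> \<le> width ?A ?B (6 * c) \<omega>"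
    unfolding W' using W Y R le ct cB q0 by (simp add: distrib_left)
  define y y' w e where "y = S A \<omega> / V A \<omega>" and "y' = S ?A \<omega> / V ?A \<omega>" and "w = width ?A ?B (6 * c) \<omega>" and "e = \<bar>Y A k \<omega> / V A \<omega>\<bar>"
  note up = up[folded y_def y'_def w_def e_def] and near = near[folded y_def e_def]
  show ?thesis
  proof (cases "y \<ge> (a + b) / 2")
    case True
    then have "b - w \<le> y'" "y' \<le> b + d + w" using near up W0 by (auto simp: field_simps abs_if split: if_splits)
    then have "hit ?A ?B b (b + d) (6 * c) \<omega> = 1" unfolding hit_def y'_def w_def by simp
    then show ?thesis using hit_bounds(1)[of ?A ?B "a - d" a "6 * c" \<omega>] by simp
  next
    case False
    then have "a - d - w \<le> y'" "y' \<le> a + w" using near up W0 by (auto simp: field_simps abs_if split: if_splits)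
    then have "hit ?A ?B (a - d) a (6 * c) \<omega> = 1" unfolding hit_def y'_def w_def by simp
    then show ?thesis using hit_bounds(1)[of ?A ?B b "b + d" "6 * c" \<omega>] by simp
  qed
qed

end

section \<open>One step of Stein's method\<close>

context local_dependence
begin

text \<open>
  The bound \<open>\<delta>\<^sub>1 + \<delta>\<^sub>2 + \<delta>\<^sub>3 + \<delta>\<^sub>4\<close> for variance \<open>1\<close>, with smaller second and third summands. This
  leaner form is at most doubled, up to terms that depend on \<open>i\<close> and \<open>k\<close> only and up to the factor
  \<open>6\<close> of \<open>c\<close>, when \<open>A\<close> is enlarged.
\<close>

definition Delta :: "nat set \<Rightarrow> nat set \<Rightarrow> real \<Rightarrow> real" where
  "Delta A B c = c * ((\<Sum>m\<in>B. x m) + \<kappa>\<^sup>2 * sum_x3 + lam * sqrt (var_scale A) + lam * sqrt (Dsum A))"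

text \<open>
  The function \<open>f\<^sub>k\<close> of the introduction.
\<close>

definition blind_ramp :: "nat set \<Rightarrow> nat set \<Rightarrow> real \<Rightarrow> real \<Rightarrow> real \<Rightarrow> real \<Rightarrow> nat \<Rightarrow> 'a \<Rightarrow> real" where
  "blind_ramp A B a b c d k \<omega> = ramp d ((b - a) / 2 + width' A B c k \<omega>) (S' A k \<omega> / V' A k \<omega> - (a + b) / 2)"

definition hit_ramps :: "nat set \<Rightarrow> nat set \<Rightarrow> real \<Rightarrow> real \<Rightarrow> real \<Rightarrow> real \<Rightarrow> nat \<Rightarrow> nat \<Rightarrow> 'a \<Rightarrow> real" where
  "hit_ramps A B a b c d i k \<omega> = hit (insert i A) (B \<union> Nb i \<union> nb k) b (b + d) (6 * c) \<omega>
     + hit (insert i A) (B \<union> Nb i \<union> nb k) (a - d) a (6 * c) \<omega>"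

lemma hit_ramps_nonneg: "0 \<le> hit_ramps A B a b c d i k \<omega>"
  unfolding hit_ramps_def using hit_bounds by (intro add_nonneg_nonneg)

lemma sum_pairs_mult: "(\<Sum>k\<in>K A. e * (\<Sum>l\<in>K A \<inter> nb k. f k l)) = e * (\<Sum>j\<in>pairs A. f (fst j) (snd j :: nat) :: real)"
  unfolding sum_pairs by (rule sum_distrib_left[symmetric])

text \<open>
  Compare \<open>\<Sum>\<^sub>k X\<^sub>k (f - f\<^sub>k)\<close> with \<open>(U / V) F\<close>, first replacing \<open>S\<close> by \<open>S - Y\<^sub>k\<close> in the ramp at
  cost \<open>hit_ramps\<close> (Taylor's formula), then deleting \<open>nb k\<close> from the half-width and from \<open>V\<close> at cost
  \<open>err\<close>. As \<open>1 / V \<ge> 0.7\<close> and the mean of \<open>U\<close> is at least \<open>0.99\<close>, the factor \<open>0.69\<close> remains.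
\<close>

lemma pointwise_concentration:
  assumes B: "B \<subseteq> I" and ab: "a \<le> b" and c: "1 \<le> c" and d: "0 < d" and mU: "99 / 100 \<le> mean_U A"
  shows "69 / 100 * hit A B a b c \<omega> \<le> - (\<Sum>k\<in>K A. X k \<omega> * blind_ramp A B a b c d k \<omega>)
      + \<bar>S A \<omega>\<bar> * ((b - a) / 2 + d + width A B c \<omega>) + 2 * \<bar>U A \<omega> - mean_U A\<bar>
      + 4 / d * \<kappa> * (\<Sum>j\<in>pairs A. (\<bar>X (fst j) \<omega>\<bar> ^ 3 * hit_ramps A B a b c d (fst j) (fst j) \<omega>
          + 2 * (\<bar>X (snd j) \<omega>\<bar> ^ 3 * hit_ramps A B a b c d (snd j) (fst j) \<omega>)) / 3)
      + err A B c \<omega>"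
proof -
  let ?h = "(b - a) / 2 + width A B c \<omega>" and ?m = "(a + b) / 2" and ?P = "1 / V A \<omega>"
  let ?y = "S A \<omega> / V A \<omega> - ?m"
  let ?u = "\<lambda>k. Y A k \<omega> / V A \<omega>"
  let ?f = "ramp d ?h ?y" and ?F = "ramp_slope d ?h ?y" and ?fk = "\<lambda>k. blind_ramp A B a b c d k \<omega>"
  let ?H = "\<lambda>i k. hit_ramps A B a b c d i k \<omega>"
  let ?near = "\<lambda>k. if ?h - \<bar>?u k\<bar> \<le> \<bar>?y\<bar> \<and> \<bar>?y\<bar> \<le> ?h + d + \<bar>?u k\<bar> then 1 else (0::real)"
  let ?e = "\<lambda>k. \<bar>X k \<omega>\<bar> * (\<bar>S' A k \<omega>\<bar> * \<bar>1 / V A \<omega> - 1 / V' A k \<omega>\<bar> + \<bar>width A B c \<omega> - width' A B c k \<omega>\<bar>)"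
  let ?rem = "\<lambda>k. 4 / d * \<kappa> * (\<Sum>l\<in>K A \<inter> nb k. (\<bar>X k \<omega>\<bar> ^ 3 * ?H k k + 2 * (\<bar>X l \<omega>\<bar> ^ 3 * ?H l k)) / 3)"
  have w0: "0 \<le> width A B c \<omega>" using c by (intro width_nonneg) auto
  have h0: "0 \<le> ?h" using ab w0 by simp
  have h'0: "0 \<le> (b - a) / 2 + width' A B c k \<omega>" for k using ab c width'_nonneg[of c A B k \<omega>] by simp
  have P: "0.7 \<le> ?P" "?P \<le> 2" using V_bounds by auto
  have term_le: "X k \<omega> * Y A k \<omega> * (?P * ?F) \<le> X k \<omega> * (?f - ?fk k) + ?rem k + ?e k" if k: "k \<in> K A" for k
  proof -
    have S': "S' A k \<omega> / V A \<omega> - ?m = ?y - ?u k" unfolding S'_eq[OF k] by (simp add: diff_divide_distrib)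
    let ?g = "ramp d ?h (?y - ?u k)"
    have 1: "\<bar>?f - ?g - ?u k * ?F\<bar> \<le> (?u k)\<^sup>2 / d * ?near k" by (rule ramp_taylor[OF d h0])
    have 2: "\<bar>?g - ?fk k\<bar> \<le> \<bar>S' A k \<omega>\<bar> * \<bar>1 / V A \<omega> - 1 / V' A k \<omega>\<bar> + \<bar>width A B c \<omega> - width' A B c k \<omega>\<bar>"
    proof -
      have "\<bar>?g - ?fk k\<bar> \<le> \<bar>(S' A k \<omega> / V A \<omega> - ?m) - (S' A k \<omega> / V' A k \<omega> - ?m)\<bar> + \<bar>?h - ((b - a) / 2 + width' A B c k \<omega>)\<bar>"
        unfolding S'[symmetric] blind_ramp_def by (rule ramp_lipschitz[OF d h0 h'0])
      moreover have "\<bar>(S' A k \<omega> / V A \<omega> - ?m) - (S' A k \<omega> / V' A k \<omega> - ?m)\<bar> = \<bar>S' A k \<omega>\<bar> * \<bar>1 / V A \<omega> - 1 / V' A k \<omega>\<bar>"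
        unfolding abs_mult[symmetric] by (simp add: algebra_simps)
      ultimately show ?thesis by simp
    qed
    have "X k \<omega> * (?u k * ?F) - X k \<omega> * (?f - ?fk k) = - (X k \<omega> * (?f - ?g - ?u k * ?F)) - X k \<omega> * (?g - ?fk k)"
      by (simp add: algebra_simps)
    also have "\<dots> \<le> \<bar>X k \<omega> * (?f - ?g - ?u k * ?F)\<bar> + \<bar>X k \<omega> * (?g - ?fk k)\<bar>" by linarith
    also have "\<dots> \<le> \<bar>X k \<omega>\<bar> * ((?u k)\<^sup>2 / d * ?near k) + ?e k"
      unfolding abs_mult[of "X k \<omega>"] by (intro add_mono mult_left_mono 1 2) auto
    also have "\<bar>X k \<omega>\<bar> * ((?u k)\<^sup>2 / d * ?near k) \<le> ?rem k"
    proof (cases "?near k = 0")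
      case True
      have "0 \<le> ?rem k" using d kappa_pos hit_ramps_nonneg by (intro mult_nonneg_nonneg sum_nonneg divide_nonneg_nonneg add_nonneg_nonneg) auto
      then show ?thesis unfolding True by simp
    next
      case False
      then have near: "?h - \<bar>?u k\<bar> \<le> \<bar>?y\<bar>" "\<bar>?y\<bar> \<le> ?h + d + \<bar>?u k\<bar>" by (auto split: if_splits)
      then have n1: "?near k = 1" by simp
      have H1: "1 \<le> ?H i k" if "i \<in> I" for i
        unfolding hit_ramps_def by (rule near_ramp_hits[OF that k B c d ab near])
      have "(?u k)\<^sup>2 \<le> 4 * (Y A k \<omega>)\<^sup>2"
      proof -
        have "(?u k)\<^sup>2 = ?P\<^sup>2 * (Y A k \<omega>)\<^sup>2" by (simp add: power_divide)
        also have "\<dots> \<le> 2\<^sup>2 * (Y A k \<omega>)\<^sup>2"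
          using P(2) V_bounds(3)[of A \<omega>] by (intro mult_right_mono power_mono) (simp_all add: less_imp_le)
        finally show ?thesis by simp
      qed
      then have "\<bar>X k \<omega>\<bar> * ((?u k)\<^sup>2 / d * ?near k) \<le> \<bar>X k \<omega>\<bar> * (4 * (Y A k \<omega>)\<^sup>2 / d)"
        unfolding n1 using d by (intro mult_left_mono) (auto intro: divide_right_mono)
      also have "\<dots> = 4 / d * (\<bar>X k \<omega>\<bar> * (Y A k \<omega>)\<^sup>2)" by simp
      also have "\<dots> \<le> 4 / d * (\<kappa> * (\<Sum>l\<in>K A \<inter> nb k. (\<bar>X k \<omega>\<bar> ^ 3 + 2 * \<bar>X l \<omega>\<bar> ^ 3) / 3))"
        using d by (intro mult_left_mono XY2_le[OF k]) auto
      also have "\<dots> \<le> 4 / d * (\<kappa> * (\<Sum>l\<in>K A \<inter> nb k. (\<bar>X k \<omega>\<bar> ^ 3 * ?H k k + 2 * (\<bar>X l \<omega>\<bar> ^ 3 * ?H l k)) / 3))"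
      proof (intro mult_left_mono sum_mono divide_right_mono add_mono)
        show "\<bar>X k \<omega>\<bar> ^ 3 \<le> \<bar>X k \<omega>\<bar> ^ 3 * ?H k k" using mult_left_mono[OF H1[OF K_I[OF k]], of "\<bar>X k \<omega>\<bar> ^ 3"] by simp
        fix l assume "l \<in> K A \<inter> nb k"
        then have "l \<in> I" using K_I by blast
        then show "\<bar>X l \<omega>\<bar> ^ 3 \<le> \<bar>X l \<omega>\<bar> ^ 3 * ?H l k" using mult_left_mono[OF H1, of l "\<bar>X l \<omega>\<bar> ^ 3"] by simp
      qed (use d kappa_pos in auto)
      finally show ?thesis by (simp only: mult.assoc)
    qed
    finally show ?thesis by (simp add: mult.assoc)
  qed
  have "U A \<omega> * (?P * ?F) = (\<Sum>k\<in>K A. X k \<omega> * Y A k \<omega> * (?P * ?F))"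
    unfolding sum_distrib_right[symmetric] sum_XY ..
  also have "\<dots> \<le> (\<Sum>k\<in>K A. X k \<omega> * (?f - ?fk k) + ?rem k + ?e k)" by (intro sum_mono term_le)
  also have "\<dots> = (\<Sum>k\<in>K A. X k \<omega> * (?f - ?fk k)) + (\<Sum>k\<in>K A. ?rem k) + (\<Sum>k\<in>K A. ?e k)"
    by (simp only: sum.distrib)
  also have "(\<Sum>k\<in>K A. X k \<omega> * (?f - ?fk k)) = S A \<omega> * ?f - (\<Sum>k\<in>K A. X k \<omega> * ?fk k)"
    unfolding S_def by (simp add: right_diff_distrib sum_subtractf sum_distrib_right)
  also have "S A \<omega> * ?f \<le> \<bar>S A \<omega>\<bar> * (?h + d)"
  proof -
    have "S A \<omega> * ?f \<le> \<bar>S A \<omega>\<bar> * \<bar>?f\<bar>" using abs_ge_self[of "S A \<omega> * ?f"] by (simp add: abs_mult)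
    also have "\<dots> \<le> \<bar>S A \<omega>\<bar> * (?h + d)" by (intro mult_left_mono abs_ramp_le[OF d h0]) auto
    finally show ?thesis .
  qed
  also have "(\<Sum>k\<in>K A. ?e k) \<le> err A B c \<omega>" using c by (intro perturbation_le_err[OF B]) auto
  finally have main: "U A \<omega> * (?P * ?F) \<le> \<bar>S A \<omega>\<bar> * (?h + d) - (\<Sum>k\<in>K A. X k \<omega> * ?fk k) + (\<Sum>k\<in>K A. ?rem k) + err A B c \<omega>"
    by linarith
  have PF: "0 \<le> ?P * ?F" "?P * ?F \<le> 2"
    using P ramp_slope_bounds[of d ?h ?y] mult_mono[of ?P 2 ?F 1] V_bounds(3)[of A \<omega>] by (auto intro: less_imp_le)
  have lower: "69 / 100 * hit A B a b c \<omega> \<le> mean_U A * (?P * ?F)"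
  proof (cases "hit A B a b c \<omega> = 0")
    case True
    have "0 \<le> mean_U A * (?P * ?F)" using mU by (intro mult_nonneg_nonneg PF(1)) simp
    then show ?thesis using True by simp
  next
    case False
    then have *: "a - width A B c \<omega> \<le> S A \<omega> / V A \<omega>" "S A \<omega> / V A \<omega> \<le> b + width A B c \<omega>" "hit A B a b c \<omega> = 1"
      by (auto simp: hit_def split: if_splits)
    have "\<bar>?y\<bar> \<le> ?h" using *(1,2) unfolding abs_le_iff by (simp add: field_simps)
    then have "?F = 1" by (rule ramp_slope_eq_1[OF d])
    moreover have "99 / 100 * 0.7 \<le> mean_U A * ?P" using mU P by (intro mult_mono) auto
    ultimately show ?thesis unfolding *(3) by (simp only: mult_1_right)
  qed
  have "(mean_U A - U A \<omega>) * (?P * ?F) \<le> \<bar>U A \<omega> - mean_U A\<bar> * 2"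
    using PF by (intro mult_mono) auto
  then have "mean_U A * (?P * ?F) \<le> U A \<omega> * (?P * ?F) + 2 * \<bar>U A \<omega> - mean_U A\<bar>"
    unfolding left_diff_distrib by linarith
  with main lower
  have "69 / 100 * hit A B a b c \<omega> \<le> \<bar>S A \<omega>\<bar> * (?h + d) - (\<Sum>k\<in>K A. X k \<omega> * ?fk k) + (\<Sum>k\<in>K A. ?rem k) + err A B c \<omega> + 2 * \<bar>U A \<omega> - mean_U A\<bar>"
    by linarith
  moreover have "(\<Sum>k\<in>K A. ?rem k) = 4 / d * \<kappa> * (\<Sum>j\<in>pairs A. (\<bar>X (fst j) \<omega>\<bar> ^ 3 * ?H (fst j) (fst j)
          + 2 * (\<bar>X (snd j) \<omega>\<bar> ^ 3 * ?H (snd j) (fst j))) / 3)"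
    by (rule sum_pairs_mult[where f="\<lambda>k l. (\<bar>X k \<omega>\<bar> ^ 3 * ?H k k + 2 * (\<bar>X l \<omega>\<bar> ^ 3 * ?H l k)) / 3"])
  moreover have "?h + d = (b - a) / 2 + d + width A B c \<omega>" by simp
  ultimately show ?thesis by (simp only:)
qed

lemma blind_ramp_measurable:
  assumes A: "A \<subseteq> I" and B: "B \<subseteq> I" and k: "k \<in> K A"
  shows "blind_ramp A B a b c d k \<in> borel_measurable (gen (I - nb k))"
proof -
  have X[measurable (raw)]: "l \<in> I \<Longrightarrow> l \<notin> nb k \<Longrightarrow> X l \<in> borel_measurable (gen (I - nb k))" for l
    by (rule X_measurable_gen) simp
  have m1[measurable]: "S' A k \<in> borel_measurable (gen (I - nb k))"
    unfolding S'_def[abs_def] by (intro borel_measurable_sum X) (auto dest: K_I)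
  have m2[measurable]: "U' A k \<in> borel_measurable (gen (I - nb k))"
    unfolding U'_def[abs_def]
  proof (intro borel_measurable_sum)
    fix j assume "j \<in> pairs A"
    then have "fst j \<in> I" "snd j \<in> I" by (auto simp: pairs_iff dest: K_I)
    then show "(\<lambda>\<omega>. if fst j \<in> nb k \<or> snd j \<in> nb k then 0 else X (fst j) \<omega> * X (snd j) \<omega>) \<in> borel_measurable (gen (I - nb k))"
      by (cases "fst j \<in> nb k \<or> snd j \<in> nb k") (auto intro!: borel_measurable_times X)
  qed
  have t: "(\<lambda>\<omega>. if p \<in> nb k \<or> l \<in> nb k then 0 else \<bar>X p \<omega> * X l \<omega>\<bar>) \<in> borel_measurable (gen (I - nb k))"
    if "p \<in> I" "l \<in> I" for p l
    using that by (cases "p \<in> nb k \<or> l \<in> nb k") (auto intro!: borel_measurable_times borel_measurable_abs X)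
  have m3[measurable]: "Tsq' A k \<in> borel_measurable (gen (I - nb k))"
    unfolding Tsq'_def[abs_def] by (intro borel_measurable_add borel_measurable_sum t) (auto dest: NA_I Nb_I intro: nb_I)
  have m4[measurable]: "(\<lambda>\<omega>. \<Sum>m\<in>B - nb k. \<bar>X m \<omega>\<bar>) \<in> borel_measurable (gen (I - nb k))"
    using B by (intro borel_measurable_sum borel_measurable_abs X) auto
  show ?thesis unfolding blind_ramp_def[abs_def] width'_def V'_def Q'_def by measurable
qed

lemma abs_blind_ramp_le:
  assumes B: "B \<subseteq> I" and ab: "a \<le> b" and c: "1 \<le> c" and d: "0 < d"
  shows "\<bar>blind_ramp A B a b c d k \<omega>\<bar> \<le> (b - a) / 2 + d + 2 * c * (\<Sum>m\<in>I. \<bar>X m \<omega>\<bar>)"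
proof -
  have w: "0 \<le> width' A B c k \<omega>" using c by (intro width'_nonneg) auto
  have "\<bar>blind_ramp A B a b c d k \<omega>\<bar> \<le> (b - a) / 2 + width' A B c k \<omega> + d"
    unfolding blind_ramp_def using ab w by (intro abs_ramp_le[OF d]) auto
  moreover have "width' A B c k \<omega> \<le> c * (\<Sum>m\<in>I. \<bar>X m \<omega>\<bar>) + c * (\<Sum>m\<in>I. \<bar>X m \<omega>\<bar>)"
  proof -
    have "\<bar>S' A k \<omega>\<bar> * Q' A k \<omega> \<le> \<bar>S' A k \<omega>\<bar> * 1" using Q'_bounds by (intro mult_left_mono) auto
    also have "\<dots> \<le> (\<Sum>m\<in>K A - nb k. \<bar>X m \<omega>\<bar>)" unfolding S'_def by simp
    also have "\<dots> \<le> (\<Sum>m\<in>I. \<bar>X m \<omega>\<bar>)" using K_subset by (intro sum_mono2) auto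
    finally have "\<bar>S' A k \<omega>\<bar> * Q' A k \<omega> \<le> (\<Sum>m\<in>I. \<bar>X m \<omega>\<bar>)" .
    moreover have "(\<Sum>m\<in>B - nb k. \<bar>X m \<omega>\<bar>) \<le> (\<Sum>m\<in>I. \<bar>X m \<omega>\<bar>)" using B by (intro sum_mono2) auto
    ultimately show ?thesis unfolding width'_def mult.assoc using c by (intro add_mono mult_left_mono) auto
  qed
  ultimately show ?thesis by simp
qed

lemma Dsum_insert:
  assumes i: "i \<in> I"
  shows "sqrt (Dsum (insert i A)) \<le> sqrt (Dsum A) + sqrt (Dsum {i})"
proof -
  have N: "NA (insert i A) = NA A \<union> NA {i}" by (auto simp: N_set_def)
  have "Dsum (insert i A) \<le> Dsum A + Dsum {i}"
    unfolding Dsum_def N by (subst sum_Un) (auto intro!: sum_nonneg)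
  then have "sqrt (Dsum (insert i A)) \<le> sqrt (Dsum A + Dsum {i})" by simp
  also have "\<dots> \<le> sqrt (Dsum A) + sqrt (Dsum {i})" using Dsum_nonneg by (intro sqrt_add_le_add_sqrt) auto
  finally show ?thesis .
qed

lemma kappa3_le_var_scale:
  assumes "A \<subseteq> I" "A \<noteq> {}"
  shows "\<kappa> ^ 3 * sum_x4 \<le> var_scale A" "0 \<le> var_scale A"
proof -
  have "0 \<le> \<tau>" using assms tau_nonneg by blast
  then have "\<kappa> * (\<kappa>\<^sup>2 + 0) * sum_x4 \<le> var_scale A"
    unfolding var_scale_def using kappa_pos sum_x4_nonneg by (intro mult_right_mono mult_left_mono add_left_mono) auto
  then show "\<kappa> ^ 3 * sum_x4 \<le> var_scale A" by (simp add: power2_eq_square power3_eq_cube)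
  then show "0 \<le> var_scale A" using kappa_pos sum_x4_nonneg by (smt (verit) mult_nonneg_nonneg zero_le_power)
qed

lemma sum_x3_nonneg: "0 \<le> sum_x3" by (simp add: sum_x3_def sum_nonneg)

lemma Delta_parts_nonneg:
  assumes "A \<subseteq> I" "A \<noteq> {}"
  shows "0 \<le> (\<Sum>m\<in>B. x m)" "0 \<le> \<kappa>\<^sup>2 * sum_x3" "0 \<le> lam * sqrt (var_scale A)" "0 \<le> lam * sqrt (Dsum A)"
  using lam_ge_1 kappa3_le_var_scale(2)[OF assms] sum_x3_nonneg Dsum_nonneg by (auto intro: sum_nonneg)

text \<open>
  When \<open>Delta\<close> is not small the concentration inequality is trivial, so these bounds may be assumed.
\<close>

lemma smallness:
  assumes A: "A \<subseteq> I" "A \<noteq> {}" and c: "1 \<le> c" and D: "Delta A B c \<le> 1 / 200"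
  shows "8 * \<kappa> ^ 3 * sum_x4 \<le> 1" "var_scale A \<le> 1 / 2000" "\<kappa>\<^sup>2 * sum_x3 \<le> 1 / 100" "Dsum A \<le> 1 / 200" "99 / 100 \<le> mean_U A"
proof -
  note p = Delta_parts_nonneg(1)[OF A, of B] Delta_parts_nonneg(2-4)[OF A]
  let ?t = "(\<Sum>m\<in>B. x m) + \<kappa>\<^sup>2 * sum_x3 + lam * sqrt (var_scale A) + lam * sqrt (Dsum A)"
  have "1 * ?t \<le> c * ?t" using p c by (intro mult_right_mono) auto
  then have t: "?t \<le> 1 / 200" using D unfolding Delta_def by simp
  have s: "s \<le> 1 / 40000" if "0 \<le> s" "lam * sqrt s \<le> 1 / 200" for s
  proof -
    have "1 * sqrt s \<le> lam * sqrt s" using lam_ge_1 that by (intro mult_right_mono) auto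
    then have "sqrt s \<le> 1 / 200" using that by simp
    then have "(sqrt s)\<^sup>2 \<le> (1 / 200)\<^sup>2" using that by (intro power_mono) auto
    then show ?thesis using that by (simp add: power_divide)
  qed
  have v: "var_scale A \<le> 1 / 40000" using p t kappa3_le_var_scale(2)[OF A] by (intro s) auto
  then show "var_scale A \<le> 1 / 2000" by simp
  show "8 * \<kappa> ^ 3 * sum_x4 \<le> 1" using v kappa3_le_var_scale(1)[OF A] by simp
  show "\<kappa>\<^sup>2 * sum_x3 \<le> 1 / 100" using p t by linarith
  have d: "Dsum A \<le> 1 / 40000" using p t Dsum_nonneg by (intro s) auto
  then show "Dsum A \<le> 1 / 200" by simp
  show "99 / 100 \<le> mean_U A" using mean_U_near_1[of A] d by linarith
qed

lemma one_gen: "(\<lambda>_. 1) \<in> borel_measurable (gen A)" by simp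

text \<open>
  Multiplied by the weight \<open>v\<^sup>3\<close>, the pointwise inequality is integrated term by term. The first sum
  has expectation \<open>0\<close>, since \<open>X\<^sub>k\<close> is centred and independent of \<open>v\<^sup>3 f\<^sub>k\<close>. Every other term,
  except those that involve \<open>hit_ramps\<close>, is a product of four functions in \<open>L\<^sup>4\<close>; among its factors,
  three carry one factor \<open>v\<close> each. The numbers \<open>R i k\<close> stand for what the induction provides.
\<close>

lemma concentration_step:
  assumes A: "A \<subseteq> I" "A \<noteq> {}" and B: "B \<subseteq> I"
    and v: "v \<in> borel_measurable (gen A)" "L4_bound M v \<rho>" and v0: "\<And>\<omega>. \<omega> \<in> space M \<Longrightarrow> 0 \<le> v \<omega>"
    and ab: "a \<le> b" and c: "1 \<le> c" and d: "0 < d" and small: "Delta A B c \<le> 1 / 200"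
    and R: "\<And>i k. i \<in> K A \<Longrightarrow> k \<in> K A \<Longrightarrow>
      expectation (\<lambda>\<omega>. (v \<omega> * \<bar>X i \<omega>\<bar>) ^ 3 * hit (insert i A) (B \<union> Nb i \<union> nb k) b (b + d) (6 * c) \<omega>) \<le> R i k"
      "\<And>i k. i \<in> K A \<Longrightarrow> k \<in> K A \<Longrightarrow>
      expectation (\<lambda>\<omega>. (v \<omega> * \<bar>X i \<omega>\<bar>) ^ 3 * hit (insert i A) (B \<union> Nb i \<union> nb k) (a - d) a (6 * c) \<omega>) \<le> R i k"
  shows "69 / 100 * expectation (\<lambda>\<omega>. v \<omega> ^ 3 * hit A B a b c \<omega>)
    \<le> \<rho> ^ 3 * ((b - a) + 2 * d + 24 * Delta A B c) + 4 / d * \<kappa> * (\<Sum>j\<in>pairs A. (2 * R (fst j) (fst j) + 4 * R (snd j) (fst j)) / 3)"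
proof -
  note sm = smallness[OF A c small]
  have vM[measurable]: "v \<in> borel_measurable M" by (rule v_measurable[OF A v])
  have \<rho>0: "0 \<le> \<rho>" by (rule rho_nonneg[OF A v])
  note L = L4_weighted_X[OF A(1) v]
  note LS = L4_S[OF A v sm(1-4)] and LZ = L4_Zstar[OF A v sm(1)]
  \<comment> \<open>The terms that contain three of the \<open>X\<^sub>k\<close> spend all of \<open>v\<^sup>3\<close> on them, so the remaining factor
    \<open>S\<close> or \<open>Zstar\<close> is estimated with the weight \<open>1\<close>.\<close>
  have LS1: "L4_bound M (S A) 2" using L4_S[OF A one_gen L4_1 sm(1-4)] by simp
  have LZ1: "L4_bound M (Zstar A) 1" using L4_Zstar[OF A one_gen L4_1 sm(1)] by simp
  let ?T = "\<lambda>\<omega>. sqrt (Tsq A \<omega>)"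
  define t where "t = sqrt 2 * sqrt (Dsum A)"
  have LT: "L4_bound M ?T t" unfolding t_def by (rule L4_T)
  let ?sd = "\<lambda>\<omega>. sqrt \<bar>(v \<omega>)\<^sup>2 * (U A \<omega> - mean_U A)\<bar>"
  have Ld: "L4_bound M ?sd (sqrt (\<rho>\<^sup>2 * sqrt (12 * var_scale A)))"
  proof (rule L4_bound_sqrt_abs)
    note W = weighted_variance[OF A v pair_product_gen[OF A v] order_refl, folded mean_U_def U_def]
    have eq: "((v \<omega>)\<^sup>2 * (U A \<omega> - mean_U A))\<^sup>2 = v \<omega> ^ 4 * (U A \<omega> - mean_U A)\<^sup>2" for \<omega>
      by (simp add: power_mult_distrib)
    show "integrable M (\<lambda>\<omega>. ((v \<omega>)\<^sup>2 * (U A \<omega> - mean_U A))\<^sup>2)"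
      unfolding eq using W(1) by (simp add: mean_U_def U_def)
    have "expectation (\<lambda>\<omega>. ((v \<omega>)\<^sup>2 * (U A \<omega> - mean_U A))\<^sup>2) \<le> 12 * \<rho> ^ 4 * var_scale A"
      unfolding eq using W(2) by (simp add: mean_U_def U_def)
    also have "\<dots> = (\<rho>\<^sup>2 * sqrt (12 * var_scale A))\<^sup>2"
      using kappa3_le_var_scale(2)[OF A] by (simp add: power_mult_distrib)
    finally show "expectation (\<lambda>\<omega>. ((v \<omega>)\<^sup>2 * (U A \<omega> - mean_U A))\<^sup>2) \<le> (\<rho>\<^sup>2 * sqrt (12 * var_scale A))\<^sup>2" .
  qed (use kappa3_le_var_scale(2)[OF A] in \<open>measurable, auto\<close>)
  let ?su = "\<lambda>\<omega>. sqrt \<bar>(v \<omega>)\<^sup>2 * absU A \<omega>\<bar>"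
  have Lu: "L4_bound M ?su (sqrt (\<rho>\<^sup>2 * (1.1 * lam)))"
    unfolding absU_def
  proof (rule L4_pair_sum[OF A v _ _ _ lam_ge_1 sm(2)])
    fix j show "(\<lambda>\<omega>. \<bar>X (fst j) \<omega> * X (snd j) \<omega>\<bar>) \<in> borel_measurable (gen {fst j, snd j})"
      using pair_product_gen[OF A v] by (rule borel_measurable_abs)
    show "\<bar>\<Sum>j\<in>pairs A. expectation (\<lambda>\<omega>. \<bar>X (fst j) \<omega> * X (snd j) \<omega>\<bar>)\<bar> \<le> lam"
      using mean_absU_le[of A] by (simp add: abs_of_nonneg[OF sum_nonneg])
  qed auto
  have absU0: "0 \<le> absU A \<omega>" for \<omega> by (simp add: absU_def sum_nonneg)
  have BI: "L4_bound M (X m) (x m)" if "m \<in> B" for m using that B by (intro L4_X) auto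
  let ?g1 = "\<lambda>\<omega>. \<bar>v \<omega> * v \<omega> * (v \<omega> * S A \<omega>) * 1\<bar>"
  let ?g2 = "\<lambda>m \<omega>. \<bar>v \<omega> * v \<omega> * (v \<omega> * S A \<omega>) * X m \<omega>\<bar>"
  let ?g3 = "\<lambda>\<omega>. \<bar>(v \<omega> * S A \<omega>) * (v \<omega> * S A \<omega>) * v \<omega> * ?T \<omega>\<bar>"
  let ?g4 = "\<lambda>\<omega>. \<bar>?sd \<omega> * ?sd \<omega> * v \<omega> * 1\<bar>"
  let ?g5 = "\<lambda>k \<omega>. \<bar>(v \<omega> * X k \<omega>) * (v \<omega> * X k \<omega>) * (v \<omega> * X k \<omega>) * S A \<omega>\<bar>"
  let ?g6 = "\<lambda>k \<omega>. \<bar>(v \<omega> * X k \<omega>) * (v \<omega> * X k \<omega>) * (v \<omega> * X k \<omega>) * Zstar A \<omega>\<bar>"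
  let ?g7 = "\<lambda>m \<omega>. \<bar>v \<omega> * v \<omega> * (v \<omega> * Zstar A \<omega>) * X m \<omega>\<bar>"
  let ?g8 = "\<lambda>\<omega>. \<bar>?su \<omega> * ?su \<omega> * v \<omega> * ?T \<omega>\<bar>"
  let ?g9 = "\<lambda>\<omega>. \<bar>(v \<omega> * S A \<omega>) * (v \<omega> * Zstar A \<omega>) * v \<omega> * ?T \<omega>\<bar>"
  note B1 = L4_bound_mult4[OF v(2) v(2) LS L4_1]
  note B2 = L4_bound_mult4[OF v(2) v(2) LS BI]
  note B3 = L4_bound_mult4[OF LS LS v(2) LT]
  note B4 = L4_bound_mult4[OF Ld Ld v(2) L4_1]
  have B5: "integrable M (?g5 k)" "expectation (?g5 k) \<le> \<rho> * x k * (\<rho> * x k) * (\<rho> * x k) * 2" if "k \<in> K A" for k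
    using L4_bound_mult4[OF L[OF that] L[OF that] L[OF that] LS1] by auto
  have B6: "integrable M (?g6 k)" "expectation (?g6 k) \<le> \<rho> * x k * (\<rho> * x k) * (\<rho> * x k) * 1" if "k \<in> K A" for k
    using L4_bound_mult4[OF L[OF that] L[OF that] L[OF that] LZ1] by auto
  note B7 = L4_bound_mult4[OF v(2) v(2) LZ BI]
  note B8 = L4_bound_mult4[OF Lu Lu v(2) LT]
  note B9 = L4_bound_mult4[OF LS LZ v(2) LT]
  have v3: "integrable M (\<lambda>\<omega>. v \<omega> ^ 3)"
    using L4_bound_mult4(1)[OF v(2) v(2) v(2) L4_1] by (simp add: power3_eq_cube)
  have cube_int: "integrable M (\<lambda>\<omega>. (v \<omega> * \<bar>X i \<omega>\<bar>) ^ 3 * h \<omega>)"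
    if "i \<in> K A" "h \<in> borel_measurable M" "\<And>\<omega>. 0 \<le> h \<omega>" "\<And>\<omega>. h \<omega> \<le> 1" for i h
  proof (rule Bochner_Integration.integrable_bound)
    show "integrable M (\<lambda>\<omega>. v \<omega> * X i \<omega> * (v \<omega> * X i \<omega>) * (v \<omega> * X i \<omega>) * 1)"
      by (rule L4_bound_mult4(1)[OF L[OF that(1)] L[OF that(1)] L[OF that(1)] L4_1])
    have "X i \<in> borel_measurable M" by (rule X_meas[OF K_I[OF that(1)]])
    then show "(\<lambda>\<omega>. (v \<omega> * \<bar>X i \<omega>\<bar>) ^ 3 * h \<omega>) \<in> borel_measurable M" using that(2) by measurable
    show "AE \<omega> in M. norm ((v \<omega> * \<bar>X i \<omega>\<bar>) ^ 3 * h \<omega>) \<le> norm (v \<omega> * X i \<omega> * (v \<omega> * X i \<omega>) * (v \<omega> * X i \<omega>) * 1)"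
    proof (rule AE_I2)
      fix \<omega>
      have "norm ((v \<omega> * \<bar>X i \<omega>\<bar>) ^ 3 * h \<omega>) = \<bar>v \<omega> * X i \<omega>\<bar> ^ 3 * h \<omega>" using that(3)[of \<omega>] by (simp add: abs_mult power_abs)
      also have "\<dots> \<le> \<bar>v \<omega> * X i \<omega>\<bar> ^ 3 * 1" using that(4)[of \<omega>] by (intro mult_left_mono) auto
      finally show "norm ((v \<omega> * \<bar>X i \<omega>\<bar>) ^ 3 * h \<omega>) \<le> norm (v \<omega> * X i \<omega> * (v \<omega> * X i \<omega>) * (v \<omega> * X i \<omega>) * 1)"
        by (simp add: abs_mult power3_eq_cube)
    qed
  qed
  define r where "r i k \<omega> = (v \<omega> * \<bar>X i \<omega>\<bar>) ^ 3 * hit_ramps A B a b c d i k \<omega>" for i k \<omega>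
  have r: "integrable M (r i k)" "expectation (r i k) \<le> 2 * R i k" if "i \<in> K A" "k \<in> K A" for i k
  proof -
    have B': "B \<union> Nb i \<union> nb k \<subseteq> I" using B Nb_subset nb[OF K_I[OF that(2)]] by auto
    note H = cube_int[OF that(1) hit_measurable[OF B'] hit_bounds]
    have eq: "r i k = (\<lambda>\<omega>. (v \<omega> * \<bar>X i \<omega>\<bar>) ^ 3 * hit (insert i A) (B \<union> Nb i \<union> nb k) b (b + d) (6 * c) \<omega>
       + (v \<omega> * \<bar>X i \<omega>\<bar>) ^ 3 * hit (insert i A) (B \<union> Nb i \<union> nb k) (a - d) a (6 * c) \<omega>)"
      by (rule ext) (simp add: r_def hit_ramps_def distrib_left)
    show "integrable M (r i k)" unfolding eq by (intro Bochner_Integration.integrable_add H)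
    show "expectation (r i k) \<le> 2 * R i k"
      unfolding eq Bochner_Integration.integral_add[OF H H] using R(1)[OF that] R(2)[OF that] by linarith
  qed
  define f where "f k \<omega> = v \<omega> ^ 3 * blind_ramp A B a b c d k \<omega>" for k \<omega>
  have zero: "integrable M (\<lambda>\<omega>. X k \<omega> * f k \<omega>)" "expectation (\<lambda>\<omega>. X k \<omega> * f k \<omega>) = 0" if k: "k \<in> K A" for k
  proof -
    have kI: "k \<in> I" by (rule K_I[OF k])
    have [measurable]: "v \<in> borel_measurable (gen (I - nb k))" by (rule gen_mono[OF v(1) K_disjoint[OF k A(1)]])
    note [measurable] = blind_ramp_measurable[OF A(1) B k]
    have fm: "f k \<in> borel_measurable (gen (I - nb k))" unfolding f_def[abs_def] by measurable
    then have fM: "f k \<in> borel_measurable M" by (rule gen_measurable) auto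
    have fi: "integrable M (f k)"
    proof (rule Bochner_Integration.integrable_bound)
      show "integrable M (\<lambda>\<omega>. ((b - a) / 2 + d) * v \<omega> ^ 3 + 2 * c * (\<Sum>m\<in>I. \<bar>v \<omega> * v \<omega> * v \<omega> * X m \<omega>\<bar>))"
        using v3 L4_bound_mult4(1)[OF v(2) v(2) v(2) L4_X]
        by (intro Bochner_Integration.integrable_add integrable_mult_right Bochner_Integration.integrable_sum integrable_abs) auto
      show "f k \<in> borel_measurable M" by (rule fM)
      show "AE \<omega> in M. norm (f k \<omega>) \<le> norm (((b - a) / 2 + d) * v \<omega> ^ 3 + 2 * c * (\<Sum>m\<in>I. \<bar>v \<omega> * v \<omega> * v \<omega> * X m \<omega>\<bar>))"
      proof (rule AE_I2)
        fix \<omega> assume "\<omega> \<in> space M"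
        then have v0': "0 \<le> v \<omega>" by (rule v0)
        have "norm (f k \<omega>) = v \<omega> ^ 3 * \<bar>blind_ramp A B a b c d k \<omega>\<bar>" using v0' by (simp add: f_def abs_mult)
        also have "\<dots> \<le> v \<omega> ^ 3 * ((b - a) / 2 + d + 2 * c * (\<Sum>m\<in>I. \<bar>X m \<omega>\<bar>))"
          using v0' by (intro mult_left_mono abs_blind_ramp_le[OF B ab c d]) auto
        also have "\<dots> = ((b - a) / 2 + d) * v \<omega> ^ 3 + 2 * c * (\<Sum>m\<in>I. \<bar>v \<omega> * v \<omega> * v \<omega> * X m \<omega>\<bar>)"
        proof -
          have "\<bar>v \<omega> * v \<omega> * v \<omega> * X m \<omega>\<bar> = v \<omega> ^ 3 * \<bar>X m \<omega>\<bar>" for m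
            using v0' by (simp add: abs_mult power3_eq_cube)
          then show ?thesis by (simp add: distrib_left sum_distrib_left ac_simps)
        qed
        finally show "norm (f k \<omega>) \<le> norm (((b - a) / 2 + d) * v \<omega> ^ 3 + 2 * c * (\<Sum>m\<in>I. \<bar>v \<omega> * v \<omega> * v \<omega> * X m \<omega>\<bar>))"
          unfolding real_norm_def by (rule order_trans[OF _ abs_ge_self])
      qed
    qed
    have iv: "indep_var borel (X k) borel (f k)"
      using X_measurable_gen[of k "{k}"] by (intro indep1_gen[OF kI order_refl _ fm]) auto
    show "integrable M (\<lambda>\<omega>. X k \<omega> * f k \<omega>)" "expectation (\<lambda>\<omega>. X k \<omega> * f k \<omega>) = 0"
      using indep_var_integrable[OF iv integrable_X[OF kI] fi] indep_var_lebesgue_integral[OF iv integrable_X[OF kI] fi] mean_zero[OF kI] by auto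
  qed
  let ?G = "\<lambda>\<omega>. - (\<Sum>k\<in>K A. X k \<omega> * f k \<omega>) + ((b - a) / 2 + d) * ?g1 \<omega> + c * (\<Sum>m\<in>B. ?g2 m \<omega>) + c * ?g3 \<omega> + 2 * ?g4 \<omega>
     + 4 / d * \<kappa> * (\<Sum>j\<in>pairs A. (r (fst j) (fst j) \<omega> + 2 * r (snd j) (fst j) \<omega>) / 3)
     + (8 * \<kappa>\<^sup>2 * (\<Sum>k\<in>K A. ?g5 k \<omega> + ?g6 k \<omega>) + c * (\<Sum>m\<in>B. ?g7 m \<omega>) + c * ?g8 \<omega> + c * ?g9 \<omega>)"
  have point: "69 / 100 * (v \<omega> ^ 3 * hit A B a b c \<omega>) \<le> ?G \<omega>" if "\<omega> \<in> space M" for \<omega>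
  proof -
    have v0': "0 \<le> v \<omega>" using v0 that .
    then have av: "\<bar>v \<omega>\<bar> = v \<omega>" by simp
    have aT: "\<bar>?T \<omega>\<bar> = ?T \<omega>" and aZ: "\<bar>Zstar A \<omega>\<bar> = Zstar A \<omega>" using Tsq_nonneg Zstar_nonneg by auto
    let ?P = "- (\<Sum>k\<in>K A. X k \<omega> * blind_ramp A B a b c d k \<omega>)
      + \<bar>S A \<omega>\<bar> * ((b - a) / 2 + d + width A B c \<omega>) + 2 * \<bar>U A \<omega> - mean_U A\<bar>
      + 4 / d * \<kappa> * (\<Sum>j\<in>pairs A. (\<bar>X (fst j) \<omega>\<bar> ^ 3 * hit_ramps A B a b c d (fst j) (fst j) \<omega>
          + 2 * (\<bar>X (snd j) \<omega>\<bar> ^ 3 * hit_ramps A B a b c d (snd j) (fst j) \<omega>)) / 3)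
      + err A B c \<omega>"
    let ?v = "v \<omega> ^ 3"
    have e1: "?g1 \<omega> = ?v * \<bar>S A \<omega>\<bar>" and e2: "?g2 m \<omega> = ?v * (\<bar>S A \<omega>\<bar> * \<bar>X m \<omega>\<bar>)"
      and e3: "?g3 \<omega> = ?v * (\<bar>S A \<omega>\<bar> * (\<bar>S A \<omega>\<bar> * ?T \<omega>))"
      and e5: "?g5 k \<omega> = ?v * (\<bar>X k \<omega>\<bar> ^ 3 * \<bar>S A \<omega>\<bar>)" and e6: "?g6 k \<omega> = ?v * (\<bar>X k \<omega>\<bar> ^ 3 * Zstar A \<omega>)"
      and e7: "?g7 m \<omega> = ?v * (\<bar>X m \<omega>\<bar> * Zstar A \<omega>)" and e9: "?g9 \<omega> = ?v * (\<bar>S A \<omega>\<bar> * (?T \<omega> * Zstar A \<omega>))" for m k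
      by (simp_all only: abs_mult av aT aZ power3_eq_cube abs_one mult_1_right ac_simps)
    have e4: "?g4 \<omega> = ?v * \<bar>U A \<omega> - mean_U A\<bar>"
    proof -
      have "?sd \<omega> * ?sd \<omega> = (v \<omega>)\<^sup>2 * \<bar>U A \<omega> - mean_U A\<bar>" by (simp add: abs_mult)
      then have "?g4 \<omega> = \<bar>(v \<omega>)\<^sup>2 * \<bar>U A \<omega> - mean_U A\<bar> * v \<omega> * 1\<bar>" by (simp only:)
      then show ?thesis using v0' by (simp add: abs_mult power2_eq_square power3_eq_cube)
    qed
    have e8: "?g8 \<omega> = ?v * (?T \<omega> * absU A \<omega>)"
    proof -
      have "?su \<omega> * ?su \<omega> = (v \<omega>)\<^sup>2 * absU A \<omega>" using absU0[of \<omega>] by (simp add: abs_mult)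
      then have "?g8 \<omega> = \<bar>(v \<omega>)\<^sup>2 * absU A \<omega> * v \<omega> * ?T \<omega>\<bar>" by (simp only:)
      then show ?thesis using v0' absU0[of \<omega>] Tsq_nonneg[of A \<omega>] by (simp add: abs_mult power2_eq_square power3_eq_cube)
    qed
    have er: "r i k \<omega> = ?v * (\<bar>X i \<omega>\<bar> ^ 3 * hit_ramps A B a b c d i k \<omega>)" for i k
      by (simp add: r_def power_mult_distrib)
    have W: "\<bar>S A \<omega>\<bar> * width A B c \<omega> \<le> c * (\<Sum>m\<in>B. \<bar>S A \<omega>\<bar> * \<bar>X m \<omega>\<bar>) + c * (\<bar>S A \<omega>\<bar> * (\<bar>S A \<omega>\<bar> * ?T \<omega>))"
    proof -
      have "\<bar>S A \<omega>\<bar> * width A B c \<omega> = c * (\<Sum>m\<in>B. \<bar>S A \<omega>\<bar> * \<bar>X m \<omega>\<bar>) + c * (\<bar>S A \<omega>\<bar> * (\<bar>S A \<omega>\<bar> * Q A \<omega>))"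
        unfolding width_def by (simp only: distrib_left sum_distrib_left ac_simps)
      also have "\<dots> \<le> c * (\<Sum>m\<in>B. \<bar>S A \<omega>\<bar> * \<bar>X m \<omega>\<bar>) + c * (\<bar>S A \<omega>\<bar> * (\<bar>S A \<omega>\<bar> * ?T \<omega>))"
        using c Q_bounds(3) by (intro add_left_mono mult_left_mono) auto
      finally show ?thesis .
    qed
    have "69 / 100 * (?v * hit A B a b c \<omega>) = ?v * (69 / 100 * hit A B a b c \<omega>)" by simp
    also have "\<dots> \<le> ?v * ?P"
      using v0' by (intro mult_left_mono pointwise_concentration[OF B ab c d sm(5)]) auto
    also have "\<dots> \<le> ?v * (- (\<Sum>k\<in>K A. X k \<omega> * blind_ramp A B a b c d k \<omega>)
      + (((b - a) / 2 + d) * \<bar>S A \<omega>\<bar> + c * (\<Sum>m\<in>B. \<bar>S A \<omega>\<bar> * \<bar>X m \<omega>\<bar>) + c * (\<bar>S A \<omega>\<bar> * (\<bar>S A \<omega>\<bar> * ?T \<omega>))) + 2 * \<bar>U A \<omega> - mean_U A\<bar>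
      + 4 / d * \<kappa> * (\<Sum>j\<in>pairs A. (\<bar>X (fst j) \<omega>\<bar> ^ 3 * hit_ramps A B a b c d (fst j) (fst j) \<omega>
          + 2 * (\<bar>X (snd j) \<omega>\<bar> ^ 3 * hit_ramps A B a b c d (snd j) (fst j) \<omega>)) / 3)
      + err A B c \<omega>)"
      using v0' W by (intro mult_left_mono add_right_mono add_left_mono) (auto simp: distrib_left mult.commute)
    also have "\<dots> = ?G \<omega>"
    proof -
      have s1: "?v * (\<Sum>k\<in>K A. X k \<omega> * blind_ramp A B a b c d k \<omega>) = (\<Sum>k\<in>K A. X k \<omega> * f k \<omega>)"
        by (simp only: f_def sum_distrib_left ac_simps)
      have s2: "?v * (\<Sum>m\<in>B. \<bar>S A \<omega>\<bar> * \<bar>X m \<omega>\<bar>) = (\<Sum>m\<in>B. ?g2 m \<omega>)" unfolding e2 by (rule sum_distrib_left)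
      have s3: "?v * (\<Sum>j\<in>pairs A. (\<bar>X (fst j) \<omega>\<bar> ^ 3 * hit_ramps A B a b c d (fst j) (fst j) \<omega>
          + 2 * (\<bar>X (snd j) \<omega>\<bar> ^ 3 * hit_ramps A B a b c d (snd j) (fst j) \<omega>)) / 3)
        = (\<Sum>j\<in>pairs A. (r (fst j) (fst j) \<omega> + 2 * r (snd j) (fst j) \<omega>) / 3)"
        unfolding er sum_distrib_left by (intro sum.cong refl) (simp add: algebra_simps)
      have s4: "?v * err A B c \<omega> = 8 * \<kappa>\<^sup>2 * (\<Sum>k\<in>K A. ?g5 k \<omega> + ?g6 k \<omega>) + c * (\<Sum>m\<in>B. ?g7 m \<omega>) + c * ?g8 \<omega> + c * ?g9 \<omega>"
      proof -
        have "?v * ((\<bar>S A \<omega>\<bar> + Zstar A \<omega>) * cubes A \<omega>) = \<kappa>\<^sup>2 * (\<Sum>k\<in>K A. ?g5 k \<omega> + ?g6 k \<omega>)"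
          unfolding e5 e6 cubes_def sum_distrib_left by (intro sum.cong refl) (simp add: algebra_simps)
        moreover have "?v * (\<Sum>m\<in>B. \<bar>X m \<omega>\<bar> * Zstar A \<omega>) = (\<Sum>m\<in>B. ?g7 m \<omega>)" unfolding e7 by (rule sum_distrib_left)
        moreover have "?v * err A B c \<omega> = 8 * (?v * ((\<bar>S A \<omega>\<bar> + Zstar A \<omega>) * cubes A \<omega>)) + c * (?v * (\<Sum>m\<in>B. \<bar>X m \<omega>\<bar> * Zstar A \<omega>)) + c * ?g8 \<omega> + c * ?g9 \<omega>"
          unfolding err_def e8 e9 by (simp only: distrib_left mult.left_commute)
        ultimately show ?thesis by (simp only: mult.assoc)
      qed
      have "?v * (- p + (q * s + c * m + c * w) + 2 * u + e * z + y) = - (?v * p) + q * (?v * s) + c * (?v * m) + c * (?v * w) + 2 * (?v * u) + e * (?v * z) + ?v * y"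
        for p q s m w u e z y :: real by (simp add: algebra_simps)
      then show ?thesis unfolding e1 e3 e4 by (simp only: s1 s2 s3 s4)
    qed
    finally show ?thesis .
  qed
  have pK: "fst j \<in> K A" "snd j \<in> K A" if "j \<in> pairs A" for j using that by (auto simp: pairs_iff)
  note ints = zero(1) B1(1)[THEN integrable_abs] B2(1)[THEN integrable_abs] B3(1)[THEN integrable_abs] B4(1)[THEN integrable_abs]
    r(1)[OF pK(1) pK(1)] r(1)[OF pK(2) pK(1)] B5(1) B6(1) B7(1)[THEN integrable_abs] B8(1)[THEN integrable_abs] B9(1)[THEN integrable_abs]
  have "69 / 100 * expectation (\<lambda>\<omega>. v \<omega> ^ 3 * hit A B a b c \<omega>) = expectation (\<lambda>\<omega>. 69 / 100 * (v \<omega> ^ 3 * hit A B a b c \<omega>))" by simp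
  also have "\<dots> \<le> expectation ?G"
  proof (rule integral_mono[OF _ _ point])
    have "integrable M (\<lambda>\<omega>. v \<omega> ^ 3 * hit A B a b c \<omega>)"
    proof (rule Bochner_Integration.integrable_bound[OF v3])
      show "(\<lambda>\<omega>. v \<omega> ^ 3 * hit A B a b c \<omega>) \<in> borel_measurable M" using hit_measurable[OF B] by measurable
      show "AE \<omega> in M. norm (v \<omega> ^ 3 * hit A B a b c \<omega>) \<le> norm (v \<omega> ^ 3)"
        using hit_bounds by (intro AE_I2) (simp add: abs_mult mult_left_le)
    qed
    then show "integrable M (\<lambda>\<omega>. 69 / 100 * (v \<omega> ^ 3 * hit A B a b c \<omega>))" by simp
    show "integrable M ?G"
      by (intro Bochner_Integration.integrable_add Bochner_Integration.integrable_minus integrable_mult_right Bochner_Integration.integrable_sum integrable_divide_zero ints; assumption)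
  qed
  also have "\<dots> = - (\<Sum>k\<in>K A. expectation (\<lambda>\<omega>. X k \<omega> * f k \<omega>)) + ((b - a) / 2 + d) * expectation ?g1 + c * (\<Sum>m\<in>B. expectation (?g2 m)) + c * expectation ?g3 + 2 * expectation ?g4
     + 4 / d * \<kappa> * (\<Sum>j\<in>pairs A. (expectation (r (fst j) (fst j)) + 2 * expectation (r (snd j) (fst j))) / 3)
     + (8 * \<kappa>\<^sup>2 * (\<Sum>k\<in>K A. expectation (?g5 k) + expectation (?g6 k)) + c * (\<Sum>m\<in>B. expectation (?g7 m)) + c * expectation ?g8 + c * expectation ?g9)"
    using ints by (simp del: abs_mult add: Bochner_Integration.integral_sum)
  also have "\<dots> \<le> 0 + ((b - a) / 2 + d) * (\<rho> * \<rho> * (2 * \<rho>) * 1) + c * (\<Sum>m\<in>B. \<rho> * \<rho> * (2 * \<rho>) * x m) + c * (2 * \<rho> * (2 * \<rho>) * \<rho> * t)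
     + 2 * (sqrt (\<rho>\<^sup>2 * sqrt (12 * var_scale A)) * sqrt (\<rho>\<^sup>2 * sqrt (12 * var_scale A)) * \<rho> * 1)
     + 4 / d * \<kappa> * (\<Sum>j\<in>pairs A. (2 * R (fst j) (fst j) + 2 * (2 * R (snd j) (fst j))) / 3)
     + (8 * \<kappa>\<^sup>2 * (\<Sum>k\<in>K A. \<rho> * x k * (\<rho> * x k) * (\<rho> * x k) * 2 + \<rho> * x k * (\<rho> * x k) * (\<rho> * x k) * 1) + c * (\<Sum>m\<in>B. \<rho> * \<rho> * \<rho> * x m)
     + c * (sqrt (\<rho>\<^sup>2 * (1.1 * lam)) * sqrt (\<rho>\<^sup>2 * (1.1 * lam)) * \<rho> * t) + c * (2 * \<rho> * \<rho> * \<rho> * t))"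
  proof (intro add_mono mult_left_mono sum_mono divide_right_mono)
    show "- (\<Sum>k\<in>K A. expectation (\<lambda>\<omega>. X k \<omega> * f k \<omega>)) \<le> 0" using zero(2) by (simp add: sum_nonneg)
    show "0 \<le> (b - a) / 2 + d" "0 \<le> c" "0 \<le> c" "0 \<le> c" "0 \<le> c" "0 \<le> c" "0 \<le> 4 / d * \<kappa>" "0 \<le> 8 * \<kappa>\<^sup>2"
      using ab c d kappa_pos by simp_all
  qed ((rule B1(2) B3(2) B4(2) B8(2) B9(2))
      | (rule B2(2) B7(2) B5(2) B6(2), assumption)
      | (rule r(2), (rule pK, assumption)+)
      | (simp only: zero_le_numeral))+
  also have "\<dots> = \<rho> ^ 3 * ((b - a) + 2 * d) + \<rho> ^ 3 * (3 * (c * (\<Sum>m\<in>B. x m)) + 6 * (c * t) + 2 * sqrt (12 * var_scale A) + 24 * (\<kappa>\<^sup>2 * (\<Sum>k\<in>K A. x k ^ 3)) + 1.1 * (c * (lam * t)))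
     + 4 / d * \<kappa> * (\<Sum>j\<in>pairs A. (2 * R (fst j) (fst j) + 4 * R (snd j) (fst j)) / 3)"
  proof -
    have sq: "sqrt y * sqrt y * z = y * z" if "0 \<le> y" for y z :: real using that by simp
    have n: "0 \<le> \<rho>\<^sup>2 * sqrt (12 * var_scale A)" "0 \<le> \<rho>\<^sup>2 * (1.1 * lam)" using kappa3_le_var_scale(2)[OF A] lam_ge_1 by auto
    have s1: "(\<Sum>m\<in>B. \<rho> * \<rho> * (2 * \<rho>) * x m) = 2 * \<rho> ^ 3 * (\<Sum>m\<in>B. x m)" "(\<Sum>m\<in>B. \<rho> * \<rho> * \<rho> * x m) = \<rho> ^ 3 * (\<Sum>m\<in>B. x m)"
      "(\<Sum>k\<in>K A. \<rho> * x k * (\<rho> * x k) * (\<rho> * x k) * 2 + \<rho> * x k * (\<rho> * x k) * (\<rho> * x k) * 1) = 3 * \<rho> ^ 3 * (\<Sum>k\<in>K A. x k ^ 3)"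
      unfolding sum_distrib_left by (intro sum.cong refl; simp add: power3_eq_cube)+
    show ?thesis unfolding sq[OF n(1)] sq[OF n(2)] s1
      by (simp add: power2_eq_square power3_eq_cube field_simps)
  qed
  also have "\<dots> \<le> \<rho> ^ 3 * ((b - a) + 2 * d) + \<rho> ^ 3 * (24 * Delta A B c)
     + 4 / d * \<kappa> * (\<Sum>j\<in>pairs A. (2 * R (fst j) (fst j) + 4 * R (snd j) (fst j)) / 3)"
  proof (rule add_right_mono, rule add_left_mono, rule mult_left_mono)
    note p = Delta_parts_nonneg(1)[OF A, of B] Delta_parts_nonneg(2-4)[OF A]
    have sq2: "sqrt 2 \<le> 1.42" by (rule real_le_lsqrt) (auto simp: power2_eq_square)
    have sq12: "sqrt 12 \<le> 3.5" by (rule real_le_lsqrt) (auto simp: power2_eq_square)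
    have cl: "z \<le> c * z" "z \<le> lam * z" if "0 \<le> z" for z using that c lam_ge_1 mult_right_mono[of 1 c z] mult_right_mono[of 1 lam z] by auto
    have t0: "0 \<le> t" "t \<le> 1.42 * sqrt (Dsum A)" unfolding t_def using mult_right_mono[OF sq2, of "sqrt (Dsum A)"] Dsum_nonneg[of A] by (simp_all only: mult_nonneg_nonneg real_sqrt_ge_zero zero_le_numeral)
    have lt: "lam * t \<le> 1.42 * (lam * sqrt (Dsum A))" using mult_left_mono[OF t0(2), of lam] lam_ge_1 by simp
    have "6 * (c * t) + 1.1 * (c * (lam * t)) \<le> 24 * (c * (lam * sqrt (Dsum A)))"
    proof -
      have "c * t \<le> c * (lam * t)" using cl(2)[OF t0(1)] c by (intro mult_left_mono) auto
      moreover have "c * (lam * t) \<le> c * (1.42 * (lam * sqrt (Dsum A)))" using lt c by (intro mult_left_mono) auto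
      moreover have "0 \<le> c * (lam * sqrt (Dsum A))" using p c by simp
      ultimately show ?thesis by simp
    qed
    moreover have "2 * sqrt (12 * var_scale A) \<le> 24 * (c * (lam * sqrt (var_scale A)))"
    proof -
      have v0: "0 \<le> sqrt (var_scale A)" using kappa3_le_var_scale(2)[OF A] by simp
      have "sqrt (12 * var_scale A) \<le> 3.5 * sqrt (var_scale A)" unfolding real_sqrt_mult using sq12 v0 by (intro mult_right_mono) auto
      moreover have "sqrt (var_scale A) \<le> c * (lam * sqrt (var_scale A))"
        using order_trans[OF cl(2)[OF v0] cl(1)[OF p(3)]] .
      ultimately show ?thesis using v0 by linarith
    qed
    moreover have "24 * (\<kappa>\<^sup>2 * (\<Sum>k\<in>K A. x k ^ 3)) \<le> 24 * (c * (\<kappa>\<^sup>2 * sum_x3))"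
    proof -
      have "\<kappa>\<^sup>2 * (\<Sum>k\<in>K A. x k ^ 3) \<le> \<kappa>\<^sup>2 * sum_x3" by (intro mult_left_mono sum_K_x_le) auto
      then show ?thesis using cl(1)[OF p(2)] by linarith
    qed
    moreover have "0 \<le> c * (\<Sum>m\<in>B. x m)" using p c by simp
    ultimately show "3 * (c * (\<Sum>m\<in>B. x m)) + 6 * (c * t) + 2 * sqrt (12 * var_scale A) + 24 * (\<kappa>\<^sup>2 * (\<Sum>k\<in>K A. x k ^ 3)) + 1.1 * (c * (lam * t)) \<le> 24 * Delta A B c"
      unfolding Delta_def by (simp add: distrib_left)
  qed (use \<rho>0 in auto)
  finally show ?thesis by (simp add: distrib_left)
qed

end

section \<open>Iteration of the concentration inequality\<close>

context local_dependence
begin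

text \<open>
  The claim with constant \<open>C\<close>, for all index sets, weights, intervals and \<open>c\<close> simultaneously. This
  uniformity is needed because the induction changes each of them.
\<close>

definition concentration :: "real \<Rightarrow> bool" where
  "concentration C \<longleftrightarrow> (\<forall>A B v \<rho> a b c. A \<subseteq> I \<longrightarrow> A \<noteq> {} \<longrightarrow> B \<subseteq> I \<longrightarrow> v \<in> borel_measurable (gen A) \<longrightarrow>
     L4_bound M v \<rho> \<longrightarrow> (\<forall>\<omega>\<in>space M. 0 \<le> v \<omega>) \<longrightarrow> a \<le> b \<longrightarrow> 1 \<le> c \<longrightarrow>
     expectation (\<lambda>\<omega>. v \<omega> ^ 3 * hit A B a b c \<omega>) \<le> \<rho> ^ 3 * (2 * (b - a) + C * Delta A B c))"

lemma concentrationD: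
  "concentration C \<Longrightarrow> A \<subseteq> I \<Longrightarrow> A \<noteq> {} \<Longrightarrow> B \<subseteq> I \<Longrightarrow> v \<in> borel_measurable (gen A) \<Longrightarrow>
     L4_bound M v \<rho> \<Longrightarrow> (\<And>\<omega>. \<omega> \<in> space M \<Longrightarrow> 0 \<le> v \<omega>) \<Longrightarrow> a \<le> b \<Longrightarrow> 1 \<le> c \<Longrightarrow>
     expectation (\<lambda>\<omega>. v \<omega> ^ 3 * hit A B a b c \<omega>) \<le> \<rho> ^ 3 * (2 * (b - a) + C * Delta A B c)"
  unfolding concentration_def by blast

lemma sum_x3_pos: "0 < sum_x3"
proof (rule ccontr)
  assume "\<not> 0 < sum_x3"
  then have "sum_x3 = 0" using sum_x3_nonneg by linarith
  then have x0: "x i = 0" if "i \<in> I" for i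
    using that unfolding sum_x3_def by (subst (asm) sum_nonneg_eq_0_iff) auto
  have "expectation (\<lambda>\<omega>. (X i \<omega>)\<^sup>2) \<le> 0" if "i \<in> I" for i
    using expectation_abs_XX_le[OF that that] x0[OF that] by (simp add: power2_eq_square)
  then have "lam \<le> 0" unfolding lam_def using kappa_pos by (intro mult_nonneg_nonpos sum_nonpos) auto
  then show False using lam_ge_1 by simp
qed

lemma Delta_ge:
  assumes "A \<subseteq> I" "A \<noteq> {}" "1 \<le> c"
  shows "\<kappa>\<^sup>2 * sum_x3 \<le> Delta A B c" "c * (lam * sqrt (var_scale A)) \<le> Delta A B c"
    "(\<Sum>m\<in>B. x m) + \<kappa>\<^sup>2 * sum_x3 + lam * (2 * sqrt (var_scale A)) + lam * sqrt (Dsum A) \<le> 2 * (Delta A B c / c)"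
proof -
  note p = Delta_parts_nonneg(1)[OF assms(1,2), of B] Delta_parts_nonneg(2-4)[OF assms(1,2)]
  have "1 * (\<kappa>\<^sup>2 * sum_x3) \<le> c * (\<kappa>\<^sup>2 * sum_x3)" using assms(3) p by (intro mult_right_mono) auto
  also have "\<dots> \<le> Delta A B c" unfolding Delta_def using assms(3) p by (intro mult_left_mono) linarith+
  finally show "\<kappa>\<^sup>2 * sum_x3 \<le> Delta A B c" by simp
  show "c * (lam * sqrt (var_scale A)) \<le> Delta A B c" unfolding Delta_def using assms(3) p by (intro mult_left_mono) linarith+
  have "Delta A B c / c = (\<Sum>m\<in>B. x m) + \<kappa>\<^sup>2 * sum_x3 + lam * sqrt (var_scale A) + lam * sqrt (Dsum A)"
    using assms(3) by (simp add: Delta_def)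
  then show "(\<Sum>m\<in>B. x m) + \<kappa>\<^sup>2 * sum_x3 + lam * (2 * sqrt (var_scale A)) + lam * sqrt (Dsum A) \<le> 2 * (Delta A B c / c)"
    using p by linarith
qed

lemma expectation_hit_le:
  assumes A: "A \<subseteq> I" "A \<noteq> {}" and B: "B \<subseteq> I"
    and v: "v \<in> borel_measurable (gen A)" "L4_bound M v \<rho>" and v0: "\<And>\<omega>. \<omega> \<in> space M \<Longrightarrow> 0 \<le> v \<omega>"
  shows "expectation (\<lambda>\<omega>. v \<omega> ^ 3 * hit A B a b c \<omega>) \<le> \<rho> ^ 3"
proof -
  note L = L4_bound_mult4[OF v(2) v(2) v(2) L4_1]
  have "expectation (\<lambda>\<omega>. v \<omega> ^ 3 * hit A B a b c \<omega>) \<le> expectation (\<lambda>\<omega>. \<bar>v \<omega> * v \<omega> * v \<omega> * 1\<bar>)"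
  proof (rule integral_mono')
    show "integrable M (\<lambda>\<omega>. \<bar>v \<omega> * v \<omega> * v \<omega> * 1\<bar>)" using L(1) by (rule integrable_abs)
    fix \<omega> assume "\<omega> \<in> space M"
    then have "0 \<le> v \<omega>" by (rule v0)
    then show "v \<omega> ^ 3 * hit A B a b c \<omega> \<le> \<bar>v \<omega> * v \<omega> * v \<omega> * 1\<bar>"
      using mult_left_le[OF hit_bounds(2), of "v \<omega> ^ 3"] by (simp add: power3_eq_cube)
  qed simp
  also have "\<dots> \<le> \<rho> ^ 3" using L(2) by (simp add: power3_eq_cube)
  finally show ?thesis .
qed

text \<open>
  \<open>Delta\<close> is bounded below by a positive number that does not depend on the index sets.
\<close>

lemma concentration_trivial: "concentration (1 / (\<kappa>\<^sup>2 * sum_x3))"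
  unfolding concentration_def
proof (intro allI impI)
  fix A B v \<rho> and a b c :: real
  assume A: "A \<subseteq> I" "A \<noteq> {}" and B: "B \<subseteq> I" and v: "v \<in> borel_measurable (gen A)" "L4_bound M v \<rho>"
    and v0: "\<forall>\<omega>\<in>space M. 0 \<le> v \<omega>" and ab: "a \<le> b" and c: "1 \<le> c"
  have p: "0 < \<kappa>\<^sup>2 * sum_x3" using kappa_pos sum_x3_pos by simp
  have "1 = 1 / (\<kappa>\<^sup>2 * sum_x3) * (\<kappa>\<^sup>2 * sum_x3)" using kappa_pos sum_x3_pos by simp
  also have "\<dots> \<le> 1 / (\<kappa>\<^sup>2 * sum_x3) * Delta A B c" using p Delta_ge(1)[OF A c] by (intro mult_left_mono) auto
  finally have "1 \<le> 2 * (b - a) + 1 / (\<kappa>\<^sup>2 * sum_x3) * Delta A B c"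
    using ab by (intro add_increasing) auto
  then have "\<rho> ^ 3 * 1 \<le> \<rho> ^ 3 * (2 * (b - a) + 1 / (\<kappa>\<^sup>2 * sum_x3) * Delta A B c)"
    using rho_nonneg[OF A v] by (intro mult_left_mono) auto
  then show "expectation (\<lambda>\<omega>. v \<omega> ^ 3 * hit A B a b c \<omega>) \<le> \<rho> ^ 3 * (2 * (b - a) + 1 / (\<kappa>\<^sup>2 * sum_x3) * Delta A B c)"
    using expectation_hit_le[OF A B v, of a b c] v0 by force
qed

text \<open>
  What inserting \<open>i\<close> into \<open>A\<close> adds to \<open>Delta\<close>, apart from the terms that are already there.
\<close>

definition index_error :: "nat \<Rightarrow> real" where
  "index_error i = (\<Sum>m\<in>Nb i. x m) + lam * sqrt (Dsum {i})"

lemma NA_singleton: "NA {i} = Nb i" by (auto simp: N_set_def N_idx_def)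

text \<open>
  \<open>Dsum {i}\<close> has at most \<open>2 \<kappa>\<^sup>2\<close> summands, and every index occurs in boundedly many of them.
\<close>

lemma sum_Dsum_singleton_sq: "(\<Sum>i\<in>I. (Dsum {i})\<^sup>2) \<le> 4 * \<kappa> ^ 4 * sum_x4"
proof -
  let ?g = "\<lambda>p. (\<Sum>q\<in>Nb p. x p ^ 4 + x q ^ 4) + (\<Sum>q\<in>nb p. x p ^ 4 + x q ^ 4)"
  have one: "(Dsum {i})\<^sup>2 \<le> \<kappa>\<^sup>2 * (\<Sum>p\<in>Nb i. ?g p)" if i: "i \<in> I" for i
  proof -
    let ?P = "SIGMA p:Nb i. Nb p \<union> nb p"
    have fin: "finite (Nb p \<union> nb p)" if "p \<in> Nb i" for p using Nb_I[OF that] by simp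
    have D: "Dsum {i} = (\<Sum>j\<in>?P. x (fst j) * x (snd j))"
      unfolding Dsum_def NA_singleton using fin by (subst sum.Sigma) (auto simp: case_prod_beta)
    have card: "real (card ?P) \<le> 2 * \<kappa>\<^sup>2"
    proof -
      have "real (card ?P) = (\<Sum>p\<in>Nb i. real (card (Nb p \<union> nb p)))" using fin by (simp add: card_SigmaI)
      also have "\<dots> \<le> (\<Sum>p\<in>Nb i. 2 * \<kappa>)"
      proof (intro sum_mono)
        fix p assume "p \<in> Nb i"
        then have p: "p \<in> I" by (rule Nb_I)
        show "real (card (Nb p \<union> nb p)) \<le> 2 * \<kappa>"
          using card_Un_le[of "Nb p" "nb p"] card_N_idx[OF p] card_nb[OF p] by linarith
      qed
      also have "\<dots> = card (Nb i) * (2 * \<kappa>)" by simp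
      also have "\<dots> \<le> \<kappa> * (2 * \<kappa>)" using card_N_idx[OF i] kappa_pos by (intro mult_right_mono) auto
      finally show ?thesis by (simp add: power2_eq_square)
    qed
    have "(Dsum {i})\<^sup>2 \<le> (\<Sum>j\<in>?P. (x (fst j) * x (snd j))\<^sup>2) * card ?P"
      unfolding D by (rule sum_squared_le_sum_of_squares)
    also have "\<dots> \<le> (\<Sum>j\<in>?P. (x (fst j) ^ 4 + x (snd j) ^ 4) / 2) * (2 * \<kappa>\<^sup>2)"
    proof (intro mult_mono sum_mono card)
      fix j show "(x (fst j) * x (snd j))\<^sup>2 \<le> (x (fst j) ^ 4 + x (snd j) ^ 4) / 2"
        using sum_squares_bound[of "(x (fst j))\<^sup>2" "(x (snd j))\<^sup>2"] by (simp add: power_mult_distrib)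
    qed (auto intro!: sum_nonneg)
    also have "\<dots> = \<kappa>\<^sup>2 * (\<Sum>j\<in>?P. x (fst j) ^ 4 + x (snd j) ^ 4)" by (simp flip: sum_divide_distrib)
    also have "(\<Sum>j\<in>?P. x (fst j) ^ 4 + x (snd j) ^ 4) = (\<Sum>p\<in>Nb i. \<Sum>q\<in>Nb p \<union> nb p. x p ^ 4 + x q ^ 4)"
      using fin by (subst sum.Sigma) (auto simp: case_prod_beta)
    also have "\<dots> \<le> (\<Sum>p\<in>Nb i. ?g p)"
      using fin by (intro sum_mono) (subst sum_Un, auto intro!: sum_nonneg)
    finally show ?thesis by (simp add: mult_left_mono)
  qed
  have g0: "0 \<le> ?g p" for p by (auto intro!: add_nonneg_nonneg sum_nonneg)
  have g: "(\<Sum>p\<in>I. ?g p) \<le> 4 * (\<kappa> * sum_x4)"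
    unfolding sum.distrib sum_x4_def
    using sum_Nb_first[of "\<lambda>i. x i ^ 4"] sum_Nb_second[of "\<lambda>i. x i ^ 4"] sum_nb_first[of "\<lambda>i. x i ^ 4"] sum_nb_second[of "\<lambda>i. x i ^ 4"]
    by simp
  have "(\<Sum>i\<in>I. (Dsum {i})\<^sup>2) \<le> (\<Sum>i\<in>I. \<kappa>\<^sup>2 * (\<Sum>p\<in>Nb i. ?g p))" by (intro sum_mono one)
  also have "\<dots> = \<kappa>\<^sup>2 * (\<Sum>i\<in>I. \<Sum>p\<in>Nb i. ?g p)" by (simp only: sum_distrib_left)
  also have "\<dots> \<le> \<kappa>\<^sup>2 * (\<kappa> * (\<Sum>p\<in>I. ?g p))" by (intro mult_left_mono sum_Nb_second g0) auto
  also have "\<dots> \<le> \<kappa>\<^sup>2 * (\<kappa> * (4 * (\<kappa> * sum_x4)))" using g kappa_pos by (intro mult_left_mono) auto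
  finally show ?thesis by (simp add: power2_eq_square power4_eq_xxxx)
qed

lemma index_error_nonneg: "0 \<le> index_error i"
  unfolding index_error_def using lam_ge_1 Dsum_nonneg by (intro add_nonneg_nonneg sum_nonneg mult_nonneg_nonneg) auto

lemma sum_index_error: "(\<Sum>i\<in>I. x i ^ 3 * index_error i) \<le> 2.75 * (lam * (\<kappa> * sum_x4))"
proof -
  have "(\<Sum>i\<in>I. x i ^ 3 * (\<Sum>m\<in>Nb i. x m)) \<le> \<kappa> * sum_x4"
  proof -
    have "(\<Sum>i\<in>I. x i ^ 3 * (\<Sum>m\<in>Nb i. x m)) \<le> (\<Sum>i\<in>I. \<Sum>m\<in>Nb i. (3 * x i ^ 4 + x m ^ 4) / 4)"
      unfolding sum_distrib_left by (intro sum_mono cube_mult_le) auto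
    also have "\<dots> = (3 * (\<Sum>i\<in>I. \<Sum>m\<in>Nb i. x i ^ 4) + (\<Sum>i\<in>I. \<Sum>m\<in>Nb i. x m ^ 4)) / 4"
      unfolding sum_distrib_left sum.distrib[symmetric] sum_divide_distrib ..
    also have "\<dots> \<le> \<kappa> * sum_x4"
      unfolding sum_x4_def using sum_Nb_first[of "\<lambda>i. x i ^ 4"] sum_Nb_second[of "\<lambda>i. x i ^ 4"] by simp
    finally show ?thesis .
  qed
  moreover have "\<kappa> * sum_x4 \<le> lam * (\<kappa> * sum_x4)"
    using lam_ge_1 kappa_pos sum_x4_nonneg mult_right_mono[of 1 lam "\<kappa> * sum_x4"] by simp
  moreover have "(\<Sum>i\<in>I. x i ^ 3 * sqrt (Dsum {i})) \<le> 1.75 * (\<kappa> * sum_x4)"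
  proof -
    have "x i ^ 3 * sqrt (Dsum {i}) \<le> \<kappa> * ((3 * x i ^ 4 + (Dsum {i})\<^sup>2 / \<kappa> ^ 4) / 4)" for i
    proof -
      \<comment> \<open>Since \<open>Dsum {i}\<close> behaves like \<open>\<kappa>\<^sup>2\<close> times the square of a single norm, \<open>sqrt (Dsum {i}) / \<kappa>\<close>
        has the size of a single norm.\<close>
      have "x i ^ 3 * sqrt (Dsum {i}) = \<kappa> * (x i ^ 3 * (sqrt (Dsum {i}) / \<kappa>))" using kappa_pos by simp
      also have "\<dots> \<le> \<kappa> * ((3 * x i ^ 4 + (sqrt (Dsum {i}) / \<kappa>) ^ 4) / 4)"
        using kappa_pos Dsum_nonneg by (intro mult_left_mono cube_mult_le) auto
      also have "(sqrt (Dsum {i}) / \<kappa>) ^ 4 = (Dsum {i})\<^sup>2 / \<kappa> ^ 4"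
        using power_mult[of "sqrt (Dsum {i})" 2 2] Dsum_nonneg[of "{i}"] by (simp add: power_divide)
      finally show ?thesis .
    qed
    then have "(\<Sum>i\<in>I. x i ^ 3 * sqrt (Dsum {i})) \<le> (\<Sum>i\<in>I. \<kappa> * ((3 * x i ^ 4 + (Dsum {i})\<^sup>2 / \<kappa> ^ 4) / 4))"
      by (intro sum_mono)
    also have "\<dots> = \<kappa> * ((3 * sum_x4 + (\<Sum>i\<in>I. (Dsum {i})\<^sup>2) / \<kappa> ^ 4) / 4)"
      unfolding sum_x4_def sum_distrib_left sum_divide_distrib sum.distrib[symmetric] by simp
    also have "\<dots> \<le> \<kappa> * ((3 * sum_x4 + (4 * \<kappa> ^ 4 * sum_x4) / \<kappa> ^ 4) / 4)"
      using kappa_pos sum_Dsum_singleton_sq by (intro mult_left_mono divide_right_mono add_left_mono) auto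
    also have "\<dots> = 1.75 * (\<kappa> * sum_x4)" using kappa_pos by simp
    finally show ?thesis .
  qed
  then have "lam * (\<Sum>i\<in>I. x i ^ 3 * sqrt (Dsum {i})) \<le> lam * (1.75 * (\<kappa> * sum_x4))"
    using lam_ge_1 by (intro mult_left_mono) auto
  moreover have "(\<Sum>i\<in>I. x i ^ 3 * index_error i) = (\<Sum>i\<in>I. x i ^ 3 * (\<Sum>m\<in>Nb i. x m)) + lam * (\<Sum>i\<in>I. x i ^ 3 * sqrt (Dsum {i}))"
    unfolding index_error_def distrib_left sum.distrib by (simp add: sum_distrib_left ac_simps)
  ultimately show ?thesis by simp
qed

lemma sum_pairs_cube_nb:
  "(\<Sum>j\<in>pairs A. (x (fst j) ^ 3 + 2 * x (snd j) ^ 3) * (\<Sum>m\<in>nb (fst j). x m)) \<le> 3 * (\<kappa>\<^sup>2 * sum_x4)"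
proof -
  define g where "g k = (\<Sum>m\<in>nb k. x m ^ 4)" for k
  have g: "(\<Sum>k\<in>I. g k) \<le> \<kappa> * sum_x4" unfolding g_def sum_x4_def by (rule sum_nb_second) simp
  have *: "x i ^ 3 * (\<Sum>m\<in>nb k. x m) \<le> (3 * \<kappa> * x i ^ 4 + g k) / 4" if "k \<in> I" for i k
  proof -
    have "x i ^ 3 * (\<Sum>m\<in>nb k. x m) \<le> (\<Sum>m\<in>nb k. (3 * x i ^ 4 + x m ^ 4) / 4)"
      unfolding sum_distrib_left by (intro sum_mono cube_mult_le) auto
    also have "\<dots> = (card (nb k) * (3 * x i ^ 4) + g k) / 4"
      unfolding g_def by (simp add: sum.distrib flip: sum_divide_distrib)
    also have "\<dots> \<le> (\<kappa> * (3 * x i ^ 4) + g k) / 4"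
      using card_nb[OF that] by (intro divide_right_mono add_right_mono mult_right_mono) auto
    finally show ?thesis by (simp add: ac_simps)
  qed
  have "(\<Sum>j\<in>pairs A. (x (fst j) ^ 3 + 2 * x (snd j) ^ 3) * (\<Sum>m\<in>nb (fst j). x m))
     \<le> (\<Sum>j\<in>pairs A. (3 * \<kappa> * x (fst j) ^ 4 + g (fst j)) / 4 + 2 * ((3 * \<kappa> * x (snd j) ^ 4 + g (fst j)) / 4))"
  proof (intro sum_mono)
    fix j assume "j \<in> pairs A"
    then have k: "fst j \<in> I" by (auto simp: pairs_iff dest: K_I)
    show "(x (fst j) ^ 3 + 2 * x (snd j) ^ 3) * (\<Sum>m\<in>nb (fst j). x m) \<le> (3 * \<kappa> * x (fst j) ^ 4 + g (fst j)) / 4 + 2 * ((3 * \<kappa> * x (snd j) ^ 4 + g (fst j)) / 4)"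
      using *[OF k, of "fst j"] *[OF k, of "snd j"] by (simp only: distrib_right mult.assoc)
  qed
  also have "\<dots> = (3 * \<kappa> * (\<Sum>j\<in>pairs A. x (fst j) ^ 4) + 6 * \<kappa> * (\<Sum>j\<in>pairs A. x (snd j) ^ 4) + 3 * (\<Sum>j\<in>pairs A. g (fst j))) / 4"
    unfolding sum_distrib_left sum.distrib[symmetric] sum_divide_distrib by (intro sum.cong refl) (simp add: field_simps)
  also have "\<dots> \<le> (3 * \<kappa> * (\<kappa> * sum_x4) + 6 * \<kappa> * (\<kappa> * sum_x4) + 3 * (\<kappa> * (\<kappa> * sum_x4))) / 4"
  proof (intro divide_right_mono add_mono mult_left_mono)
    show "(\<Sum>j\<in>pairs A. x (fst j) ^ 4) \<le> \<kappa> * sum_x4" "(\<Sum>j\<in>pairs A. x (snd j) ^ 4) \<le> \<kappa> * sum_x4"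
      unfolding sum_x4_def by (rule sum_pairs_le; simp)+
    have "(\<Sum>j\<in>pairs A. g (fst j)) \<le> \<kappa> * (\<Sum>k\<in>I. g k)" by (rule sum_pairs_le) (simp add: g_def sum_nonneg)
    also have "\<dots> \<le> \<kappa> * (\<kappa> * sum_x4)" using g kappa_pos by (intro mult_left_mono) auto
    finally show "(\<Sum>j\<in>pairs A. g (fst j)) \<le> \<kappa> * (\<kappa> * sum_x4)" .
  qed (use kappa_pos in auto)
  finally show ?thesis by (simp add: power2_eq_square)
qed

lemma var_scale_insert:
  assumes "A \<subseteq> I" "A \<noteq> {}"
  shows "sqrt (var_scale (insert i A)) \<le> 2 * sqrt (var_scale A)"
proof -
  have t0: "0 \<le> \<tau>" using assms tau_nonneg by blast
  have fA: "finite A" using assms(1) by (rule finite_subset) simp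
  have "card (insert i A) \<le> card A + 1" using fA by (simp add: card_insert_if)
  moreover have "card A \<ge> 1" using fA assms(2) by (simp add: Suc_le_eq card_gt_0_iff)
  ultimately have "\<tau> * real (card (insert i A)) \<le> \<tau> * (4 * real (card A))" using t0 by (intro mult_left_mono) auto
  then have "var_scale (insert i A) \<le> \<kappa> * (4 * (\<kappa>\<^sup>2 + \<tau> * card A)) * sum_x4"
    unfolding var_scale_def using kappa_pos sum_x4_nonneg
    by (intro mult_right_mono mult_left_mono) (auto simp: distrib_left add_increasing)
  also have "\<dots> = 4 * var_scale A" by (simp add: var_scale_def algebra_simps)
  finally have "sqrt (var_scale (insert i A)) \<le> sqrt (4 * var_scale A)" by (rule real_sqrt_le_mono)
  also have "\<dots> = 2 * sqrt (var_scale A)" by (simp add: real_sqrt_mult)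
  finally show ?thesis .
qed

lemma Delta_insert_le:
  assumes A: "A \<subseteq> I" "A \<noteq> {}" and B: "B \<subseteq> I" and c: "1 \<le> c" and i: "i \<in> I" and k: "k \<in> I"
  shows "Delta (insert i A) (B \<union> Nb i \<union> nb k) (6 * c) \<le> 12 * Delta A B c + 6 * c * (index_error i + (\<Sum>m\<in>nb k. x m))"
proof -
  have fB: "finite B" using B by (rule finite_subset) simp
  have "(\<Sum>m\<in>B \<union> Nb i \<union> nb k. x m) \<le> (\<Sum>m\<in>B. x m) + (\<Sum>m\<in>Nb i. x m) + (\<Sum>m\<in>nb k. x m)"
  proof -
    have "(\<Sum>m\<in>J \<union> L. x m) \<le> (\<Sum>m\<in>J. x m) + (\<Sum>m\<in>L. x m)" if "finite J" "finite L" for J L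
      using that by (subst sum_Un) (auto intro: sum_nonneg)
    from this[of "B \<union> Nb i" "nb k"] this[of B "Nb i"] show ?thesis using fB finite_nb[OF k] by simp
  qed
  moreover have "lam * sqrt (var_scale (insert i A)) \<le> lam * (2 * sqrt (var_scale A))"
    using var_scale_insert[OF A] lam_ge_1 by (intro mult_left_mono) auto
  moreover have "lam * sqrt (Dsum (insert i A)) \<le> lam * (sqrt (Dsum A) + sqrt (Dsum {i}))"
    using Dsum_insert[OF i] lam_ge_1 by (intro mult_left_mono) auto
  ultimately have "(\<Sum>m\<in>B \<union> Nb i \<union> nb k. x m) + \<kappa>\<^sup>2 * sum_x3 + lam * sqrt (var_scale (insert i A)) + lam * sqrt (Dsum (insert i A))
     \<le> 2 * (Delta A B c / c) + (index_error i + (\<Sum>m\<in>nb k. x m))"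
    using Delta_ge(3)[OF A c, of B] unfolding index_error_def distrib_left by linarith
  then have "Delta (insert i A) (B \<union> Nb i \<union> nb k) (6 * c) \<le> 6 * c * (2 * (Delta A B c / c) + (index_error i + (\<Sum>m\<in>nb k. x m)))"
    unfolding Delta_def using c by (intro mult_left_mono) auto
  also have "\<dots> = 12 * Delta A B c + 6 * c * (index_error i + (\<Sum>m\<in>nb k. x m))"
    using c by (simp add: distrib_left)
  finally show ?thesis .
qed

text \<open>
  Averaged with the weights of the remainder term, the contributions of \<open>i\<close> and \<open>k\<close> to \<open>Delta\<close> sum to
  \<open>\<lambda> \<kappa>\<^sup>3 \<Sum> x\<^sup>4\<close>, that is, to at most the square of the third summand of \<open>Delta\<close>. The old part of
  \<open>Delta\<close> is multiplied by the second summand. So everything is quadratic in \<open>Delta\<close>, and the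
  division by \<open>d\<close>, a multiple of \<open>Delta\<close>, leaves a linear bound.
\<close>

lemma sum_Delta_insert:
  assumes A: "A \<subseteq> I" "A \<noteq> {}" and B: "B \<subseteq> I" and c: "1 \<le> c"
  shows "\<kappa> * (\<Sum>j\<in>pairs A. (x (fst j) ^ 3 * Delta (insert (fst j) A) (B \<union> Nb (fst j) \<union> nb (fst j)) (6 * c)
      + 2 * (x (snd j) ^ 3 * Delta (insert (snd j) A) (B \<union> Nb (snd j) \<union> nb (fst j)) (6 * c))) / 3)
    \<le> 36 * (Delta A B c)\<^sup>2"
proof -
  let ?D = "Delta A B c"
  let ?e = "\<lambda>i. x i ^ 3 * index_error i"
  have "(\<Sum>j\<in>pairs A. (x (fst j) ^ 3 * Delta (insert (fst j) A) (B \<union> Nb (fst j) \<union> nb (fst j)) (6 * c)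
      + 2 * (x (snd j) ^ 3 * Delta (insert (snd j) A) (B \<union> Nb (snd j) \<union> nb (fst j)) (6 * c))) / 3)
    \<le> (\<Sum>j\<in>pairs A. (x (fst j) ^ 3 * (12 * ?D + 6 * c * (index_error (fst j) + (\<Sum>m\<in>nb (fst j). x m)))
      + 2 * (x (snd j) ^ 3 * (12 * ?D + 6 * c * (index_error (snd j) + (\<Sum>m\<in>nb (fst j). x m))))) / 3)"
    by (intro sum_mono divide_right_mono add_mono mult_left_mono Delta_insert_le[OF A B c]) (auto simp: pairs_iff dest: K_I)
  also have "\<dots> = 4 * ?D * ((\<Sum>j\<in>pairs A. x (fst j) ^ 3) + 2 * (\<Sum>j\<in>pairs A. x (snd j) ^ 3))
      + 2 * c * ((\<Sum>j\<in>pairs A. ?e (fst j)) + 2 * (\<Sum>j\<in>pairs A. ?e (snd j)) + (\<Sum>j\<in>pairs A. (x (fst j) ^ 3 + 2 * x (snd j) ^ 3) * (\<Sum>m\<in>nb (fst j). x m)))"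
    unfolding sum_distrib_left[of _ _ "pairs A"] sum.distrib[symmetric] by (intro sum.cong refl) (simp add: field_simps)
  also have "\<dots> \<le> 4 * ?D * (\<kappa> * sum_x3 + 2 * (\<kappa> * sum_x3))
      + 2 * c * (\<kappa> * (\<Sum>i\<in>I. ?e i) + 2 * (\<kappa> * (\<Sum>i\<in>I. ?e i)) + 3 * (\<kappa>\<^sup>2 * sum_x4))"
  proof (intro add_mono mult_left_mono sum_pairs_cube_nb)
    show "(\<Sum>j\<in>pairs A. x (fst j) ^ 3) \<le> \<kappa> * sum_x3" "(\<Sum>j\<in>pairs A. x (snd j) ^ 3) \<le> \<kappa> * sum_x3"
      unfolding sum_x3_def by (rule sum_pairs_le; simp)+
    show "(\<Sum>j\<in>pairs A. ?e (fst j)) \<le> \<kappa> * (\<Sum>i\<in>I. ?e i)" "(\<Sum>j\<in>pairs A. ?e (snd j)) \<le> \<kappa> * (\<Sum>i\<in>I. ?e i)"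
      by (rule sum_pairs_le; simp add: index_error_nonneg)+
    have "0 \<le> ?D" using Delta_ge(1)[OF A c, of B] Delta_parts_nonneg(2)[OF A] by linarith
    then show "0 \<le> 4 * ?D" by simp
  qed (use c in auto)
  also have "\<dots> = 12 * ?D * (\<kappa> * sum_x3) + 6 * c * (\<kappa> * (\<Sum>i\<in>I. ?e i) + \<kappa>\<^sup>2 * sum_x4)"
    by (simp add: algebra_simps)
  also have "\<dots> \<le> 12 * ?D * (\<kappa> * sum_x3) + 6 * c * (\<kappa> * (2.75 * (lam * (\<kappa> * sum_x4))) + lam * (\<kappa>\<^sup>2 * sum_x4))"
  proof (intro add_left_mono mult_left_mono add_mono sum_index_error)
    show "\<kappa>\<^sup>2 * sum_x4 \<le> lam * (\<kappa>\<^sup>2 * sum_x4)"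
      using lam_ge_1 sum_x4_nonneg mult_right_mono[of 1 lam "\<kappa>\<^sup>2 * sum_x4"] by simp
  qed (use c kappa_pos in auto)
  also have "\<dots> = 12 * ?D * (\<kappa> * sum_x3) + 22.5 * c * (lam * (\<kappa>\<^sup>2 * sum_x4))"
    by (simp add: power2_eq_square algebra_simps)
  finally have "\<kappa> * (\<Sum>j\<in>pairs A. (x (fst j) ^ 3 * Delta (insert (fst j) A) (B \<union> Nb (fst j) \<union> nb (fst j)) (6 * c)
      + 2 * (x (snd j) ^ 3 * Delta (insert (snd j) A) (B \<union> Nb (snd j) \<union> nb (fst j)) (6 * c))) / 3)
    \<le> \<kappa> * (12 * ?D * (\<kappa> * sum_x3) + 22.5 * c * (lam * (\<kappa>\<^sup>2 * sum_x4)))"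
    using kappa_pos by (intro mult_left_mono) auto
  also have "\<dots> = 12 * ?D * (\<kappa>\<^sup>2 * sum_x3) + 22.5 * (c * (lam * (\<kappa> ^ 3 * sum_x4)))"
    by (simp add: power2_eq_square power3_eq_cube algebra_simps)
  also have "\<dots> \<le> 12 * ?D * ?D + 22.5 * (?D * ?D)"
  proof (intro add_mono mult_left_mono Delta_ge(1)[OF A c])
    have D0: "0 \<le> ?D" using Delta_ge(1)[OF A c, of B] Delta_parts_nonneg(2)[OF A] by linarith
    then show "0 \<le> 12 * ?D" by simp
    let ?s = "lam * sqrt (var_scale A)"
    have s0: "0 \<le> ?s" by (rule Delta_parts_nonneg(3)[OF A])
    have "lam * (\<kappa> ^ 3 * sum_x4) \<le> lam * var_scale A"
      using kappa3_le_var_scale(1)[OF A] lam_ge_1 by (intro mult_left_mono) auto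
    also have "\<dots> \<le> lam * (lam * var_scale A)"
      using lam_ge_1 kappa3_le_var_scale(2)[OF A] mult_right_mono[of 1 lam "var_scale A"] by (intro mult_left_mono) auto
    also have "\<dots> = ?s * ?s" using kappa3_le_var_scale(2)[OF A] by (simp add: ac_simps)
    finally have "c * (lam * (\<kappa> ^ 3 * sum_x4)) \<le> c * (?s * ?s)" using c by (intro mult_left_mono) auto
    also have "\<dots> = (c * ?s) * ?s" by simp
    also have "\<dots> \<le> ?D * ?D"
    proof (intro mult_mono Delta_ge(2)[OF A c])
      show "?s \<le> ?D" using Delta_ge(2)[OF A c, of B] mult_right_mono[OF c s0] by simp
    qed (use s0 D0 in auto)
    finally show "c * (lam * (\<kappa> ^ 3 * sum_x4)) \<le> ?D * ?D" .
  qed auto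
  also have "\<dots> \<le> 36 * ?D\<^sup>2" using zero_le_square[of ?D] unfolding power2_eq_square mult.assoc by linarith
  finally show ?thesis .
qed

text \<open>
  Take \<open>d = 1000 D\<close> with \<open>D = Delta A B c\<close>. The intervals at the ramps have length \<open>d\<close>, hence
  contribute a fixed multiple of \<open>D\<close> that does not involve \<open>C\<close>; the other part is
  \<open>C\<close> times \<open>288 D / 1000\<close>. After division by \<open>0.69\<close> the coefficient of \<open>C D\<close> stays below \<open>1 / 2\<close>.
\<close>

lemma concentration_improve:
  assumes conc: "concentration C" and C: "8000 \<le> C"
  shows "concentration (4000 + C / 2)"
  unfolding concentration_def
proof (intro allI impI)
  fix A B v \<rho> and a b c :: real
  assume A: "A \<subseteq> I" "A \<noteq> {}" and B: "B \<subseteq> I" and v: "v \<in> borel_measurable (gen A)" "L4_bound M v \<rho>"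
    and v0': "\<forall>\<omega>\<in>space M. 0 \<le> v \<omega>" and ab: "a \<le> b" and c: "1 \<le> c"
  have v0: "0 \<le> v \<omega>" if "\<omega> \<in> space M" for \<omega> using v0' that by blast
  define D where "D = Delta A B c"
  have D: "0 < D" using Delta_ge(1)[OF A c, of B] kappa_pos sum_x3_pos unfolding D_def
    by (smt (verit) mult_pos_pos zero_less_power)
  have \<rho>0: "0 \<le> \<rho>" by (rule rho_nonneg[OF A v])
  let ?E = "expectation (\<lambda>\<omega>. v \<omega> ^ 3 * hit A B a b c \<omega>)"
  have "?E \<le> \<rho> ^ 3 * (2 * (b - a) + (4000 + C / 2) * D)"
  proof (cases "D \<ge> 1 / 8000")
    case True
    have "1 \<le> (4000 + C / 2) * D" using mult_mono[of 8000 "4000 + C / 2" "1 / 8000" D] True C by simp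
    then have "\<rho> ^ 3 * 1 \<le> \<rho> ^ 3 * (2 * (b - a) + (4000 + C / 2) * D)" using ab \<rho>0 by (intro mult_left_mono) auto
    then show ?thesis using expectation_hit_le[OF A B v v0, of a b c] by linarith
  next
    case False
    define d where "d = 1000 * D"
    have d: "0 < d" using D by (simp add: d_def)
    define R where "R i k = (\<rho> * x i) ^ 3 * (2 * d + C * Delta (insert i A) (B \<union> Nb i \<union> nb k) (6 * c))" for i k
    have rec: "expectation (\<lambda>\<omega>. (v \<omega> * \<bar>X i \<omega>\<bar>) ^ 3 * hit (insert i A) (B \<union> Nb i \<union> nb k) a' b' (6 * c) \<omega>) \<le> R i k"
      if "i \<in> K A" "k \<in> K A" "b' = a' + d" for i k a' b'
    proof -
      have iI: "i \<in> I" "k \<in> I" using that K_I by auto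
      have [measurable]: "v \<in> borel_measurable (gen (insert i A))" by (rule gen_mono[OF v(1)]) auto
      have [measurable]: "X i \<in> borel_measurable (gen (insert i A))" by (rule X_measurable_gen) simp
      have L: "L4_bound M (\<lambda>\<omega>. v \<omega> * \<bar>X i \<omega>\<bar>) (\<rho> * x i)"
        using L4_weighted_X[OF A(1) v that(1)] X_meas[OF iI(1)] v_measurable[OF A v]
        unfolding L4_bound_def by (simp add: power_mult_distrib)
      have "expectation (\<lambda>\<omega>. (v \<omega> * \<bar>X i \<omega>\<bar>) ^ 3 * hit (insert i A) (B \<union> Nb i \<union> nb k) a' b' (6 * c) \<omega>)
          \<le> (\<rho> * x i) ^ 3 * (2 * (b' - a') + C * Delta (insert i A) (B \<union> Nb i \<union> nb k) (6 * c))"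
      proof (rule concentrationD[OF conc _ _ _ _ L])
        show "(\<lambda>\<omega>. v \<omega> * \<bar>X i \<omega>\<bar>) \<in> borel_measurable (gen (insert i A))" by measurable
        show "B \<union> Nb i \<union> nb k \<subseteq> I" using B Nb_subset nb[OF iI(2)] by auto
      qed (use A iI v0 d c that in auto)
      then show ?thesis unfolding R_def using that by simp
    qed
    have main: "69 / 100 * ?E \<le> \<rho> ^ 3 * ((b - a) + 2 * d + 24 * D) + 4 / d * \<kappa> * (\<Sum>j\<in>pairs A. (2 * R (fst j) (fst j) + 4 * R (snd j) (fst j)) / 3)"
      unfolding D_def
      by (rule concentration_step[OF A B v v0 ab c d _ rec rec]) (use False in \<open>auto simp: D_def\<close>)
    have "\<kappa> * (\<Sum>j\<in>pairs A. (2 * R (fst j) (fst j) + 4 * R (snd j) (fst j)) / 3)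
        = 2 * \<rho> ^ 3 * (2 * d * (\<kappa> * (((\<Sum>j\<in>pairs A. x (fst j) ^ 3) + 2 * (\<Sum>j\<in>pairs A. x (snd j) ^ 3)) / 3))
          + C * (\<kappa> * (\<Sum>j\<in>pairs A. (x (fst j) ^ 3 * Delta (insert (fst j) A) (B \<union> Nb (fst j) \<union> nb (fst j)) (6 * c)
      + 2 * (x (snd j) ^ 3 * Delta (insert (snd j) A) (B \<union> Nb (snd j) \<union> nb (fst j)) (6 * c))) / 3)))"
      unfolding R_def power_mult_distrib sum_distrib_left[of _ _ "pairs A"] sum_divide_distrib sum.distrib[symmetric]
      by (intro sum.cong refl) (simp add: field_simps)
    also have "\<dots> \<le> 2 * \<rho> ^ 3 * (2 * d * D + C * (36 * D\<^sup>2))"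
    proof (intro mult_left_mono add_mono)
      have "(\<Sum>j\<in>pairs A. x (fst j) ^ 3) \<le> \<kappa> * sum_x3" "(\<Sum>j\<in>pairs A. x (snd j) ^ 3) \<le> \<kappa> * sum_x3"
        unfolding sum_x3_def by (rule sum_pairs_le; simp)+
      then have "\<kappa> * (((\<Sum>j\<in>pairs A. x (fst j) ^ 3) + 2 * (\<Sum>j\<in>pairs A. x (snd j) ^ 3)) / 3) \<le> \<kappa> * (\<kappa> * sum_x3)"
        using kappa_pos by (intro mult_left_mono) auto
      also have "\<dots> \<le> D" using Delta_ge(1)[OF A c, of B] by (simp add: D_def power2_eq_square mult.assoc)
      finally show "\<kappa> * (((\<Sum>j\<in>pairs A. x (fst j) ^ 3) + 2 * (\<Sum>j\<in>pairs A. x (snd j) ^ 3)) / 3) \<le> D" .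
      show "\<kappa> * (\<Sum>j\<in>pairs A. (x (fst j) ^ 3 * Delta (insert (fst j) A) (B \<union> Nb (fst j) \<union> nb (fst j)) (6 * c)
      + 2 * (x (snd j) ^ 3 * Delta (insert (snd j) A) (B \<union> Nb (snd j) \<union> nb (fst j)) (6 * c))) / 3) \<le> 36 * D\<^sup>2"
        unfolding D_def by (rule sum_Delta_insert[OF A B c])
    qed (use d C \<rho>0 in auto)
    finally have "4 / d * (\<kappa> * (\<Sum>j\<in>pairs A. (2 * R (fst j) (fst j) + 4 * R (snd j) (fst j)) / 3)) \<le> 4 / d * (2 * \<rho> ^ 3 * (2 * d * D + C * (36 * D\<^sup>2)))"
      using d by (intro mult_left_mono) auto
    also have "\<dots> = \<rho> ^ 3 * (16 * D + 288 / 1000 * (C * D))"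
      using D by (simp add: d_def field_simps power2_eq_square)
    finally have "69 / 100 * ?E \<le> \<rho> ^ 3 * ((b - a) + 2 * d + 24 * D) + \<rho> ^ 3 * (16 * D + 288 / 1000 * (C * D))"
      using main by (simp only: mult.assoc)
    also have "\<dots> = \<rho> ^ 3 * ((b - a) + 2040 * D + 288 / 1000 * (C * D))" by (simp add: d_def algebra_simps)
    also have "\<dots> \<le> \<rho> ^ 3 * (69 / 100 * (2 * (b - a) + (4000 + C / 2) * D))"
    proof (rule mult_left_mono)
      have "0 \<le> C * D" using C D by simp
      then show "(b - a) + 2040 * D + 288 / 1000 * (C * D) \<le> 69 / 100 * (2 * (b - a) + (4000 + C / 2) * D)"
        using ab D by (simp add: distrib_right)
    qed (use \<rho>0 in auto)
    also have "\<dots> = 69 / 100 * (\<rho> ^ 3 * (2 * (b - a) + (4000 + C / 2) * D))" by (rule mult.left_commute)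
    finally show ?thesis by (rule mult_left_le_imp_le) simp
  qed
  then show "?E \<le> \<rho> ^ 3 * (2 * (b - a) + (4000 + C / 2) * Delta A B c)" by (simp add: D_def)
qed

text \<open>
  The fixed point of \<open>C \<mapsto> 4000 + C / 2\<close>.
\<close>

theorem concentration_8000: "concentration 8000"
proof -
  define C0 where "C0 = max 8000 (1 / (\<kappa>\<^sup>2 * sum_x3))"
  have mono: "concentration C'" if C: "concentration C" and le: "C \<le> C'" for C C'
    unfolding concentration_def
  proof (intro allI impI)
    fix A B v \<rho> and a b c :: real
    assume A: "A \<subseteq> I" "A \<noteq> {}" and B: "B \<subseteq> I" and v: "v \<in> borel_measurable (gen A)" "L4_bound M v \<rho>"
      and v0: "\<forall>\<omega>\<in>space M. 0 \<le> v \<omega>" and ab: "a \<le> b" and c: "1 \<le> c"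
    have "0 \<le> Delta A B c" using Delta_ge(1)[OF A c, of B] Delta_parts_nonneg(2)[OF A] by linarith
    then have "\<rho> ^ 3 * (2 * (b - a) + C * Delta A B c) \<le> \<rho> ^ 3 * (2 * (b - a) + C' * Delta A B c)"
      using le rho_nonneg[OF A v] by (intro mult_left_mono add_left_mono mult_right_mono) auto
    then show "expectation (\<lambda>\<omega>. v \<omega> ^ 3 * hit A B a b c \<omega>) \<le> \<rho> ^ 3 * (2 * (b - a) + C' * Delta A B c)"
      using concentrationD[OF C A B v _ ab c] v0 by fastforce
  qed
  have iter: "concentration (8000 + (C0 - 8000) / 2 ^ m)" for m
  proof (induction m)
    case 0
    then show ?case using mono[OF concentration_trivial] by (simp add: C0_def)
  next
    case (Suc m)
    have "concentration (4000 + (8000 + (C0 - 8000) / 2 ^ m) / 2)"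
      by (rule concentration_improve[OF Suc]) (simp add: C0_def)
    moreover have "4000 + (8000 + (C0 - 8000) / 2 ^ m) / 2 = 8000 + (C0 - 8000) / 2 ^ Suc m"
      by (simp add: field_simps)
    ultimately show ?case by simp
  qed
  show ?thesis
    unfolding concentration_def
  proof (intro allI impI)
    fix A B v \<rho> and a b c :: real
    assume A: "A \<subseteq> I" "A \<noteq> {}" and B: "B \<subseteq> I" and v: "v \<in> borel_measurable (gen A)" "L4_bound M v \<rho>"
      and v0: "\<forall>\<omega>\<in>space M. 0 \<le> v \<omega>" and ab: "a \<le> b" and c: "1 \<le> c"
    let ?E = "expectation (\<lambda>\<omega>. v \<omega> ^ 3 * hit A B a b c \<omega>)"
    have "?E \<le> \<rho> ^ 3 * (2 * (b - a) + (8000 + (C0 - 8000) / 2 ^ m) * Delta A B c)" for m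
      using concentrationD[OF iter A B v _ ab c] v0 by fastforce
    moreover have "(\<lambda>m. \<rho> ^ 3 * (2 * (b - a) + (8000 + (C0 - 8000) / 2 ^ m) * Delta A B c)) \<longlonglongrightarrow> \<rho> ^ 3 * (2 * (b - a) + (8000 + 0) * Delta A B c)"
    proof (intro tendsto_intros)
      have "(\<lambda>m. (1 / 2 :: real) ^ m) \<longlonglongrightarrow> 0" by (rule LIMSEQ_power_zero) simp
      then have "(\<lambda>m. (C0 - 8000) * (1 / 2) ^ m) \<longlonglongrightarrow> (C0 - 8000) * 0" by (rule tendsto_mult_left)
      then show "(\<lambda>m. (C0 - 8000) / 2 ^ m) \<longlonglongrightarrow> 0" by (simp add: power_divide)
    qed
    ultimately have "?E \<le> \<rho> ^ 3 * (2 * (b - a) + (8000 + 0) * Delta A B c)"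
      by (intro LIMSEQ_le_const) auto
    then show "?E \<le> \<rho> ^ 3 * (2 * (b - a) + 8000 * Delta A B c)" by simp
  qed
qed

end

section \<open>The general statement\<close>

lemma Lp_norm_finite:
  assumes [measurable]: "Y \<in> borel_measurable M" and int: "integrable M (\<lambda>\<omega>. \<bar>Y \<omega>\<bar> powr p)"
  shows "Lp_norm M p Y = ennreal ((\<integral>\<omega>. \<bar>Y \<omega>\<bar> powr p \<partial>M) powr (1 / p))"
proof -
  have "(\<integral>\<^sup>+ \<omega>. ennreal (\<bar>Y \<omega>\<bar> powr p) \<partial>M) = ennreal (\<integral>\<omega>. \<bar>Y \<omega>\<bar> powr p \<partial>M)"
    by (rule nn_integral_eq_integral[OF int]) simp
  then show ?thesis by (simp add: Lp_norm_def ennreal_rpow_def)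
qed

lemma Lp_norm_infinite:
  assumes "Y \<in> borel_measurable M" "\<not> integrable M (\<lambda>\<omega>. \<bar>Y \<omega>\<bar> powr p)"
  shows "Lp_norm M p Y = \<infinity>"
proof -
  have "(\<integral>\<^sup>+ \<omega>. ennreal (\<bar>Y \<omega>\<bar> powr p) \<partial>M) = \<infinity>"
  proof (rule ccontr)
    assume "(\<integral>\<^sup>+ \<omega>. ennreal (\<bar>Y \<omega>\<bar> powr p) \<partial>M) \<noteq> \<infinity>"
    then have "integrable M (\<lambda>\<omega>. \<bar>Y \<omega>\<bar> powr p)"
      using assms(1) by (intro integrableI_bounded) (auto simp: less_top)
    then show False using assms(2) by simp
  qed
  then show ?thesis by (simp add: Lp_norm_def ennreal_rpow_def)
qed

lemma Lp_norm_eq_0: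
  assumes [measurable]: "Y \<in> borel_measurable M" and "Lp_norm M p Y = 0"
  shows "AE \<omega> in M. Y \<omega> = 0"
proof -
  let ?J = "\<integral>\<^sup>+ \<omega>. ennreal (\<bar>Y \<omega>\<bar> powr p) \<partial>M"
  have "?J \<noteq> \<infinity>" "enn2real ?J powr (1 / p) = 0"
    using assms(2) by (auto simp: Lp_norm_def ennreal_rpow_def split: if_splits)
  then have "?J = 0" by (simp add: enn2real_eq_0_iff)
  then have "AE \<omega> in M. ennreal (\<bar>Y \<omega>\<bar> powr p) = 0" by (subst (asm) nn_integral_0_iff_AE) auto
  then show ?thesis by eventually_elim simp
qed

lemma abs_powr_numeral: "\<bar>y\<bar> powr 4 = y ^ 4" "\<bar>y\<bar> powr 2 = y\<^sup>2" for y :: real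
proof -
  show "\<bar>y\<bar> powr 4 = y ^ 4" using powr_numeral[of "\<bar>y\<bar>" "num.Bit0 (num.Bit0 num.One)"] by (cases "y = 0") auto
  show "\<bar>y\<bar> powr 2 = y\<^sup>2" using powr_numeral[of "\<bar>y\<bar>" "num.Bit0 num.One"] by (cases "y = 0") auto
qed

lemma pow4_powr:
  fixes r :: real
  assumes "0 \<le> r"
  shows "(r ^ 4) powr (1 / 4) = r" "(r ^ 4) powr (3 / 4) = r ^ 3"
proof -
  have *: "(r ^ 4) powr (q / 4) = r powr q" if "0 < r" for q
  proof -
    have "(r ^ 4) powr (q / 4) = (r powr 4) powr (q / 4)" using that by (simp add: powr_numeral)
    then show ?thesis by (simp add: powr_powr)
  qed
  show "(r ^ 4) powr (1 / 4) = r" using *[of 1] assms by (cases "r = 0") auto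
  show "(r ^ 4) powr (3 / 4) = r ^ 3" using *[of 3] assms by (cases "r = 0") (auto simp: powr_numeral)
qed

lemma psi_scale:
  assumes "\<sigma> > 0"
  shows "psi \<sigma> y = \<sigma> * psi 1 (y / \<sigma>\<^sup>2)"
proof -
  have s: "0 \<le> \<sigma>\<^sup>2" by simp
  have "min (max y (0.25 * \<sigma>\<^sup>2)) (2 * \<sigma>\<^sup>2) = min (max (\<sigma>\<^sup>2 * (y / \<sigma>\<^sup>2)) (\<sigma>\<^sup>2 * 0.25)) (\<sigma>\<^sup>2 * 2)"
    using assms by simp
  also have "\<dots> = \<sigma>\<^sup>2 * min (max (y / \<sigma>\<^sup>2) 0.25) 2"
    using assms by (auto simp: min_def max_def field_simps)
  finally show ?thesis using assms by (simp add: psi_def real_sqrt_mult)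
qed

lemma finite_nb_SIGMA:
  fixes nb :: "nat \<Rightarrow> nat set"
  assumes "\<And>i. i \<in> {1..n} \<Longrightarrow> nb i \<subseteq> {1..n}"
  shows "finite (SIGMA i:{1..n}. nb i)"
proof (rule finite_SigmaI)
  fix i assume "i \<in> {1..n}"
  from finite_subset[OF assms[OF this]] show "finite (nb i)" by simp
qed simp

lemma card_le_kappa:
  assumes "\<And>i. i \<in> {1..n} \<Longrightarrow> nb i \<subseteq> {1..n}" "i \<in> {1..n}"
  shows "card (N_idx n nb i) \<le> kappa n nb nb2" "j \<in> nb i \<Longrightarrow> card (nb2 i j) \<le> kappa n nb nb2"
proof -
  have "card (N_idx n nb i) \<le> (SUP i\<in>{1..n}. card (N_idx n nb i))"
    using assms(2) by (intro cSUP_upper) auto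
  then show "card (N_idx n nb i) \<le> kappa n nb nb2" by (simp add: kappa_def)
  assume "j \<in> nb i"
  then have "(case (i, j) of (i, j) \<Rightarrow> card (nb2 i j)) \<le> (SUP (i, j)\<in>(SIGMA i:{1..n}. nb i). card (nb2 i j))"
    using assms(2) finite_nb_SIGMA[of n nb, OF assms(1)] by (intro cSUP_upper) auto
  then show "card (nb2 i j) \<le> kappa n nb nb2" by (simp add: kappa_def)
qed

lemma card_le_tau: "i \<in> {1..n} \<Longrightarrow> card (D_idx n nb nb2 i) \<le> tau n nb nb2"
  unfolding tau_def by (intro cSUP_upper) auto

lemma (in prob_space) indep_families_divide:
  assumes "indep_families M X J L"
  shows "indep_families M (\<lambda>i \<omega>. X i \<omega> / s) J L"
proof -
  let ?g = "\<lambda>J f. \<lambda>i\<in>J. f i / (s :: real)"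
  have m: "?g J \<in> measurable (Pi\<^sub>M J (\<lambda>_. borel)) (Pi\<^sub>M J (\<lambda>_. borel))" for J
    by measurable
  have "indep_var (Pi\<^sub>M J (\<lambda>_. borel)) (?g J \<circ> (\<lambda>\<omega>. \<lambda>i\<in>J. X i \<omega>)) (Pi\<^sub>M L (\<lambda>_. borel)) (?g L \<circ> (\<lambda>\<omega>. \<lambda>i\<in>L. X i \<omega>))"
    using assms unfolding indep_families_def by (rule indep_var_compose[OF _ m m])
  moreover have "?g J \<circ> (\<lambda>\<omega>. \<lambda>i\<in>J. X i \<omega>) = (\<lambda>\<omega>. \<lambda>i\<in>J. X i \<omega> / s)" for J
    by (auto simp: fun_eq_iff)
  ultimately show ?thesis unfolding indep_families_def by simp
qed

text \<open>
  A centred variable that is independent of itself has second moment \<open>0\<close>. This excludes \<open>\<kappa> = 0\<close> when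
  some \<open>X\<^sub>i\<close> does not vanish.
\<close>

lemma (in prob_space) AE_zero_if_indep_self:
  assumes "indep_families M X {i} L" "i \<in> L" "integrable M (X i)" "expectation (X i) = 0"
  shows "AE \<omega> in M. X i \<omega> = 0"
proof -
  have m: "(\<lambda>f. f i) \<in> measurable (Pi\<^sub>M J (\<lambda>_. borel)) borel" if "i \<in> J" for J :: "nat set"
    by (rule measurable_component_singleton[OF that])
  have "indep_var borel ((\<lambda>f. f i) \<circ> (\<lambda>\<omega>. \<lambda>i\<in>{i}. X i \<omega>)) borel ((\<lambda>f. f i) \<circ> (\<lambda>\<omega>. \<lambda>i\<in>L. X i \<omega>))"
    using assms(1) unfolding indep_families_def by (rule indep_var_compose) (auto intro!: m assms(2))
  moreover have "(\<lambda>f. f i) \<circ> (\<lambda>\<omega>. \<lambda>i\<in>{i}. X i \<omega>) = X i" "(\<lambda>f. f i) \<circ> (\<lambda>\<omega>. \<lambda>i\<in>L. X i \<omega>) = X i"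
    using assms(2) by auto
  ultimately have iv: "indep_var borel (X i) borel (X i)" by simp
  have "integrable M (\<lambda>\<omega>. X i \<omega> * X i \<omega>)" "expectation (\<lambda>\<omega>. X i \<omega> * X i \<omega>) = 0"
    using indep_var_integrable[OF iv assms(3,3)] indep_var_lebesgue_integral[OF iv assms(3,3)] assms(4) by auto
  then have "AE \<omega> in M. X i \<omega> * X i \<omega> = 0"
    by (subst (asm) integral_nonneg_eq_0_iff_AE) auto
  then show ?thesis by eventually_elim simp
qed

theorem proposition4p6:
  fixes M :: "'a measure" and n :: nat and X :: "nat \<Rightarrow> 'a \<Rightarrow> real"
    and nb :: "nat \<Rightarrow> nat set" and nb2 :: "nat \<Rightarrow> nat \<Rightarrow> nat set"
    and A B :: "nat set" and h :: "(nat \<Rightarrow> real) \<Rightarrow> real"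
    and a b c \<sigma> :: real
    and \<xi> S V T Q \<eta> \<zeta> :: "'a \<Rightarrow> real"
    and \<kappa> \<tau> :: real and lam \<delta>1 \<delta>2 \<delta>3 \<delta>4 :: ennreal
  assumes prob: "prob_space M"
    and integrable: "\<And>i. i \<in> {1..n} \<Longrightarrow> integrable M (X i)"
    and mean_zero: "\<And>i. i \<in> {1..n} \<Longrightarrow> prob_space.expectation M (X i) = 0"
    and nb: "\<And>i. i \<in> {1..n} \<Longrightarrow> nb i \<subseteq> {1..n}"
    and indep1: "\<And>i. i \<in> {1..n} \<Longrightarrow> indep_families M X {i} ({1..n} - nb i)"
    and nb2: "\<And>i j. i \<in> {1..n} \<Longrightarrow> j \<in> nb i \<Longrightarrow> nb i \<subseteq> nb2 i j \<and> nb2 i j \<subseteq> {1..n}"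
    and indep2: "\<And>i j. i \<in> {1..n} \<Longrightarrow> j \<in> nb i \<Longrightarrow> indep_families M X {i, j} ({1..n} - nb2 i j)"
    and sigma: "\<sigma> > 0" "\<sigma>\<^sup>2 = prob_space.variance M (\<lambda>\<omega>. \<Sum>i\<in>{1..n}. X i \<omega>)"
    and A: "A \<subseteq> {1..n}" "A \<noteq> {}"
    and B: "B \<subseteq> {1..n}" "B \<noteq> {}"
    and h: "h \<in> borel_measurable (Pi\<^sub>M A (\<lambda>_. borel))"
    and xi: "\<xi> = (\<lambda>\<omega>. h (\<lambda>i\<in>A. X i \<omega>))" "\<And>\<omega>. \<omega> \<in> space M \<Longrightarrow> \<xi> \<omega> \<ge> 0"
    and abc: "a \<le> b" "c \<ge> 1"
    and S: "S = (\<lambda>\<omega>. \<Sum>k\<in>N_set_compl n nb A. X k \<omega>)"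
    and V: "V = (\<lambda>\<omega>. psi \<sigma> (\<Sum>k\<in>N_set_compl n nb A. \<Sum>l\<in>N_set_compl n nb A \<inter> nb k. X k \<omega> * X l \<omega>))"
    and T: "T = (\<lambda>\<omega>. sqrt (1 / \<sigma>\<^sup>2 * (\<Sum>k\<in>N_set n nb A. \<Sum>l\<in>nb k. \<bar>X k \<omega> * X l \<omega>\<bar>)
                      + 1 / \<sigma>\<^sup>2 * (\<Sum>k\<in>N_set n nb A. \<Sum>l\<in>N_idx n nb k. \<bar>X k \<omega> * X l \<omega>\<bar>)))"
    and Q: "Q = (\<lambda>\<omega>. min 1 (T \<omega>))"
    and eta: "\<eta> = (\<lambda>\<omega>. a - c * (\<Sum>m\<in>B. \<bar>X m \<omega>\<bar> / \<sigma>) - c * \<bar>S \<omega>\<bar> * Q \<omega> / \<sigma>)"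
    and zeta: "\<zeta> = (\<lambda>\<omega>. b + c * (\<Sum>m\<in>B. \<bar>X m \<omega>\<bar> / \<sigma>) + c * \<bar>S \<omega>\<bar> * Q \<omega> / \<sigma>)"
    and kappa: "\<kappa> = real (kappa n nb nb2)"
    and tau: "\<tau> = real (tau n nb nb2)"
    and lam: "lam = ennreal (\<kappa> / \<sigma>\<^sup>2) * (\<Sum>k\<in>{1..n}. (Lp_norm M 2 (X k))\<^sup>2)"
    and delta1: "\<delta>1 = ennreal (c / \<sigma>) * (\<Sum>m\<in>B. Lp_norm M 4 (X m))"
    and delta2: "\<delta>2 = ennreal (c * \<kappa>\<^sup>2 * (real (card A))\<^sup>2 / \<sigma> ^ 3) * lam
                       * (\<Sum>i\<in>{1..n}. Lp_norm M 4 (X i) ^ 3)"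
    and delta3: "\<delta>3 = ennreal (c * sqrt \<kappa> * (\<kappa> + sqrt \<tau>) * sqrt (real (card A)) / \<sigma>\<^sup>2) * lam
                       * ennreal_rpow (\<Sum>i\<in>{1..n}. Lp_norm M 4 (X i) ^ 4) (1 / 2)"
    and delta4: "\<delta>4\<^sup>2 = ennreal (c\<^sup>2 / \<sigma>\<^sup>2) * lam\<^sup>2
                        * (\<Sum>k\<in>N_set n nb A. \<Sum>l\<in>N_idx n nb k \<union> nb k.
                             Lp_norm M 4 (X k) * Lp_norm M 4 (X l))"
  shows "(\<integral>\<^sup>+ \<omega>. ennreal (\<xi> \<omega> * indicator {\<omega>. \<eta> \<omega> \<le> S \<omega> / V \<omega> \<and> S \<omega> / V \<omega> \<le> \<zeta> \<omega>} \<omega>) \<partial>M)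
         \<le> 8755 * Lp_norm M (4 / 3) \<xi> * (ennreal ((b - a) / 1500) + \<delta>1 + \<delta>2 + \<delta>3 + \<delta>4)"
proof -
  interpret prob_space M by (rule prob)
  let ?I = "{1..n}"
  let ?L = "\<lambda>i. Lp_norm M 4 (X i)"
  let ?sum = "ennreal ((b - a) / 1500) + \<delta>1 + \<delta>2 + \<delta>3 + \<delta>4"
  have X_meas: "X i \<in> borel_measurable M" if "i \<in> ?I" for i using integrable[OF that] by simp
  have finA: "finite A" using A(1) finite_subset by blast
  have cardA: "1 \<le> real (card A)" using finA A(2) by (simp add: Suc_le_eq card_gt_0_iff)
  have xi_meas: "\<xi> \<in> borel_measurable M"
    unfolding xi(1)
    by (rule measurable_compose[OF _ h]) (use A(1) X_meas in \<open>auto intro!: measurable_restrict\<close>)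
  have kappa_ge: "card (N_idx n nb i) \<le> kappa n nb nb2" "j \<in> nb i \<Longrightarrow> card (nb2 i j) \<le> kappa n nb nb2"
    if "i \<in> ?I" for i j
    by (rule card_le_kappa[OF _ that]; use nb in blast)+
  let ?hit = "\<lambda>\<omega>. \<xi> \<omega> * indicator {\<omega>. \<eta> \<omega> \<le> S \<omega> / V \<omega> \<and> S \<omega> / V \<omega> \<le> \<zeta> \<omega>} \<omega>"
  have zero: ?thesis if "Lp_norm M (4 / 3) \<xi> = 0"
  proof -
    have "AE \<omega> in M. \<xi> \<omega> = 0" by (rule Lp_norm_eq_0[OF xi_meas that])
    then have "AE \<omega> in M. ennreal (?hit \<omega>) = 0" by eventually_elim simp
    then have "(\<integral>\<^sup>+ \<omega>. ennreal (?hit \<omega>) \<partial>M) = (\<integral>\<^sup>+ \<omega>. 0 \<partial>M)" by (rule nn_integral_cong_AE)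
    then show ?thesis by simp
  qed
  consider "Lp_norm M (4 / 3) \<xi> = 0"
    | i where "Lp_norm M (4 / 3) \<xi> \<noteq> 0" "i \<in> ?I" "\<not> integrable M (\<lambda>\<omega>. X i \<omega> ^ 4)"
    | "Lp_norm M (4 / 3) \<xi> \<noteq> 0" "\<And>i. i \<in> ?I \<Longrightarrow> integrable M (\<lambda>\<omega>. X i \<omega> ^ 4)" by blast
  then show ?thesis
  proof cases
    case 1
    then show ?thesis by (rule zero)
  next
    case (2 i)
    \<comment> \<open>A variable without fourth moment: \<open>\<delta>\<^sub>2\<close> is infinite, because the other factors are positive.\<close>
    have top: "?L i = \<infinity>" by (rule Lp_norm_infinite[OF X_meas[OF 2(2)]]) (use 2(3) in \<open>simp add: abs_powr_numeral\<close>)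
    have nz: "\<not> (AE \<omega> in M. X i \<omega> = 0)"
    proof
      assume "AE \<omega> in M. X i \<omega> = 0"
      then have "AE \<omega> in M. X i \<omega> ^ 4 = 0" by eventually_elim simp
      then have "integrable M (\<lambda>\<omega>. X i \<omega> ^ 4) \<longleftrightarrow> integrable M (\<lambda>\<omega>. 0 :: real)"
        using X_meas[OF 2(2)] by (intro integrable_cong_AE) auto
      then show False using 2(3) by simp
    qed
    have kpos: "0 < \<kappa>"
    proof (rule ccontr)
      assume "\<not> 0 < \<kappa>"
      then have k0: "kappa n nb nb2 = 0" by (simp add: kappa)
      have "nb i = {}"
      proof (rule ccontr)
        assume "nb i \<noteq> {}"
        then obtain l where l: "l \<in> nb i" by auto
        then have lI: "l \<in> ?I" using nb[OF 2(2)] by auto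
        have "card (N_idx n nb l) = 0" using kappa_ge(1)[OF lI] k0 by simp
        moreover have "i \<in> N_idx n nb l" "finite (N_idx n nb l)" using l 2(2) by (auto simp: N_idx_def)
        ultimately show False by auto
      qed
      then have "indep_families M X {i} ?I" using indep1[OF 2(2)] by simp
      from AE_zero_if_indep_self[OF this 2(2) integrable[OF 2(2)] mean_zero[OF 2(2)]] nz show False by simp
    qed
    have lam0: "lam \<noteq> 0"
    proof
      assume "lam = 0"
      then have "(\<Sum>k\<in>?I. (Lp_norm M 2 (X k))\<^sup>2) = 0"
        using kpos sigma(1) unfolding lam by (auto simp: ennreal_eq_0_iff divide_le_0_iff)
      then have "Lp_norm M 2 (X i) = 0" using 2(2) by (subst (asm) sum_eq_0_iff) auto
      then show False using Lp_norm_eq_0[OF X_meas[OF 2(2)]] nz by simp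
    qed
    have "(\<Sum>i\<in>?I. ?L i ^ 3) = \<infinity>"
    proof -
      have "?L i ^ 3 \<le> (\<Sum>i\<in>?I. ?L i ^ 3)" using 2(2) by (intro member_le_sum) auto
      then show ?thesis using top by (simp add: top_unique)
    qed
    moreover have "0 < c * \<kappa>\<^sup>2 * (real (card A))\<^sup>2 / \<sigma> ^ 3" using kpos cardA abc(2) sigma(1) by simp
    ultimately have "\<delta>2 = \<infinity>" unfolding delta2 using lam0
      by (simp add: ennreal_mult_eq_top_iff ennreal_eq_0_iff not_le)
    then have "8755 * Lp_norm M (4 / 3) \<xi> * ?sum = \<infinity>" using 2(1) by (simp add: ennreal_mult_eq_top_iff)
    then show ?thesis by simp
  next
    case 3
    \<comment> \<open>All fourth moments are finite: pass to the variables divided by \<open>\<sigma>\<close>.\<close>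
    define Y where "Y i \<omega> = X i \<omega> / \<sigma>" for i \<omega>
    have intW: "expectation (\<lambda>\<omega>. \<Sum>i\<in>?I. X i \<omega>) = 0"
      using integrable mean_zero by (subst Bochner_Integration.integral_sum) auto
    interpret L: local_dependence M n Y nb nb2 ?I \<kappa> \<tau>
    proof
      fix i assume i: "i \<in> ?I"
      show "Y i \<in> borel_measurable M" using X_meas[OF i] unfolding Y_def[abs_def] by measurable
      show "integrable M (\<lambda>\<omega>. Y i \<omega> ^ 4)" using 3(2)[OF i] by (simp add: Y_def power_divide)
      show "expectation (Y i) = 0" using mean_zero[OF i] by (simp add: Y_def[abs_def])
      show "nb i \<subseteq> ?I" by (rule nb[OF i])
      show "indep_families M Y {i} (?I - nb i)" unfolding Y_def[abs_def] by (rule indep_families_divide[OF indep1[OF i]])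
      show "real (card (N_idx n nb i)) \<le> \<kappa>" using kappa_ge(1)[OF i] by (simp add: kappa)
      show "real (card (D_idx n nb nb2 i)) \<le> \<tau>" using card_le_tau[OF i] by (simp add: tau)
      fix j assume j: "j \<in> nb i"
      show "nb i \<subseteq> nb2 i j \<and> nb2 i j \<subseteq> ?I" by (rule nb2[OF i j])
      show "indep_families M Y {i, j} (?I - nb2 i j)" unfolding Y_def[abs_def] by (rule indep_families_divide[OF indep2[OF i j]])
      show "real (card (nb2 i j)) \<le> \<kappa>" using kappa_ge(2)[OF i j] by (simp add: kappa)
    next
      have "expectation (\<lambda>\<omega>. (\<Sum>i\<in>?I. Y i \<omega>)\<^sup>2) = expectation (\<lambda>\<omega>. (\<Sum>i\<in>?I. X i \<omega>)\<^sup>2 / \<sigma>\<^sup>2)"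
        unfolding Y_def by (simp add: power_divide flip: sum_divide_distrib)
      also have "\<dots> = expectation (\<lambda>\<omega>. (\<Sum>i\<in>?I. X i \<omega>)\<^sup>2) / \<sigma>\<^sup>2" by simp
      also have "expectation (\<lambda>\<omega>. (\<Sum>i\<in>?I. X i \<omega>)\<^sup>2) = \<sigma>\<^sup>2" using sigma(2) intW by simp
      also have "\<sigma>\<^sup>2 / \<sigma>\<^sup>2 = 1" using sigma(1) by simp
      finally show "expectation (\<lambda>\<omega>. (\<Sum>i\<in>?I. Y i \<omega>)\<^sup>2) = 1" .
    qed simp
    let ?x = L.x
    have s0: "0 < \<sigma>" by (rule sigma(1))
    have k0: "0 \<le> \<kappa>" "0 \<le> \<tau>" by (simp_all add: kappa tau)
    have Lx: "?L i = ennreal (\<sigma> * ?x i)" if "i \<in> ?I" for i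
    proof -
      have "?L i = ennreal (expectation (\<lambda>\<omega>. X i \<omega> ^ 4) powr (1 / 4))"
        using Lp_norm_finite[OF X_meas[OF that], of 4] 3(2)[OF that] by (simp add: abs_powr_numeral)
      also have "expectation (\<lambda>\<omega>. X i \<omega> ^ 4) = (\<sigma> * ?x i) ^ 4"
        using s0 L.x_pow4[of i] by (simp add: Y_def power_divide power_mult_distrib)
      also have "((\<sigma> * ?x i) ^ 4) powr (1 / 4) = \<sigma> * ?x i" using s0 by (intro pow4_powr) simp
      finally show ?thesis .
    qed
    have L_lam: "lam = ennreal L.lam"
    proof -
      have X2: "integrable M (\<lambda>\<omega>. (X k \<omega>)\<^sup>2)" if "k \<in> ?I" for k
      proof -
        have "(X k \<omega>)\<^sup>2 = \<sigma>\<^sup>2 * (Y k \<omega> * Y k \<omega>)" for \<omega> using s0 by (simp add: Y_def power2_eq_square)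
        then show ?thesis using integrable_mult_right[OF L.integrable_XX[OF that that], of "\<sigma>\<^sup>2"] by (simp only:)
      qed
      have "(Lp_norm M 2 (X k))\<^sup>2 = ennreal (expectation (\<lambda>\<omega>. (X k \<omega>)\<^sup>2))" if "k \<in> ?I" for k
        using Lp_norm_finite[OF X_meas[OF that], of 2] X2[OF that]
        by (simp add: abs_powr_numeral ennreal_power powr_half_sqrt)
      then have "lam = ennreal (\<kappa> / \<sigma>\<^sup>2 * (\<Sum>k\<in>?I. expectation (\<lambda>\<omega>. (X k \<omega>)\<^sup>2)))"
        unfolding lam using k0 by (simp flip: ennreal_mult')
      also have "\<kappa> / \<sigma>\<^sup>2 * (\<Sum>k\<in>?I. expectation (\<lambda>\<omega>. (X k \<omega>)\<^sup>2)) = L.lam"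
        unfolding L.lam_def by (simp add: Y_def power_divide flip: sum_divide_distrib)
      finally show ?thesis .
    qed
    have lam1: "1 \<le> L.lam" by (rule L.lam_ge_1)
    have d1: "\<delta>1 = ennreal (c * (\<Sum>m\<in>B. ?x m))"
    proof -
      have "(\<Sum>m\<in>B. ?L m) = (\<Sum>m\<in>B. ennreal (\<sigma> * ?x m))" using B(1) by (intro sum.cong refl Lx) auto
      also have "\<dots> = ennreal (\<sigma> * (\<Sum>m\<in>B. ?x m))" using s0 by (simp add: sum_distrib_left)
      finally show ?thesis unfolding delta1 using s0 abc(2) by (simp flip: ennreal_mult')
    qed
    have d2: "ennreal (c * (\<kappa>\<^sup>2 * L.sum_x3)) \<le> \<delta>2"
    proof -
      have "(\<Sum>i\<in>?I. ?L i ^ 3) = (\<Sum>i\<in>?I. ennreal ((\<sigma> * ?x i) ^ 3))"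
        using s0 by (intro sum.cong refl) (simp add: Lx ennreal_power)
      also have "\<dots> = ennreal (\<sigma> ^ 3 * L.sum_x3)"
        using s0 unfolding L.sum_x3_def sum_distrib_left by (simp add: power_mult_distrib)
      finally have "\<delta>2 = ennreal (c * \<kappa>\<^sup>2 * (real (card A))\<^sup>2 / \<sigma> ^ 3) * ennreal L.lam * ennreal (\<sigma> ^ 3 * L.sum_x3)"
        unfolding delta2 L_lam by simp
      also have "\<dots> = ennreal ((c * (\<kappa>\<^sup>2 * L.sum_x3)) * ((real (card A))\<^sup>2 * L.lam))"
        using s0 abc(2) k0 lam1 L.sum_x3_nonneg by (simp add: field_simps flip: ennreal_mult)
      finally have e: "\<delta>2 = ennreal ((c * (\<kappa>\<^sup>2 * L.sum_x3)) * ((real (card A))\<^sup>2 * L.lam))" .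
      have "1 * 1 \<le> (real (card A))\<^sup>2 * L.lam" using lam1 cardA by (intro mult_mono) auto
      then have "(c * (\<kappa>\<^sup>2 * L.sum_x3)) * 1 \<le> (c * (\<kappa>\<^sup>2 * L.sum_x3)) * ((real (card A))\<^sup>2 * L.lam)"
        using abc(2) L.sum_x3_nonneg by (intro mult_left_mono) auto
      then show ?thesis unfolding e by (intro ennreal_leI) simp
    qed
    have d3: "ennreal (c * (L.lam * sqrt (L.var_scale A))) \<le> \<delta>3"
    proof -
      have "(\<Sum>i\<in>?I. ?L i ^ 4) = (\<Sum>i\<in>?I. ennreal ((\<sigma> * ?x i) ^ 4))"
        using s0 by (intro sum.cong refl) (simp add: Lx ennreal_power)
      also have "\<dots> = ennreal (\<sigma> ^ 4 * L.sum_x4)"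
        using s0 unfolding L.sum_x4_def sum_distrib_left by (simp add: power_mult_distrib)
      finally have "ennreal_rpow (\<Sum>i\<in>?I. ?L i ^ 4) (1 / 2) = ennreal ((\<sigma> ^ 4 * L.sum_x4) powr (1 / 2))"
        using s0 L.sum_x4_nonneg by (simp add: ennreal_rpow_def)
      also have "(\<sigma> ^ 4 * L.sum_x4) powr (1 / 2) = \<sigma>\<^sup>2 * sqrt L.sum_x4"
      proof -
        have "sqrt (\<sigma> ^ 4) = \<sigma>\<^sup>2" by (rule real_sqrt_unique) (simp_all flip: power_mult)
        then show ?thesis using L.sum_x4_nonneg by (simp add: powr_half_sqrt real_sqrt_mult)
      qed
      finally have "\<delta>3 = ennreal (c * sqrt \<kappa> * (\<kappa> + sqrt \<tau>) * sqrt (real (card A)) / \<sigma>\<^sup>2) * ennreal L.lam * ennreal (\<sigma>\<^sup>2 * sqrt L.sum_x4)"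
        unfolding delta3 L_lam by simp
      also have "\<dots> = ennreal (c * (L.lam * (sqrt \<kappa> * ((\<kappa> + sqrt \<tau>) * sqrt (real (card A))) * sqrt L.sum_x4)))"
      proof -
        have "ennreal (p / t) * ennreal l * ennreal (t * q) = ennreal (p * (l * q))" if "0 < t" "0 \<le> p" "0 \<le> l" for p t l q :: real
          using that by (simp flip: ennreal_mult')
        from this[of "\<sigma>\<^sup>2" "c * sqrt \<kappa> * (\<kappa> + sqrt \<tau>) * sqrt (real (card A))" L.lam "sqrt L.sum_x4"]
        show ?thesis using s0 abc(2) k0 lam1 by (simp add: ac_simps)
      qed
      finally have e: "\<delta>3 = ennreal (c * (L.lam * (sqrt \<kappa> * ((\<kappa> + sqrt \<tau>) * sqrt (real (card A))) * sqrt L.sum_x4)))" .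
      have "sqrt (\<kappa>\<^sup>2 + \<tau> * card A) \<le> (\<kappa> + sqrt \<tau>) * sqrt (real (card A))"
      proof (rule real_le_lsqrt)
        have "\<kappa>\<^sup>2 * 1 \<le> \<kappa>\<^sup>2 * card A" using cardA by (intro mult_left_mono) auto
        moreover have "0 \<le> 2 * \<kappa> * sqrt \<tau> * card A" using k0 by simp
        moreover have "((\<kappa> + sqrt \<tau>) * sqrt (real (card A)))\<^sup>2 = (\<kappa>\<^sup>2 + 2 * \<kappa> * sqrt \<tau> + \<tau>) * card A"
          using k0 by (simp add: power_mult_distrib power2_sum)
        ultimately show "\<kappa>\<^sup>2 + \<tau> * card A \<le> ((\<kappa> + sqrt \<tau>) * sqrt (real (card A)))\<^sup>2" by (simp add: distrib_right)
      qed (use k0 in auto)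
      then have "sqrt \<kappa> * sqrt (\<kappa>\<^sup>2 + \<tau> * card A) * sqrt L.sum_x4 \<le> sqrt \<kappa> * ((\<kappa> + sqrt \<tau>) * sqrt (real (card A))) * sqrt L.sum_x4"
        using k0 L.sum_x4_nonneg by (intro mult_right_mono mult_left_mono) auto
      then have "c * (L.lam * sqrt (L.var_scale A)) \<le> c * (L.lam * (sqrt \<kappa> * ((\<kappa> + sqrt \<tau>) * sqrt (real (card A))) * sqrt L.sum_x4))"
        unfolding L.var_scale_def real_sqrt_mult using abc(2) lam1 by (intro mult_left_mono) auto
      then show ?thesis unfolding e by (rule ennreal_leI)
    qed
    have d4: "ennreal (c * (L.lam * sqrt (L.Dsum A))) \<le> \<delta>4"
    proof -
      let ?r = "c * (L.lam * sqrt (L.Dsum A))"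
      have r0: "0 \<le> ?r" using abc(2) lam1 L.Dsum_nonneg by simp
      have "(\<Sum>k\<in>N_set n nb A. \<Sum>l\<in>N_idx n nb k \<union> nb k. ?L k * ?L l) = (\<Sum>k\<in>N_set n nb A. \<Sum>l\<in>N_idx n nb k \<union> nb k. ennreal (\<sigma>\<^sup>2 * (?x k * ?x l)))"
      proof (intro sum.cong refl)
        fix k l assume "k \<in> N_set n nb A" "l \<in> N_idx n nb k \<union> nb k"
        then have "k \<in> ?I" "l \<in> ?I" using L.NA_I L.Nb_I L.nb_I by blast+
        then show "?L k * ?L l = ennreal (\<sigma>\<^sup>2 * (?x k * ?x l))"
          using s0 by (simp add: Lx power2_eq_square ac_simps flip: ennreal_mult)
      qed
      also have "\<dots> = ennreal (\<sigma>\<^sup>2 * L.Dsum A)"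
        unfolding L.Dsum_def sum_distrib_left by (simp add: sum_nonneg)
      finally have "\<delta>4\<^sup>2 = ennreal (c\<^sup>2 / \<sigma>\<^sup>2) * (ennreal L.lam)\<^sup>2 * ennreal (\<sigma>\<^sup>2 * L.Dsum A)"
        unfolding delta4 L_lam by simp
      also have "\<dots> = ennreal (?r\<^sup>2)"
        using s0 lam1 L.Dsum_nonneg by (simp add: ennreal_power power_mult_distrib field_simps flip: ennreal_mult)
      finally have sq: "\<delta>4\<^sup>2 = ennreal (?r\<^sup>2)" .
      show ?thesis
      proof (cases \<delta>4)
        case (real r)
        then have "r\<^sup>2 = ?r\<^sup>2" using sq by (simp add: ennreal_power)
        then have "r = ?r" by (rule power2_eq_imp_eq[OF _ _ r0]) (use real in simp)
        then show ?thesis using real by simp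
      qed simp
    qed
    have Delta: "ennreal ((b - a) / 1500 + L.Delta A B c) \<le> ?sum"
    proof -
      note p = L.Delta_parts_nonneg(1)[OF A, of B] L.Delta_parts_nonneg(2-4)[OF A]
      have c0: "0 \<le> c" using abc(2) by simp
      have "ennreal ((b - a) / 1500 + L.Delta A B c) = ennreal ((b - a) / 1500) + ennreal (c * (\<Sum>m\<in>B. ?x m))
          + ennreal (c * (\<kappa>\<^sup>2 * L.sum_x3)) + ennreal (c * (L.lam * sqrt (L.var_scale A))) + ennreal (c * (L.lam * sqrt (L.Dsum A)))"
        using p c0 abc(1) unfolding L.Delta_def distrib_left by (simp add: add.assoc flip: ennreal_plus)
      also have "\<dots> \<le> ?sum" using d2 d3 d4 unfolding d1 by (intro add_mono order_refl)
      finally show ?thesis .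
    qed
    have Delta_pos: "0 < L.Delta A B c"
      using L.Delta_ge(1)[OF A abc(2), of B] L.kappa_pos L.sum_x3_pos by (smt (verit) mult_pos_pos zero_less_power)
    show ?thesis
    proof (cases "integrable M (\<lambda>\<omega>. \<bar>\<xi> \<omega>\<bar> powr (4 / 3))")
      case False
      then have "Lp_norm M (4 / 3) \<xi> = \<infinity>" by (rule Lp_norm_infinite[OF xi_meas])
      moreover have "?sum \<noteq> 0"
      proof
        assume "?sum = 0"
        then have "ennreal ((b - a) / 1500 + L.Delta A B c) \<le> 0" using Delta by (simp only:)
        moreover have "0 < (b - a) / 1500 + L.Delta A B c" using Delta_pos abc(1) by (intro add_nonneg_pos) auto
        ultimately show False by (simp add: ennreal_eq_0_iff)
      qed
      ultimately have "8755 * Lp_norm M (4 / 3) \<xi> * ?sum = \<infinity>" by (simp add: ennreal_mult_eq_top_iff)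
      then show ?thesis by simp
    next
      case True
      define v where "v \<omega> = root 3 (\<xi> \<omega>)" for \<omega>
      have v3: "v \<omega> ^ 3 = \<xi> \<omega>" for \<omega> unfolding v_def by (rule odd_real_root_pow) simp
      have v0: "0 \<le> v \<omega>" if "\<omega> \<in> space M" for \<omega> using xi(2)[OF that] by (simp add: v_def)
      have v4: "v \<omega> ^ 4 = \<bar>\<xi> \<omega>\<bar> powr (4 / 3)" if "\<omega> \<in> space M" for \<omega>
      proof (cases "v \<omega> = 0")
        case False
        then have vp: "0 < v \<omega>" using v0[OF that] by simp
        have "\<bar>\<xi> \<omega>\<bar> = v \<omega> powr 3" using vp xi(2)[OF that] v3[of \<omega>] by (simp add: powr_numeral)
        then have "\<bar>\<xi> \<omega>\<bar> powr (4 / 3) = v \<omega> powr 4" by (simp add: powr_powr)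
        then show ?thesis using vp by (simp add: powr_numeral)
      qed (use v3[of \<omega>] in simp)
      have xi_gen: "\<xi> \<in> borel_measurable (L.gen A)"
        unfolding xi(1)
      proof (rule measurable_compose[OF _ h], rule measurable_restrict)
        fix i assume i: "i \<in> A"
        have [measurable]: "Y i \<in> borel_measurable (L.gen A)" by (rule L.X_measurable_gen[OF i])
        have "(\<lambda>\<omega>. \<sigma> * Y i \<omega>) \<in> borel_measurable (L.gen A)" by measurable
        then show "X i \<in> borel_measurable (L.gen A)" using s0 by (simp add: Y_def)
      qed
      then have v_gen: "v \<in> borel_measurable (L.gen A)" unfolding v_def[abs_def] by measurable
      have vM: "v \<in> borel_measurable M" using xi_meas unfolding v_def[abs_def] by measurable
      define \<rho> where "\<rho> = root 4 (expectation (\<lambda>\<omega>. v \<omega> ^ 4))"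
      have v4i: "integrable M (\<lambda>\<omega>. v \<omega> ^ 4)" using True v4 by (subst Bochner_Integration.integrable_cong) auto
      have E4: "expectation (\<lambda>\<omega>. v \<omega> ^ 4) = expectation (\<lambda>\<omega>. \<bar>\<xi> \<omega>\<bar> powr (4 / 3))"
        by (rule Bochner_Integration.integral_cong) (auto simp: v4)
      have Lv: "L4_bound M v \<rho>" using vM v4i by (simp add: L4_bound_def \<rho>_def)
      have \<rho>0: "0 \<le> \<rho>" by (simp add: \<rho>_def)
      have norm: "Lp_norm M (4 / 3) \<xi> = ennreal (\<rho> ^ 3)"
      proof -
        have "Lp_norm M (4 / 3) \<xi> = ennreal ((\<rho> ^ 4) powr (3 / 4))"
          using Lp_norm_finite[OF xi_meas True] by (simp add: \<rho>_def flip: E4)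
        also have "(\<rho> ^ 4) powr (3 / 4) = \<rho> ^ 3" by (rule pow4_powr(2)[OF \<rho>0])
        finally show ?thesis .
      qed
      have hit: "?hit \<omega> = v \<omega> ^ 3 * L.hit A B a b c \<omega>" for \<omega>
      proof -
        have LS: "L.S A \<omega> = S \<omega> / \<sigma>" unfolding L.S_def S Y_def by (simp add: sum_divide_distrib)
        have LU: "L.U A \<omega> = (\<Sum>k\<in>N_set_compl n nb A. \<Sum>l\<in>N_set_compl n nb A \<inter> nb k. X k \<omega> * X l \<omega>) / \<sigma>\<^sup>2"
          unfolding L.U_def L.sum_pairs[where f="\<lambda>k l. Y k \<omega> * Y l \<omega>"] by (simp add: Y_def power2_eq_square sum_divide_distrib)
        have LV: "L.V A \<omega> = V \<omega> / \<sigma>" unfolding L.V_def LU V using psi_scale[OF s0] s0 by simp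
        have LT: "L.Tsq A \<omega> = 1 / \<sigma>\<^sup>2 * (\<Sum>k\<in>N_set n nb A. \<Sum>l\<in>nb k. \<bar>X k \<omega> * X l \<omega>\<bar>)
            + 1 / \<sigma>\<^sup>2 * (\<Sum>k\<in>N_set n nb A. \<Sum>l\<in>N_idx n nb k. \<bar>X k \<omega> * X l \<omega>\<bar>)"
          unfolding L.Tsq_def sum_distrib_left using s0 by (simp add: Y_def power2_eq_square abs_mult)
        have LQ: "L.Q A \<omega> = Q \<omega>" unfolding L.Q_def LT Q T ..
        have LW: "L.width A B c \<omega> = c * (\<Sum>m\<in>B. \<bar>X m \<omega>\<bar> / \<sigma>) + c * \<bar>S \<omega>\<bar> * Q \<omega> / \<sigma>"
          unfolding L.width_def LS LQ using s0 by (simp add: Y_def)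
        have ratio: "L.S A \<omega> / L.V A \<omega> = S \<omega> / V \<omega>" unfolding LS LV using s0 by simp
        show ?thesis unfolding v3 L.hit_def ratio LW eta zeta
          by (auto simp: indicator_def algebra_simps)
      qed
      have "L.concentration 8000" by (rule L.concentration_8000)
      from L.concentrationD[OF this A B(1) v_gen Lv v0 abc]
      have bound: "expectation (\<lambda>\<omega>. v \<omega> ^ 3 * L.hit A B a b c \<omega>) \<le> \<rho> ^ 3 * (2 * (b - a) + 8000 * L.Delta A B c)" .
      have int: "integrable M (\<lambda>\<omega>. v \<omega> ^ 3 * L.hit A B a b c \<omega>)"
      proof (rule Bochner_Integration.integrable_bound)
        show "integrable M (\<lambda>\<omega>. v \<omega> * v \<omega> * v \<omega> * 1)" by (rule L4_bound_mult4(1)[OF Lv Lv Lv L.L4_1])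
        show "(\<lambda>\<omega>. v \<omega> ^ 3 * L.hit A B a b c \<omega>) \<in> borel_measurable M" using vM L.hit_measurable[OF B(1)] by measurable
        show "AE \<omega> in M. norm (v \<omega> ^ 3 * L.hit A B a b c \<omega>) \<le> norm (v \<omega> * v \<omega> * v \<omega> * 1)"
          using L.hit_bounds by (intro AE_I2) (simp add: abs_mult mult_left_le power3_eq_cube)
      qed
      have "(\<integral>\<^sup>+ \<omega>. ennreal (?hit \<omega>) \<partial>M) = ennreal (expectation (\<lambda>\<omega>. v \<omega> ^ 3 * L.hit A B a b c \<omega>))"
        unfolding hit using int v0 L.hit_bounds(1) by (intro nn_integral_eq_integral) auto
      also have "\<dots> \<le> ennreal (8755 * \<rho> ^ 3 * ((b - a) / 1500 + L.Delta A B c))"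
      proof (rule ennreal_leI, rule order_trans[OF bound])
        have "\<rho> ^ 3 * (2 * (b - a) + 8000 * L.Delta A B c) \<le> \<rho> ^ 3 * (8755 * ((b - a) / 1500 + L.Delta A B c))"
        proof (rule mult_left_mono)
          show "2 * (b - a) + 8000 * L.Delta A B c \<le> 8755 * ((b - a) / 1500 + L.Delta A B c)"
            using Delta_pos abc(1) by argo
        qed (use \<rho>0 in simp)
        then show "\<rho> ^ 3 * (2 * (b - a) + 8000 * L.Delta A B c) \<le> 8755 * \<rho> ^ 3 * ((b - a) / 1500 + L.Delta A B c)"
          by (simp add: ac_simps)
      qed
      also have "\<dots> = 8755 * Lp_norm M (4 / 3) \<xi> * ennreal ((b - a) / 1500 + L.Delta A B c)"
        unfolding norm using \<rho>0 Delta_pos abc(1) by (simp add: ennreal_mult)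
      also have "\<dots> \<le> 8755 * Lp_norm M (4 / 3) \<xi> * ?sum" using Delta by (rule mult_left_mono) simp
      finally show ?thesis .
    qed
  qed
qed

end
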